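(* Let $0<\alpha<1$, let $\mathcal{H}$ be a (complex) Hilbert space and let $A$ be a positive self-adjoint operator on $\mathcal{H}$ with domain $D(A)$. Then for every $u_0\in D(A)$ there exists a unique strong solution $u$ of the problem $$D^{\alpha}u(t)=(-i)^{\alpha}Au(t),\quad t>0,\qquad u(0)=u_0,$$ where $D^\alpha$ is the Caputo fractional derivative of order $\alpha$. Moreover, there exist a measure space $(\Omega,\mu)$, a Borel measurable function $a$ on $\Omega$ and a unitary map $W:L^2(\Omega,\mu)\to\mathcal{H}$ such that the unique solution of this problem has the representation $$u(t)=W\big(E_{\alpha}((-it)^{\alpha}a(\cdot))\,W^{-1}u_0\big),\qquad t\ge 0.$$
   Context: Positive self-adjoint means: densely defined, possibly unbounded, self-adjoint, with $(Ax,x)\ge 0$ for all $x\in D(A)$. Notation: $(-i)^{\alpha}=e^{-i\alpha\pi/2}$ and $(-it)^{\alpha}=e^{-i\alpha\pi/2}t^{\alpha}$ for $t\ge0$. The Mittag-Leffler function is $E_{\alpha}(z)=\sum_{k=0}^{\infty}\frac{z^k}{\Gamma(\alpha k+1)}$, $z\in\mathbb{C}$. In the representation formula, $E_{\alpha}((-it)^{\alpha}a(\cdot))$ acts on $L^2(\Omega,\mu)$ by pointwise multiplication. For $\beta>0$, $t>0$ let $g_{\beta}(t)=t^{\beta-1}/\Gamma(\beta)$ and $(g_\beta*u)(t)=\int_0^t g_\beta(t-s)u(s)\,ds$. If $u\in C([0,\infty);\mathcal{H})$ and $g_{1-\alpha}*u\in C^1((0,\infty);\mathcal{H})$, the Caputo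 derivative of order $\alpha\in(0,1)$ is $$D^{\alpha}u(t)=\frac{d}{dt}(g_{1-\alpha}*u)(t)-u(0)g_{1-\alpha}(t)=\frac{1}{\Gamma(1-\alpha)}\left[\frac{d}{dt}\int_0^t(t-s)^{-\alpha}u(s)\,ds-\frac{u(0)}{t^{\alpha}}\right],\quad t>0.$$ Strong solution: for $u_0\in D(A)$, a function $u$ is a strong solution of the problem $D^{\alpha}u(t)=(-i)^{\alpha}Au(t)$ $(t>0)$, $u(0)=u_0$, if $u\in C([0,\infty);D(A))$ ($D(A)$ with the graph norm), $g_{1-\alpha}*u\in C^1((0,\infty);\mathcal{H})$, $u(0)=u_0$, and the equation holds for all $t>0$. *)

theory Defs
  imports "HOL-Analysis.Analysis"
begin

text \<open>Complex Hilbert spaces; the inner product is linear in its first argument.\<close>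

class complex_hilbert_space = banach +
  fixes scaleC :: "complex \<Rightarrow> 'a \<Rightarrow> 'a" (infixr "*\<^sub>C" 75)
    and cinner :: "'a \<Rightarrow> 'a \<Rightarrow> complex"
  assumes scaleC_add_right: "c *\<^sub>C (x + y) = c *\<^sub>C x + c *\<^sub>C y"
    and scaleC_add_left: "(c + d) *\<^sub>C x = c *\<^sub>C x + d *\<^sub>C x"
    and scaleC_scaleC: "c *\<^sub>C (d *\<^sub>C x) = (c * d) *\<^sub>C x"
    and scaleC_of_real: "complex_of_real r *\<^sub>C x = r *\<^sub>R x"
    and cinner_commute: "cinner x y = cnj (cinner y x)"
    and cinner_add_left: "cinner (x + y) z = cinner x z + cinner y z"
    and cinner_scaleC_left: "cinner (c *\<^sub>C x) y = c * cinner x y"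
    and cinner_self_nonneg: "0 \<le> Re (cinner x x)"
    and norm_eq_sqrt_cinner: "norm x = sqrt (Re (cinner x x))"

instantiation complex :: complex_hilbert_space
begin

definition scaleC_complex :: "complex \<Rightarrow> complex \<Rightarrow> complex" where
  "scaleC_complex c x = c * x"

definition cinner_complex :: "complex \<Rightarrow> complex \<Rightarrow> complex" where
  "cinner_complex x y = x * cnj y"

instance
  by standard
    (auto simp: scaleC_complex_def cinner_complex_def algebra_simps scaleR_conv_of_real
      cmod_def power2_eq_square)

end


text \<open>An unbounded operator is given by its domain \<open>D\<close> and a function \<open>A\<close>, whose values
  outside \<open>D\<close> are irrelevant.\<close>

definition linear_operator_on ::
    "'h::complex_hilbert_space set \<Rightarrow> ('h \<Rightarrow> 'h) \<Rightarrow> bool" where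
  "linear_operator_on D A \<longleftrightarrow>
     0 \<in> D \<and>
     (\<forall>x\<in>D. \<forall>y\<in>D. x + y \<in> D \<and> A (x + y) = A x + A y) \<and>
     (\<forall>c. \<forall>x\<in>D. c *\<^sub>C x \<in> D \<and> A (c *\<^sub>C x) = c *\<^sub>C A x)"

definition densely_defined :: "'h::complex_hilbert_space set \<Rightarrow> bool" where
  "densely_defined D \<longleftrightarrow> closure D = UNIV"

definition adjoint_domain ::
    "'h::complex_hilbert_space set \<Rightarrow> ('h \<Rightarrow> 'h) \<Rightarrow> 'h set" where
  "adjoint_domain D A = {y. \<exists>z. \<forall>x\<in>D. cinner (A x) y = cinner x z}"

text \<open>For \<open>y\<close> in the adjoint domain the described vector is unique when \<open>D\<close> is dense.\<close>

definition adjoint_op ::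
    "'h::complex_hilbert_space set \<Rightarrow> ('h \<Rightarrow> 'h) \<Rightarrow> 'h \<Rightarrow> 'h" where
  "adjoint_op D A y = (THE z. \<forall>x\<in>D. cinner (A x) y = cinner x z)"

definition self_adjoint ::
    "'h::complex_hilbert_space set \<Rightarrow> ('h \<Rightarrow> 'h) \<Rightarrow> bool" where
  "self_adjoint D A \<longleftrightarrow>
     linear_operator_on D A \<and> densely_defined D \<and>
     adjoint_domain D A = D \<and> (\<forall>x\<in>D. adjoint_op D A x = A x)"

definition positive_self_adjoint ::
    "'h::complex_hilbert_space set \<Rightarrow> ('h \<Rightarrow> 'h) \<Rightarrow> bool" where
  "positive_self_adjoint D A \<longleftrightarrow>
     self_adjoint D A \<and> (\<forall>x\<in>D. cinner (A x) x \<in> \<real> \<and> 0 \<le> Re (cinner (A x) x))"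

definition graph_norm :: "('h::complex_hilbert_space \<Rightarrow> 'h) \<Rightarrow> 'h \<Rightarrow> real" where
  "graph_norm A x = sqrt ((norm x)\<^sup>2 + (norm (A x))\<^sup>2)"


definition minus_i_powr :: "real \<Rightarrow> complex" where
  "minus_i_powr \<alpha> = exp (- \<i> * of_real (\<alpha> * pi / 2))"

definition minus_it_powr :: "real \<Rightarrow> real \<Rightarrow> complex" where
  "minus_it_powr \<alpha> t = minus_i_powr \<alpha> * of_real (t powr \<alpha>)"

definition mittag_leffler :: "real \<Rightarrow> complex \<Rightarrow> complex" where
  "mittag_leffler \<alpha> z = (\<Sum>k. z ^ k / of_real (Gamma (\<alpha> * real k + 1)))"


definition frac_kernel :: "real \<Rightarrow> real \<Rightarrow> real" where
  "frac_kernel \<beta> t = t powr (\<beta> - 1) / Gamma \<beta>"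

text \<open>The Bochner integral of the library requires a separable range, so vector-valued
  integrals are gauge integrals; they agree with the Bochner integral on all Bochner
  integrable functions, in particular on the product of an integrable scalar kernel with a
  continuous function.\<close>

definition frac_conv :: "real \<Rightarrow> (real \<Rightarrow> 'h::complex_hilbert_space) \<Rightarrow> real \<Rightarrow> 'h" where
  "frac_conv \<beta> u t = integral {0..t} (\<lambda>s. frac_kernel \<beta> (t - s) *\<^sub>R u s)"

definition caputo :: "real \<Rightarrow> (real \<Rightarrow> 'h::complex_hilbert_space) \<Rightarrow> real \<Rightarrow> 'h" where
  "caputo \<alpha> u t =
     vector_derivative (frac_conv (1 - \<alpha>) u) (at t) - frac_kernel (1 - \<alpha>) t *\<^sub>R u 0"

text \<open>Only the values of \<open>u\<close> on \<open>[0, \<infinity>)\<close> matter.\<close>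

definition strong_solution ::
    "real \<Rightarrow> 'h::complex_hilbert_space set \<Rightarrow> ('h \<Rightarrow> 'h) \<Rightarrow> 'h \<Rightarrow> (real \<Rightarrow> 'h) \<Rightarrow> bool" where
  "strong_solution \<alpha> D A u0 u \<longleftrightarrow>
     (\<forall>t\<ge>0. u t \<in> D) \<and>
     (\<forall>t\<ge>0. ((\<lambda>s. graph_norm A (u s - u t)) \<longlongrightarrow> 0) (at t within {0..})) \<and>
     frac_conv (1 - \<alpha>) u C1_differentiable_on {0<..} \<and>
     u 0 = u0 \<and>
     (\<forall>t>0. caputo \<alpha> u t = minus_i_powr \<alpha> *\<^sub>C A (u t))"


text \<open>The space $L^2(M)$ consists of almost-everywhere classes of complex-valued
  square-integrable functions.\<close>

definition square_integrable :: "'b measure \<Rightarrow> ('b \<Rightarrow> complex) set" where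
  "square_integrable M =
     {f \<in> borel_measurable M. integrable M (\<lambda>x. (cmod (f x))\<^sup>2)}"

definition L2_class :: "'b measure \<Rightarrow> ('b \<Rightarrow> complex) \<Rightarrow> ('b \<Rightarrow> complex) set" where
  "L2_class M f = {g \<in> square_integrable M. AE x in M. g x = f x}"

definition L2 :: "'b measure \<Rightarrow> ('b \<Rightarrow> complex) set set" where
  "L2 M = L2_class M ` square_integrable M"

text \<open>Pointwise multiplication by \<open>\<phi>\<close>. If the product is not square integrable, the result
  is the empty set, which is not an element of \<open>L2 M\<close>.\<close>

definition L2_mult ::
    "'b measure \<Rightarrow> ('b \<Rightarrow> complex) \<Rightarrow> ('b \<Rightarrow> complex) set \<Rightarrow> ('b \<Rightarrow> complex) set" where
  "L2_mult M \<phi> F = {h \<in> square_integrable M. \<exists>f\<in>F. AE x in M. h x = \<phi> x * f x}"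

definition unitary_L2 ::
    "'b measure \<Rightarrow> (('b \<Rightarrow> complex) set \<Rightarrow> 'h::complex_hilbert_space) \<Rightarrow> bool" where
  "unitary_L2 M W \<longleftrightarrow>
     bij_betw W (L2 M) UNIV \<and>
     (\<forall>f\<in>square_integrable M. \<forall>g\<in>square_integrable M.
        W (L2_class M (\<lambda>x. f x + g x)) = W (L2_class M f) + W (L2_class M g)) \<and>
     (\<forall>c. \<forall>f\<in>square_integrable M.
        W (L2_class M (\<lambda>x. c * f x)) = c *\<^sub>C W (L2_class M f)) \<and>
     (\<forall>f\<in>square_integrable M. \<forall>g\<in>square_integrable M.
        cinner (W (L2_class M f)) (W (L2_class M g)) = (LINT x|M. f x * cnj (g x)))"

end

theory Submission
  imports Defs "HOL-Probability.Probability" "HOL-Complex_Analysis.Complex_Analysis" "HOL-Real_Asymp.Real_Asymp"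
begin

text \<open>The resolvent \<open>B = (I + A)\<^sup>-\<^sup>1\<close> is an injective positive contraction. For a unit
  vector \<open>h\<close> the numbers \<open>\<langle>B\<^sup>n h, h\<rangle>\<close> are the moments of a probability measure on
  \<open>[0, 1]\<close>, and Zorn's lemma splits \<open>\<H>\<close> into orthogonal cyclic subspaces, so that \<open>B\<close>
  becomes multiplication by the real coordinate on the \<open>L\<^sup>2\<close> space of the direct sum of these
  measures, and \<open>A\<close> becomes multiplication by \<open>a = 1 / b - 1 \<ge> 0\<close>.

  The functions \<open>E\<^sub>\<alpha>((-it)\<^sup>\<alpha> a)\<close> are bounded uniformly in \<open>t, a \<ge> 0\<close>, because
  \<open>E\<^sub>\<alpha>((-it)\<^sup>\<alpha>) = exp (-it) / \<alpha> - \<integral> exp (i t exp v) \<kappa>(v) dv\<close> with an integrable kernel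
  \<open>\<kappa>\<close>: both sides have the same Laplace transform, by the residue theorem. Multiplication by
  them therefore defines bounded operators, and the scalar Volterra equation for \<open>E\<^sub>\<alpha>\<close>, read
  off its power series, yields the strong solution. For uniqueness, the difference of two
  solutions is tested against vectors in bounded spectral subspaces; there the Volterra
  equation can be iterated, and the iterates tend to \<open>0\<close>.\<close>

subsection \<open>Hilbert space geometry\<close>

text \<open>The arguments (-it)^\<alpha> a fill the ray of direction -\<alpha>\<pi>/2, which bounds
  the sector where E_\<alpha> grows exponentially. Estimating the power series term by term cannot
  give boundedness there; it has to come from an exact formula with one oscillating exponential of
  modulus 1 and an integrable remainder. Replacing t by t a^(1/\<alpha>) reduces every a \<ge> 0 to
  a = 1.

  The resolvent is preferred to A because all its powers act on all vectors, and because B and I - B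
  are commuting and positive, which is exactly Hausdorff's condition for a moment sequence. In the
  existence proof the unbounded multiplier x then occurs only as x / (1 + x).

  The Hilbert space need not be separable, so the direct sum of measures can have uncountably many
  summands and need not be \<sigma>-finite. Fubini is therefore never applied on it. Time integrals
  are moved past multiplication operators by Riemann sums, and limits are taken strongly, since
  E_\<alpha>((-it)^\<alpha> x) is continuous in t for each x but not uniformly in x.\<close>

lemma scaleC_one [simp]: "1 *\<^sub>C x = x"
  using scaleC_of_real[of 1 x] by simp

lemma scaleC_zero_left [simp]: "0 *\<^sub>C x = 0"
  using scaleC_of_real[of 0 x] by simp

lemma scaleC_zero_right [simp]: "c *\<^sub>C 0 = 0"
  using scaleC_add_right[of c 0 0] by simp

lemma scaleC_minus_one: "(-1) *\<^sub>C x = - x"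
  using scaleC_of_real[of "-1" x] by simp

lemma scaleC_minus_left: "(- c) *\<^sub>C x = - (c *\<^sub>C x)"
  using scaleC_scaleC[of "-1" c x] by (simp add: scaleC_minus_one)

lemma scaleC_minus_right: "c *\<^sub>C (- x) = - (c *\<^sub>C x)"
  using scaleC_scaleC[of c "-1" x] by (simp add: scaleC_minus_one scaleC_minus_left)

lemma scaleC_diff_right: "c *\<^sub>C (x - y) = c *\<^sub>C x - c *\<^sub>C y"
  using scaleC_add_right[of c x "- y"] by (simp add: scaleC_minus_right)

lemma scaleC_scaleR: "c *\<^sub>C (r *\<^sub>R x) = r *\<^sub>R (c *\<^sub>C x)"
  by (metis scaleC_of_real scaleC_scaleC mult.commute)

lemma cinner_add_right: "cinner x (y + z) = cinner x y + cinner x z"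
  by (metis cinner_commute cinner_add_left complex_cnj_add)

lemma cinner_scaleC_right: "cinner x (c *\<^sub>C y) = cnj c * cinner x y"
  by (metis cinner_commute cinner_scaleC_left complex_cnj_mult)

lemma cinner_scaleR_left: "cinner (r *\<^sub>R x) y = of_real r * cinner x y"
  by (metis cinner_scaleC_left scaleC_of_real)

lemma cinner_scaleR_right: "cinner x (r *\<^sub>R y) = of_real r * cinner x y"
  by (metis cinner_scaleC_right scaleC_of_real complex_cnj_complex_of_real)

lemma cinner_zero_left [simp]: "cinner 0 x = 0"
  using cinner_scaleR_left[of 0 0 x] by simp

lemma cinner_zero_right [simp]: "cinner x 0 = 0"
  using cinner_scaleR_right[of x 0 0] by simp

lemma cinner_minus_left: "cinner (- x) y = - cinner x y"
  using cinner_scaleR_left[of "-1" x y] by simp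

lemma cinner_minus_right: "cinner x (- y) = - cinner x y"
  using cinner_scaleR_right[of x "-1" y] by simp

lemma cinner_diff_left: "cinner (x - y) z = cinner x z - cinner y z"
  using cinner_add_left[of x "-y" z] by (simp add: cinner_minus_left)

lemma cinner_diff_right: "cinner x (y - z) = cinner x y - cinner x z"
  using cinner_add_right[of x y "-z"] by (simp add: cinner_minus_right)

lemmas cinner_simps = cinner_add_left cinner_add_right cinner_diff_left cinner_diff_right
  cinner_scaleC_left cinner_scaleC_right cinner_scaleR_left cinner_scaleR_right
  cinner_minus_left cinner_minus_right

lemma cinner_self: "cinner x x = of_real ((norm x)\<^sup>2)"
proof -
  have "Im (cinner x x) = 0"
    using arg_cong[OF cinner_commute[of x x], of Im] by simp
  then show ?thesis
    by (simp add: complex_eq_iff norm_eq_sqrt_cinner cinner_self_nonneg)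
qed

lemma norm_scaleC: "norm (c *\<^sub>C x) = cmod c * norm x"
proof -
  have "complex_of_real ((norm (c *\<^sub>C x))\<^sup>2) = c * cnj c * cinner x x"
    unfolding cinner_self[symmetric] cinner_scaleC_left cinner_scaleC_right by (simp only: mult_ac)
  also have "\<dots> = complex_of_real ((cmod c * norm x)\<^sup>2)"
    unfolding cinner_self complex_norm_square[symmetric] by (simp add: power_mult_distrib)
  finally have "(norm (c *\<^sub>C x))\<^sup>2 = (cmod c * norm x)\<^sup>2"
    by (simp only: of_real_eq_iff)
  then show ?thesis by (simp add: power2_eq_iff_nonneg)
qed

lemma norm_diff_sq: "(norm (x - y :: 'h::complex_hilbert_space))\<^sup>2
    = (norm x)\<^sup>2 + (norm y)\<^sup>2 - 2 * Re (cinner x y)"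
proof -
  have "cinner (x - y) (x - y) = cinner x x + cinner y y - cinner x y - cnj (cinner x y)"
    by (simp add: cinner_simps cinner_commute[of y x])
  then have "Re (cinner (x - y) (x - y)) = Re (cinner x x + cinner y y - cinner x y - cnj (cinner x y))"
    by (simp only:)
  then show ?thesis by (simp add: cinner_self del: of_real_power)
qed

lemma norm_add_sq: "(norm (x + y :: 'h::complex_hilbert_space))\<^sup>2
    = (norm x)\<^sup>2 + (norm y)\<^sup>2 + 2 * Re (cinner x y)"
  using norm_diff_sq[of x "- y"] by (simp add: cinner_simps)

lemma cinner_Cauchy_Schwarz: "cmod (cinner x y) \<le> norm x * norm y"
proof (cases "y = 0")
  case False
  \<comment> \<open>\<open>c *\<^sub>C y\<close> is the orthogonal projection of \<open>x\<close> to
    the line of \<open>y\<close>; the inequality says that the remainder has nonnegative square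
    norm.\<close>
  define c where "c = cinner x y / of_real ((norm y)\<^sup>2)"
  have ny: "(norm y)\<^sup>2 > 0" using False by simp
  have "0 \<le> (norm (x - c *\<^sub>C y))\<^sup>2" by simp
  also have "\<dots> = (norm x)\<^sup>2 + (cmod c * norm y)\<^sup>2 - 2 * Re (cnj c * cinner x y)"
    by (simp add: norm_diff_sq cinner_simps norm_scaleC)
  also have "cnj c * cinner x y = of_real ((cmod (cinner x y))\<^sup>2 / (norm y)\<^sup>2)"
    unfolding c_def using complex_norm_square[of "cinner x y"] by (simp add: mult.commute)
  also have "(cmod c * norm y)\<^sup>2 = (cmod (cinner x y))\<^sup>2 / (norm y)\<^sup>2"
    unfolding c_def using ny by (simp add: norm_divide norm_mult power2_eq_square)
  finally have "(cmod (cinner x y))\<^sup>2 / (norm y)\<^sup>2 \<le> (norm x)\<^sup>2"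
    by (simp del: of_real_divide of_real_power)
  then have "(cmod (cinner x y))\<^sup>2 \<le> (norm x * norm y)\<^sup>2"
    using ny by (simp add: field_simps)
  then show ?thesis by (rule power2_le_imp_le) simp
qed simp

lemma bounded_linear_cinner_left: "bounded_linear (\<lambda>x. cinner x y)"
  by (rule bounded_linear_intro[of _ "norm y"])
    (simp_all add: cinner_simps scaleR_conv_of_real cinner_Cauchy_Schwarz)

lemma bounded_linear_cinner_right: "bounded_linear (\<lambda>y. cinner x y)"
  by (rule bounded_linear_intro[of _ "norm x"])
    (simp_all add: cinner_simps scaleR_conv_of_real, metis cinner_Cauchy_Schwarz mult.commute)

lemma bounded_linear_scaleC: "bounded_linear (\<lambda>x. c *\<^sub>C x)"
  by (rule bounded_linear_intro[of _ "cmod c"])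
    (simp_all add: scaleC_add_right scaleC_scaleR norm_scaleC)

lemmas tendsto_cinner_left = bounded_linear.tendsto[OF bounded_linear_cinner_left]
lemmas tendsto_cinner_right = bounded_linear.tendsto[OF bounded_linear_cinner_right]
lemmas tendsto_scaleC = bounded_linear.tendsto[OF bounded_linear_scaleC]

section \<open>Orthogonal complements and the Riesz theorem\<close>

definition csubspace :: "'h::complex_hilbert_space set \<Rightarrow> bool" where
  "csubspace K \<longleftrightarrow> 0 \<in> K \<and> (\<forall>x\<in>K. \<forall>y\<in>K. x + y \<in> K) \<and> (\<forall>c. \<forall>x\<in>K. c *\<^sub>C x \<in> K)"

lemma csubspace_closure:
  assumes "csubspace K" shows "csubspace (closure K)"
  unfolding csubspace_def
proof (intro conjI ballI allI)
  show "0 \<in> closure K" using assms closure_subset unfolding csubspace_def by blast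
next
  fix x y assume "x \<in> closure K" "y \<in> closure K"
  then obtain f g where "\<forall>n. f n \<in> K" "f \<longlonglongrightarrow> x" "\<forall>n. g n \<in> K" "g \<longlonglongrightarrow> y"
    unfolding closure_sequential by blast
  then have "\<forall>n. f n + g n \<in> K" "(\<lambda>n. f n + g n) \<longlonglongrightarrow> x + y"
    using assms by (auto simp: csubspace_def intro: tendsto_add)
  then show "x + y \<in> closure K" unfolding closure_sequential by (intro exI[of _ "\<lambda>n. f n + g n"]) simp
next
  fix c x assume "x \<in> closure K"
  then obtain f where "\<forall>n. f n \<in> K" "f \<longlonglongrightarrow> x"
    unfolding closure_sequential by blast
  then have "\<forall>n. c *\<^sub>C f n \<in> K" "(\<lambda>n. c *\<^sub>C f n) \<longlonglongrightarrow> c *\<^sub>C x"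
    using assms by (auto simp: csubspace_def intro: tendsto_scaleC)
  then show "c *\<^sub>C x \<in> closure K"
    unfolding closure_sequential by (intro exI[of _ "\<lambda>n. c *\<^sub>C f n"]) simp
qed

text \<open>By the parallelogram law a minimising sequence for the distance to \<open>K\<close> is Cauchy.\<close>

theorem orthogonal_vector_exists:
  fixes K :: "'h::complex_hilbert_space set"
  assumes K: "csubspace K" "closed K" "K \<noteq> UNIV"
  obtains y where "y \<noteq> 0" "\<And>x. x \<in> K \<Longrightarrow> cinner x y = 0"
proof -
  obtain z where z: "z \<notin> K" using K by auto
  have K0: "K \<noteq> {}" "0 \<in> K" using K by (auto simp: csubspace_def)
  define d where "d = infdist z K"
  have d: "d \<le> norm (z - x)" if "x \<in> K" for x
    using infdist_le[OF that, of z] by (simp add: d_def dist_norm)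
  have d0: "0 \<le> d" by (simp add: d_def infdist_nonneg)
  have "\<exists>x\<in>K. norm (z - x) < d + 1 / Suc n" for n
  proof (rule ccontr)
    assume "\<not> ?thesis"
    then have "d + 1 / Suc n \<le> infdist z K"
      unfolding infdist_notempty[OF K0(1)] dist_norm
      by (intro cINF_greatest) (use K0 in \<open>auto simp: not_less\<close>)
    then show False by (simp add: d_def)
  qed
  then obtain k where k: "\<And>n. k n \<in> K" "\<And>n. norm (z - k n) < d + 1 / Suc n" by metis
  have par: "(norm (k m - k n))\<^sup>2 \<le> 2 * (norm (z - k m))\<^sup>2 + 2 * (norm (z - k n))\<^sup>2 - 4 * d\<^sup>2" for m n
  proof -
    \<comment> \<open>The midpoint stays in \<open>K\<close>, so its distance to \<open>z\<close> is
      at least \<open>d\<close>; in the parallelogram law this bounds the difference of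
      \<open>k m\<close> and \<open>k n\<close>.\<close>
    define mid where "mid = (1/2) *\<^sub>C (k m + k n)"
    have "mid \<in> K" using K k unfolding csubspace_def mid_def by blast
    then have "d \<le> norm (z - mid)" by (rule d)
    then have "d\<^sup>2 \<le> (norm (z - mid))\<^sup>2" using d0 by (rule power_mono)
    moreover have "(z - k m) + (z - k n) = 2 *\<^sub>R (z - mid)"
      using scaleC_of_real[of "1/2" "k m + k n"] by (simp add: mid_def algebra_simps scaleR_2)
    then have "(norm ((z - k m) + (z - k n)))\<^sup>2 = 4 * (norm (z - mid))\<^sup>2"
      by (simp add: power_mult_distrib)
    moreover have "(norm (k m - k n))\<^sup>2 = (norm ((z - k n) - (z - k m)))\<^sup>2" by simp
    ultimately show ?thesis
      unfolding norm_add_sq norm_diff_sq[of "z - k n"]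
      using cinner_commute[of "z - k n" "z - k m"] by simp
  qed
  have "Cauchy k"
  proof (rule metric_CauchyI)
    fix e :: real assume e: "0 < e"
    \<comment> \<open>This is the right-hand side of \<open>par\<close> when both distances are at
      most d + 1 / (n + 1).\<close>
    have "(\<lambda>n. 4 * (d + 1 / Suc n)\<^sup>2 - 4 * d\<^sup>2) \<longlonglongrightarrow> 4 * (d + 0)\<^sup>2 - 4 * d\<^sup>2"
      by (intro tendsto_intros LIMSEQ_Suc lim_const_over_n[of 1, simplified])
    then have "\<forall>\<^sub>F n in sequentially. 4 * (d + 1 / Suc n)\<^sup>2 - 4 * d\<^sup>2 < e\<^sup>2"
      by (rule order_tendstoD) (use e in simp)
    then obtain N where N: "4 * (d + 1 / Suc N)\<^sup>2 - 4 * d\<^sup>2 < e\<^sup>2"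
      by (auto simp: eventually_sequentially)
    have kk: "(norm (z - k n))\<^sup>2 \<le> (d + 1 / Suc N)\<^sup>2" if "N \<le> n" for n
    proof (rule power_mono)
      have "1 / real (Suc n) \<le> 1 / Suc N" using that by (intro divide_left_mono) auto
      then show "norm (z - k n) \<le> d + 1 / Suc N" using k(2)[of n] by linarith
    qed simp
    have "dist (k m) (k n) < e" if "N \<le> m" "N \<le> n" for m n
    proof -
      have "(norm (k m - k n))\<^sup>2 < e\<^sup>2"
        using par[of m n] kk[OF that(1)] kk[OF that(2)] N by linarith
      then show ?thesis using e unfolding dist_norm by (rule_tac power2_less_imp_less) auto
    qed
    then show "\<exists>M. \<forall>m\<ge>M. \<forall>n\<ge>M. dist (k m) (k n) < e" by blast
  qed
  then obtain l where l: "k \<longlonglongrightarrow> l" using Cauchy_convergent convergent_def by blast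
  have lK: "l \<in> K" using K(2) k(1) l closed_sequentially by blast
  have "(\<lambda>n. norm (z - k n)) \<longlonglongrightarrow> norm (z - l)" by (intro tendsto_intros l)
  moreover have "(\<lambda>n. d + 1 / Suc n) \<longlonglongrightarrow> d + 0"
    by (intro tendsto_intros LIMSEQ_Suc lim_const_over_n[of 1, simplified])
  ultimately have "norm (z - l) \<le> d + 0"
    by (rule LIMSEQ_le) (use k(2) less_imp_le in blast)
  then have dl: "norm (z - l) \<le> norm (z - x)" if "x \<in> K" for x using d[OF that] by simp
  show ?thesis
  proof (rule that[of "z - l"])
    show "z - l \<noteq> 0" using z lK by auto
    fix x assume x: "x \<in> K"
    show "cinner x (z - l) = 0"
    proof (cases "x = 0")
      case False
      \<comment> \<open>Moving \<open>l\<close> by the projection of \<open>z - l\<close> to the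
        line of \<open>x\<close> lowers the squared distance by |(z - l, x)|^2 / |x|^2, so
        minimality forces the inner product to vanish.\<close>
      define c where "c = cinner (z - l) x / of_real ((norm x)\<^sup>2)"
      have nx: "(norm x)\<^sup>2 > 0" using False by simp
      have "l + c *\<^sub>C x \<in> K" using K x lK unfolding csubspace_def by blast
      from dl[OF this] have "(norm (z - l))\<^sup>2 \<le> (norm ((z - l) - c *\<^sub>C x))\<^sup>2"
        by (intro power_mono) (auto simp: algebra_simps)
      also have "\<dots> = (norm (z - l))\<^sup>2 + (cmod c * norm x)\<^sup>2 - 2 * Re (cnj c * cinner (z - l) x)"
        unfolding norm_diff_sq[of "z - l" "c *\<^sub>C x"] cinner_scaleC_right norm_scaleC ..
      also have "cnj c * cinner (z - l) x = of_real ((cmod (cinner (z - l) x))\<^sup>2 / (norm x)\<^sup>2)"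
        unfolding c_def using complex_norm_square[of "cinner (z - l) x"] by (simp add: mult.commute)
      also have "(cmod c * norm x)\<^sup>2 = (cmod (cinner (z - l) x))\<^sup>2 / (norm x)\<^sup>2"
        unfolding c_def using nx by (simp add: norm_divide norm_mult power2_eq_square)
      finally have "(cmod (cinner (z - l) x))\<^sup>2 / (norm x)\<^sup>2 \<le> 0"
        by (simp del: of_real_divide of_real_power)
      then have "cinner (z - l) x = 0" using nx by (simp add: divide_le_0_iff)
      then show ?thesis using cinner_commute[of x "z - l"] by simp
    qed simp
  qed
qed

text \<open>The kernel of a nonzero \<open>F\<close> is a proper closed subspace. A vector
  \<open>y\<close> orthogonal to it spans the complement, because x - (F x / F y) y lies in the
  kernel; only the scaling of \<open>y\<close> remains to be fixed.\<close>

theorem riesz_representation: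
  fixes F :: "'h::complex_hilbert_space \<Rightarrow> complex"
  assumes add: "\<And>x y. F (x + y) = F x + F y"
    and scale: "\<And>c x. F (c *\<^sub>C x) = c * F x"
    and bound: "\<And>x. cmod (F x) \<le> C * norm x"
  obtains z where "\<And>x. F x = cinner x z"
proof (cases "\<forall>x. F x = 0")
  case True
  then show ?thesis by (intro that[of 0]) simp
next
  case False
  have bl: "bounded_linear F"
  proof (rule bounded_linear_intro[of _ C])
    show "F (r *\<^sub>R x) = r *\<^sub>R F x" for r x
      using scale[of "of_real r" x] by (simp add: scaleC_of_real scaleR_conv_of_real)
  qed (use add bound in \<open>auto simp: mult.commute\<close>)
  have "closed (F -` {0})"
    using bl by (intro closed_vimage) (auto simp: linear_continuous_on)
  moreover have "csubspace (F -` {0})"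
    using add scale scale[of 0 0] by (auto simp: csubspace_def)
  moreover have "F -` {0} \<noteq> UNIV" using False by auto
  ultimately obtain y where y: "y \<noteq> 0" "\<And>x. x \<in> F -` {0} \<Longrightarrow> cinner x y = 0"
    using orthogonal_vector_exists by metis
  have Fy: "F y \<noteq> 0" using y(2)[of y] y(1) by (auto simp: cinner_self)
  \<comment> \<open>The conjugate compensates for conjugate linearity in the second
    argument.\<close>
  define z where "z = cnj (F y / of_real ((norm y)\<^sup>2)) *\<^sub>C y"
  have "F x = cinner x z" for x
  proof -
    have "F (x + (- (F x / F y)) *\<^sub>C y) = 0" using Fy by (simp add: add scale del: scaleC_minus_left)
    then have "cinner (x + (- (F x / F y)) *\<^sub>C y) y = 0" by (intro y(2)) simp
    then have "cinner x y = F x / F y * of_real ((norm y)\<^sup>2)"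
      by (simp add: cinner_simps cinner_self)
    then show ?thesis using Fy y(1) by (simp add: z_def cinner_simps)
  qed
  then show ?thesis by (rule that)
qed

subsection \<open>The resolvent\<close>

text \<open>Density makes the representing vector unique: the difference of two candidates is
  orthogonal to \<open>D\<close>, hence to itself.\<close>

lemma adjoint_op_eqI:
  assumes dense: "densely_defined D" and y: "\<And>x. x \<in> D \<Longrightarrow> cinner (A x) y = cinner x z"
  shows "adjoint_op D A y = z"
  unfolding adjoint_op_def
proof (rule the_equality)
  show "\<forall>x\<in>D. cinner (A x) y = cinner x z" using y by blast
  fix z' assume z': "\<forall>x\<in>D. cinner (A x) y = cinner x z'"
  have eq: "cinner x (z' - z) = 0" if "x \<in> D" for x
    using z' y that by (simp add: cinner_simps)
  obtain f where f: "\<forall>n. f n \<in> D" "f \<longlonglongrightarrow> z' - z"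
    using dense unfolding densely_defined_def closure_sequential[symmetric]
    by (metis UNIV_I closure_sequential)
  have "(\<lambda>n. cinner (f n) (z' - z)) \<longlonglongrightarrow> cinner (z' - z) (z' - z)"
    by (rule tendsto_cinner_left[OF f(2)])
  then have "cinner (z' - z) (z' - z) = 0"
    using eq f(1) by (simp add: LIMSEQ_const_iff)
  then show "z' = z" by (simp add: cinner_self)
qed

lemma self_adjoint_symmetric:
  assumes sa: "self_adjoint D A" and "x \<in> D" "y \<in> D"
  shows "cinner (A x) y = cinner x (A y)"
proof -
  obtain z where z: "\<forall>x\<in>D. cinner (A x) y = cinner x z"
    using assms unfolding self_adjoint_def adjoint_domain_def by blast
  then have "adjoint_op D A y = z"
    using sa by (intro adjoint_op_eqI) (auto simp: self_adjoint_def)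
  then show ?thesis using z assms by (simp add: self_adjoint_def)
qed

text \<open>This is where self-adjointness goes beyond symmetry: a weak identity alone yields
  membership in the domain. It is used for the range of I + A, once to see that it is closed and
  once to see that nothing is orthogonal to it.\<close>

lemma self_adjoint_memI:
  assumes sa: "self_adjoint D A" and y: "\<And>x. x \<in> D \<Longrightarrow> cinner (A x) y = cinner x z"
  shows "y \<in> D" "A y = z"
proof -
  show "y \<in> D" using assms unfolding self_adjoint_def adjoint_domain_def by blast
  then show "A y = z"
    using adjoint_op_eqI[of D A y z] assms by (auto simp: self_adjoint_def)
qed

text \<open>Positivity gives |x|^2 + |A x|^2 \<le> |x + A x|^2, so I + A is injective and its
  inverse is bounded on the range. The range is closed because A is, and a vector \<open>y\<close>
  orthogonal to it would satisfy A y = - y, which contradicts positivity unless y = 0.\<close>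

theorem resolvent_exists:
  fixes A :: "'h::complex_hilbert_space \<Rightarrow> 'h"
  assumes psa: "positive_self_adjoint D A"
  obtains B where
    "\<And>w. B w \<in> D" "\<And>w. B w + A (B w) = w" "\<And>x. x \<in> D \<Longrightarrow> B (x + A x) = x"
    "\<And>x y. B (x + y) = B x + B y" "\<And>c x. B (c *\<^sub>C x) = c *\<^sub>C B x"
    "\<And>x y. cinner (B x) y = cinner x (B y)"
    "\<And>x. norm (B x) \<le> norm x" "\<And>x. (norm (B x))\<^sup>2 \<le> Re (cinner (B x) x)"
proof -
  have sa: "self_adjoint D A" and lin: "linear_operator_on D A"
    and pos: "\<And>x. x \<in> D \<Longrightarrow> 0 \<le> Re (cinner (A x) x)"
    using psa unfolding positive_self_adjoint_def self_adjoint_def by simp_all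
  have D: "0 \<in> D" "\<And>x y. x \<in> D \<Longrightarrow> y \<in> D \<Longrightarrow> x + y \<in> D" "\<And>c x. x \<in> D \<Longrightarrow> c *\<^sub>C x \<in> D"
    and A: "\<And>x y. x \<in> D \<Longrightarrow> y \<in> D \<Longrightarrow> A (x + y) = A x + A y"
      "\<And>c x. x \<in> D \<Longrightarrow> A (c *\<^sub>C x) = c *\<^sub>C A x"
    using lin unfolding linear_operator_on_def by simp_all
  have Dm: "x - y \<in> D" "A (x - y) = A x - A y" if "x \<in> D" "y \<in> D" for x y
    using D(2)[of x "(-1) *\<^sub>C y"] D(3)[of y "-1"] A(1)[of x "(-1) *\<^sub>C y"] A(2)[of y "-1"] that
    by (simp_all add: scaleC_minus_one)
  have big: "(norm x)\<^sup>2 + (norm (A x))\<^sup>2 \<le> (norm (x + A x))\<^sup>2" if "x \<in> D" for x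
    unfolding norm_add_sq using pos[OF that] cinner_commute[of x "A x"] by (metis add.commute add_increasing2 complex_cnj cnj.sel(1) le_add_same_cancel1 mult_nonneg_nonneg zero_le_numeral)
  have bigx: "norm x \<le> norm (x + A x)" and bigA: "norm (A x) \<le> norm (x + A x)" if "x \<in> D" for x
    using big[OF that] zero_le_power2[of "norm (A x)"] zero_le_power2[of "norm x"]
    by (smt (verit) norm_ge_zero power2_le_imp_le)+
  define R where "R = (\<lambda>x. x + A x) ` D"
  have "csubspace R"
    unfolding csubspace_def
  proof (intro conjI ballI allI)
    have "A 0 = 0" using A(2)[of 0 0] D by simp
    then show "0 \<in> R" using D(1) unfolding R_def by force
  next
    fix x y assume "x \<in> R" "y \<in> R"
    then obtain x' y' where "x' \<in> D" "y' \<in> D" "x = x' + A x'" "y = y' + A y'" by (auto simp: R_def)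
    then show "x + y \<in> R" unfolding R_def
      by (intro image_eqI[of _ _ "x' + y'"]) (auto simp: A D)
  next
    fix c x assume "x \<in> R"
    then obtain x' where "x' \<in> D" "x = x' + A x'" by (auto simp: R_def)
    then show "c *\<^sub>C x \<in> R" unfolding R_def
      by (intro image_eqI[of _ _ "c *\<^sub>C x'"]) (auto simp: A D scaleC_add_right)
  qed
  moreover have "closed R"
    unfolding closed_sequential_limits
  proof (intro allI impI, elim conjE)
    fix f w assume f: "\<forall>n. f n \<in> R" and fw: "f \<longlonglongrightarrow> w"
    then have "\<forall>n. \<exists>x. x \<in> D \<and> f n = x + A x" unfolding R_def by blast
    then obtain x where x: "\<And>n. x n \<in> D" "\<And>n. f n = x n + A (x n)" by metis
    have Cf: "Cauchy f" using fw by (rule LIMSEQ_imp_Cauchy)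
    have "norm (x m - x n) \<le> norm (f m - f n)" for m n
      using bigx[OF Dm(1)[OF x(1) x(1)], of m n] Dm(2)[OF x(1) x(1), of m n] x(2)
      by (simp add: algebra_simps)
    then have "Cauchy x"
      using Cf unfolding Cauchy_def dist_norm by (meson order_le_less_trans)
    then obtain l where l: "x \<longlonglongrightarrow> l" using Cauchy_convergent convergent_def by blast
    have Al: "(\<lambda>n. A (x n)) \<longlonglongrightarrow> w - l"
      using tendsto_diff[OF fw l] by (simp add: x(2))
    \<comment> \<open>Closedness of A, in weak form: the limits of \<open>x n\<close> and
      \<open>A (x n)\<close> satisfy the defining identity of the adjoint.\<close>
    have "cinner (A y) l = cinner y (w - l)" if "y \<in> D" for y
    proof (rule LIMSEQ_unique)
      show "(\<lambda>n. cinner (A y) (x n)) \<longlonglongrightarrow> cinner (A y) l" by (rule tendsto_cinner_right[OF l])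
      show "(\<lambda>n. cinner (A y) (x n)) \<longlonglongrightarrow> cinner y (w - l)"
        using tendsto_cinner_right[OF Al, of y] self_adjoint_symmetric[OF sa that x(1)] by simp
    qed
    from self_adjoint_memI[OF sa this] have "l \<in> D" "A l = w - l" by auto
    then show "w \<in> R" unfolding R_def by (intro image_eqI[of _ _ l]) auto
  qed
  moreover have "y = 0" if y: "\<And>x. x \<in> R \<Longrightarrow> cinner x y = 0" for y
  proof -
    have "cinner (A x) y = cinner x (- y)" if "x \<in> D" for x
    proof -
      have "cinner (x + A x) y = 0" using that by (intro y) (auto simp: R_def)
      then show ?thesis by (simp add: cinner_simps add_eq_0_iff)
    qed
    from self_adjoint_memI[OF sa this] have "y \<in> D" "A y = - y" by auto
    then have "(norm y)\<^sup>2 \<le> 0" using pos[of y] by (simp add: cinner_simps cinner_self del: of_real_power)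
    then show ?thesis by simp
  qed
  ultimately have "R = UNIV" using orthogonal_vector_exists[of R] by metis
  then have "\<forall>w. \<exists>x. x \<in> D \<and> x + A x = w" unfolding R_def by (metis UNIV_I image_iff)
  then obtain B where B: "\<And>w. B w \<in> D" "\<And>w. B w + A (B w) = w" by metis
  have BI: "B w = x" if "x \<in> D" "x + A x = w" for x w
  proof -
    have "norm (B w - x) \<le> norm ((B w - x) + A (B w - x))" by (intro bigx Dm B that)
    also have "(B w - x) + A (B w - x) = (B w + A (B w)) - (x + A x)"
      unfolding Dm(2)[OF B(1) that(1)] by simp
    also have "\<dots> = 0" unfolding B(2) that(2) by simp
    finally have "norm (B w - x) \<le> 0" by simp
    then show ?thesis by simp
  qed
  \<comment> \<open>Substituting x = B x + A (B x) leaves the nonnegative term (B x, A (B x)). The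
    resulting inequality says that B - B^2 is positive, which the mixed moments of B and I - B need
    later.\<close>
  have sq: "(norm (B x))\<^sup>2 \<le> Re (cinner (B x) x)" for x
  proof -
    have "cinner (B x) x = cinner (B x) (B x + A (B x))" by (simp only: B(2))
    also have "\<dots> = cinner (B x) (B x) + cinner (B x) (A (B x))" by (rule cinner_add_right)
    also have "cinner (B x) (A (B x)) = cnj (cinner (A (B x)) (B x))" by (rule cinner_commute)
    finally show ?thesis using pos[OF B(1), of x] by (simp add: cinner_self del: of_real_power)
  qed
  show ?thesis
  proof (rule that[of B])
    show "B (x + y) = B x + B y" for x y
    proof (rule BI)
      have "B x + B y + A (B x + B y) = (B x + A (B x)) + (B y + A (B y))"
        by (simp add: A(1) B(1))
      also have "\<dots> = x + y" by (simp only: B(2))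
      finally show "B x + B y + A (B x + B y) = x + y" .
    qed (intro D B)
    show "B (c *\<^sub>C x) = c *\<^sub>C B x" for c x
    proof (rule BI)
      have "c *\<^sub>C B x + A (c *\<^sub>C B x) = c *\<^sub>C (B x + A (B x))"
        by (simp add: A(2) B(1) scaleC_add_right)
      also have "\<dots> = c *\<^sub>C x" by (simp only: B(2))
      finally show "c *\<^sub>C B x + A (c *\<^sub>C B x) = c *\<^sub>C x" .
    qed (intro D B)
    show "cinner (B x) y = cinner x (B y)" for x y
    proof -
      have "cinner (B x) y = cinner (B x) (B y + A (B y))" by (simp only: B(2))
      also have "\<dots> = cinner (B x + A (B x)) (B y)"
        using self_adjoint_symmetric[OF sa B(1) B(1), of x y] by (simp add: cinner_simps)
      also have "\<dots> = cinner x (B y)" by (simp only: B(2))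
      finally show ?thesis .
    qed
    show "norm (B x) \<le> norm x" for x using bigx[OF B(1), of x] by (simp only: B(2))
    show "B (x + A x) = x" if "x \<in> D" for x using BI[OF that refl] .
  qed (rule B sq)+
qed

subsection \<open>Moment problems\<close>

text \<open>A complex density is determined by its moments: polynomials, then continuous functions
  by Weierstrass, then half-lines by ramps, then Borel sets by a Dynkin argument. The variable
  \<open>\<beta>\<close> is kept general so that the statement covers both the spectral measures,
  with the identity, and Laplace transforms, with exp (-|t|).\<close>

theorem moments_zero_imp_integral_zero:
  fixes g :: "'x \<Rightarrow> complex" and \<beta> :: "'x \<Rightarrow> real"
  assumes g: "integrable N g"
    and \<beta> [measurable]: "\<beta> \<in> borel_measurable N"
    and AE01: "AE x in N. 0 \<le> \<beta> x \<and> \<beta> x \<le> 1"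
    and moments: "\<And>n. (LINT x|N. g x * of_real (\<beta> x ^ n)) = 0"
    and E: "E \<in> sets borel"
  shows "(LINT x|N. g x * indicator E (\<beta> x)) = 0"
proof -
  have g_meas [measurable]: "g \<in> borel_measurable N" using g by auto
  have int: "integrable N (\<lambda>x. g x * of_real (\<phi> (\<beta> x)))"
    if [measurable]: "\<phi> \<in> borel_measurable borel" and "\<And>y. 0 \<le> y \<Longrightarrow> y \<le> 1 \<Longrightarrow> \<bar>\<phi> y\<bar> \<le> C"
    for \<phi> :: "real \<Rightarrow> real" and C
  proof (rule Bochner_Integration.integrable_bound)
    show "integrable N (\<lambda>x. C * norm (g x))" using g by simp
    show "AE x in N. norm (g x * of_real (\<phi> (\<beta> x))) \<le> norm (C * norm (g x))"
      using AE01
    proof eventually_elim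
      case (elim x)
      then have "norm (g x) * \<bar>\<phi> (\<beta> x)\<bar> \<le> norm (g x) * C"
        using that(2)[of "\<beta> x"] by (intro mult_left_mono) auto
      also have "\<dots> \<le> norm (C * norm (g x))" by (simp add: mult.commute)
      finally show ?case by (simp add: norm_mult)
    qed
  qed simp
  have poly: "(LINT x|N. g x * of_real (p (\<beta> x))) = 0"
    if pp: "real_polynomial_function p" for p :: "real \<Rightarrow> real"
  proof -
    obtain a n where p: "p = (\<lambda>x. \<Sum>i\<le>n. a i * x ^ i)"
      using pp unfolding real_polynomial_function_iff_sum by blast
    have "(LINT x|N. g x * of_real (p (\<beta> x))) =
        (LINT x|N. (\<Sum>i\<le>n. of_real (a i) * (g x * of_real (\<beta> x ^ i))))"
      by (simp add: p sum_distrib_left mult_ac)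
    also have "\<dots> = (\<Sum>i\<le>n. LINT x|N. of_real (a i) * (g x * of_real (\<beta> x ^ i)))"
      by (intro Bochner_Integration.integral_sum integrable_mult_right int[where C = 1])
        (auto simp: power_le_one)
    also have "\<dots> = 0" by (simp add: moments del: of_real_power)
    finally show ?thesis .
  qed
  have cont: "(LINT x|N. g x * of_real (\<phi> (\<beta> x))) = 0"
    if c: "continuous_on UNIV \<phi>" for \<phi> :: "real \<Rightarrow> real"
  proof -
    define G where "G = (LINT x|N. norm (g x))"
    have G0: "G \<ge> 0" by (simp add: G_def)
    have c': "continuous_on {0..1} \<phi>" using c continuous_on_subset by blast
    have [measurable]: "\<phi> \<in> borel_measurable borel"
      using c by (rule borel_measurable_continuous_onI)
    have "bounded (\<phi> ` {0..1})"
      using c' compact_continuous_image compact_imp_bounded by blast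
    then obtain C where "\<forall>y\<in>{0..1}. \<bar>\<phi> y\<bar> \<le> C"
      unfolding bounded_iff by auto
    then have C: "\<bar>\<phi> y\<bar> \<le> C" if "0 \<le> y" "y \<le> 1" for y using that by simp
    have bnd: "norm (LINT x|N. g x * of_real (\<phi> (\<beta> x))) \<le> e * G" if e: "0 < e" for e
    proof -
      obtain p where p: "real_polynomial_function p" "\<And>y. y \<in> {0..1} \<Longrightarrow> \<bar>\<phi> y - p y\<bar> < e"
        using Stone_Weierstrass_real_polynomial_function[OF _ c' e] by auto
      have cp: "continuous_on UNIV p"
        using p(1) by (intro continuous_on_polymonial_function) (simp add: real_polynomial_function_eq)
      then have [measurable]: "p \<in> borel_measurable borel"
        by (rule borel_measurable_continuous_onI)
      have "bounded (p ` {0..1})"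
        using cp continuous_on_subset compact_continuous_image compact_imp_bounded by blast
      then obtain C' where "\<forall>y\<in>{0..1}. \<bar>p y\<bar> \<le> C'"
        unfolding bounded_iff by auto
      then have C': "\<bar>p y\<bar> \<le> C'" if "0 \<le> y" "y \<le> 1" for y using that by simp
      have i: "integrable N (\<lambda>x. g x * of_real (\<phi> (\<beta> x)))" "integrable N (\<lambda>x. g x * of_real (p (\<beta> x)))"
        using int[of \<phi> C] int[of p C'] C C' by auto
      have "(LINT x|N. g x * of_real (\<phi> (\<beta> x))) =
          (LINT x|N. g x * of_real (\<phi> (\<beta> x)) - g x * of_real (p (\<beta> x)))"
        using poly[OF p(1)] i by simp
      also have "norm \<dots> \<le> (LINT x|N. e * norm (g x))"
      proof (rule order_trans[OF integral_norm_bound integral_mono_AE])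
        show "AE x in N. norm (g x * of_real (\<phi> (\<beta> x)) - g x * of_real (p (\<beta> x))) \<le> e * norm (g x)"
          using AE01
        proof eventually_elim
          case (elim x)
          have "norm (g x * of_real (\<phi> (\<beta> x)) - g x * of_real (p (\<beta> x)))
              = norm (g x) * \<bar>\<phi> (\<beta> x) - p (\<beta> x)\<bar>"
            by (metis norm_mult norm_of_real of_real_diff right_diff_distrib)
          also have "\<dots> \<le> norm (g x) * e"
            using p(2)[of "\<beta> x"] elim by (intro mult_left_mono) auto
          finally show ?case by (simp add: mult.commute)
        qed
      qed (use i g in auto)
      also have "\<dots> = e * G" by (simp add: G_def)
      finally show ?thesis .
    qed
    have "norm (LINT x|N. g x * of_real (\<phi> (\<beta> x))) \<le> 0 + e" if "0 < e" for e
    proof -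
      \<comment> \<open>The denominator G + 1 also works when the total mass \<open>G\<close> is
        zero.\<close>
      have "e / (G + 1) * G \<le> e" using G0 that by (simp add: field_simps)
      then show ?thesis
        using bnd[of "e / (G + 1)"] G0 that by (simp del: times_divide_eq_left)
    qed
    then have "norm (LINT x|N. g x * of_real (\<phi> (\<beta> x))) \<le> 0"
      by (rule field_le_epsilon)
    then show ?thesis by simp
  qed
  have int_ind: "integrable N (\<lambda>x. g x * indicator E (\<beta> x))" if [measurable]: "E \<in> sets borel" for E
    by (rule Bochner_Integration.integrable_bound[OF g]) (auto simp: indicator_def)
  have tot: "(LINT x|N. g x) = 0" using moments[of 0] by simp
  have sb: "sigma_sets UNIV (range (\<lambda>a::real. {..a})) = sets borel"
    by (simp add: borel_eq_atMost sets_measure_of_conv)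
  have "Int_stable (range (\<lambda>a::real. {..a}))"
    by (auto simp: Int_stable_def)
  moreover have "range (\<lambda>a::real. {..a}) \<subseteq> Pow UNIV" by simp
  moreover have "E \<in> sigma_sets UNIV (range (\<lambda>a::real. {..a}))"
    using E by (simp add: sb)
  ultimately show ?thesis
  proof (induction rule: sigma_sets_induct_disjoint)
    case (basic E)
    then obtain a where E: "E = {..a}" by auto
    \<comment> \<open>A ramp of slope -j that is 1 up to \<open>a\<close> and reaches 0 at a + 1/j;
      it tends pointwise to the indicator of the half-line.\<close>
    define \<phi> where "\<phi> j y = max 0 (min 1 (1 - real j * (y - a)))" for j y
    have "(\<lambda>j. LINT x|N. g x * of_real (\<phi> j (\<beta> x))) \<longlonglongrightarrow> (LINT x|N. g x * indicator E (\<beta> x))"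
    proof (rule integral_dominated_convergence[where w = "\<lambda>x. norm (g x)"])
      show "integrable N (\<lambda>x. norm (g x))" using g by simp
      show "AE x in N. norm (g x * of_real (\<phi> j (\<beta> x))) \<le> norm (g x)" for j
        by (auto simp: \<phi>_def norm_mult intro!: AE_I2 mult_left_le)
      show "AE x in N. (\<lambda>j. g x * of_real (\<phi> j (\<beta> x))) \<longlonglongrightarrow> g x * indicator E (\<beta> x)"
      proof (intro AE_I2 tendsto_mult tendsto_const)
        fix x
        show "(\<lambda>j. of_real (\<phi> j (\<beta> x)) :: complex) \<longlonglongrightarrow> indicator E (\<beta> x)"
        proof (cases "\<beta> x \<le> a")
          case True
          then have "\<phi> j (\<beta> x) = 1" for j
            by (auto simp: \<phi>_def mult_nonneg_nonpos)
          then show ?thesis using True by (simp add: E)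
        next
          case False
          obtain J :: nat where J: "1 / (\<beta> x - a) \<le> real J" using real_arch_simple by blast
          have "\<phi> j (\<beta> x) = 0" if "J \<le> j" for j
          proof -
            have "1 / (\<beta> x - a) \<le> real j" using J that by linarith
            then have "1 \<le> real j * (\<beta> x - a)" using False by (simp add: field_simps)
            then show ?thesis by (simp add: \<phi>_def)
          qed
          then have "\<forall>\<^sub>F j in sequentially. (of_real (\<phi> j (\<beta> x)) :: complex) = 0"
            unfolding eventually_sequentially by (intro exI[of _ J]) simp
          then have "(\<lambda>j. of_real (\<phi> j (\<beta> x)) :: complex) \<longlonglongrightarrow> 0"
            by (rule tendsto_eventually)
          then show ?thesis using False by (simp add: E)
        qed
      qed
    qed (auto simp: E \<phi>_def)
    moreover have "(LINT x|N. g x * of_real (\<phi> j (\<beta> x))) = 0" for j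
      by (rule cont) (auto simp: \<phi>_def intro!: continuous_intros)
    ultimately show ?case by (simp add: LIMSEQ_const_iff)
  next
    case empty
    show ?case by simp
  next
    case (compl E)
    then have E: "E \<in> sets borel" by (simp add: sb)
    have "(LINT x|N. g x * indicator (UNIV - E) (\<beta> x)) = (LINT x|N. g x - g x * indicator E (\<beta> x))"
      by (intro Bochner_Integration.integral_cong) (auto simp: indicator_def)
    also have "\<dots> = 0" using int_ind[OF E] g compl tot by simp
    finally show ?case .
  next
    case (union F)
    then have F [measurable]: "F i \<in> sets borel" for i by (simp add: sb image_subset_iff)
    have fin: "(LINT x|N. g x * indicator (\<Union>i<n. F i) (\<beta> x)) = 0" for n
    proof -
      have "indicator (\<Union>i<n. F i) y = (\<Sum>i<n. indicator (F i) y :: complex)" for y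
        using union(1) by (intro indicator_UN_disjoint) (auto intro: disjoint_family_on_mono)
      then have "(LINT x|N. g x * indicator (\<Union>i<n. F i) (\<beta> x)) = (LINT x|N. (\<Sum>i<n. g x * indicator (F i) (\<beta> x)))"
        by (simp add: sum_distrib_left)
      also have "\<dots> = 0" using union(3) int_ind[OF F] by (subst Bochner_Integration.integral_sum) auto
      finally show ?thesis .
    qed
    have "(\<lambda>n. LINT x|N. g x * indicator (\<Union>i<n. F i) (\<beta> x)) \<longlonglongrightarrow> (LINT x|N. g x * indicator (\<Union>i. F i) (\<beta> x))"
    proof (rule integral_dominated_convergence[where w = "\<lambda>x. norm (g x)"])
      show "integrable N (\<lambda>x. norm (g x))" using g by simp
      show "AE x in N. norm (g x * indicator (\<Union>i<n. F i) (\<beta> x)) \<le> norm (g x)" for n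
        by (auto simp: indicator_def)
      show "AE x in N. (\<lambda>n. g x * indicator (\<Union>i<n. F i) (\<beta> x)) \<longlonglongrightarrow> g x * indicator (\<Union>i. F i) (\<beta> x)"
        by (intro AE_I2 tendsto_mult tendsto_const LIMSEQ_indicator_UN)
    qed (use int_ind[THEN borel_measurable_integrable, of "\<Union>i<_. F i"]
        int_ind[THEN borel_measurable_integrable, of "\<Union>i. F i"] in auto)
    then show ?case by (simp add: fin LIMSEQ_const_iff)
  qed
qed

text \<open>Read \<open>c k j\<close> as the integral of x^k (1 - x)^j. The recursion is then x + (1
  - x) = 1, and the identity is the expansion of (x + (1 - x))^N, proved with Pascal's rule.\<close>

lemma bernstein_sum_eq:
  fixes c :: "nat \<Rightarrow> nat \<Rightarrow> real"
  assumes rec: "\<And>k j. c (Suc k) j + c k (Suc j) = c k j"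
  shows "(\<Sum>i\<le>N. real (N choose i) * c (m + i) (j + (N - i))) = c m j"
proof (induction N arbitrary: m j)
  case (Suc N)
  have "(\<Sum>i\<le>Suc N. real (Suc N choose i) * c (m + i) (j + (Suc N - i)))
      = c m (j + Suc N) + (\<Sum>i\<le>N. real (Suc N choose Suc i) * c (m + Suc i) (j + (N - i)))"
    by (subst sum.atMost_Suc_shift) simp
  also have "(\<Sum>i\<le>N. real (Suc N choose Suc i) * c (m + Suc i) (j + (N - i)))
      = (\<Sum>i\<le>N. real (N choose i) * c (Suc m + i) (j + (N - i)))
        + (\<Sum>i\<le>N. real (N choose Suc i) * c (m + Suc i) (j + (N - i)))"
    by (simp add: sum.distrib[symmetric] ring_distribs)
  also have "(\<Sum>i\<le>N. real (N choose Suc i) * c (m + Suc i) (j + (N - i)))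
      = (\<Sum>i<N. real (N choose Suc i) * c (m + Suc i) (Suc j + (N - Suc i)))"
    by (simp add: lessThan_Suc_atMost[symmetric] Suc_diff_Suc)
  also have "c m (j + Suc N) + ((\<Sum>i\<le>N. real (N choose i) * c (Suc m + i) (j + (N - i)))
        + (\<Sum>i<N. real (N choose Suc i) * c (m + Suc i) (Suc j + (N - Suc i))))
      = (\<Sum>i\<le>N. real (N choose i) * c (Suc m + i) (j + (N - i)))
        + (\<Sum>i\<le>N. real (N choose i) * c (m + i) (Suc j + (N - i)))"
    by (simp add: sum.atMost_shift)
  also have "\<dots> = c m j"
    unfolding Suc.IH by (rule rec)
  finally show ?case .
qed simp

text \<open>The quotient of binomials is the product of (k - i) / (n - i) for i < m. Each factor is
  within m / (n - m) of k / n, and since all factors are bounded by 1 the difference of the products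
  is at most the sum of the differences.\<close>

lemma binomial_ratio_approx:
  fixes n m k :: nat
  assumes "2 * m < n" "k \<le> n"
  shows "\<bar>(real k / real n) ^ m - real (k choose m) / real (n choose m)\<bar> \<le> real m * (real m / real (n - m))"
proof -
  have "real (k choose m) / real (n choose m)
      = (\<Prod>i<m. real k - real i) / (\<Prod>i<m. real n - real i)"
    unfolding binomial_gbinomial gbinomial_prod_rev by (simp add: atLeast0LessThan)
  also have "\<dots> = (\<Prod>i<m. (real k - real i) / (real n - real i))"
    by (simp add: prod_dividef)
  finally have eq: "real (k choose m) / real (n choose m) = (\<Prod>i<m. (real k - real i) / (real n - real i))" .
  have "norm ((\<Prod>i<m. real k / real n) - (\<Prod>i<m. (real k - real i) / (real n - real i)))
      \<le> (\<Sum>i<m. norm (real k / real n - (real k - real i) / (real n - real i)))"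
  proof (rule norm_prod_diff)
    fix i assume "i \<in> {..<m}"
    then have i: "i < m" by simp
    \<comment> \<open>The case k < i needs 2 m < n: then i - k \<le> i < n - i.\<close>
    have "\<bar>real k - real i\<bar> \<le> real n - real i" using i assms by linarith
    moreover have "0 < real n - real i" using i assms by simp
    ultimately show "norm ((real k - real i) / (real n - real i)) \<le> 1"
      by (simp add: divide_le_eq_1)
    show "norm (real k / real n) \<le> 1" using assms by simp
  qed
  also have "\<dots> \<le> (\<Sum>i<m. real m / real (n - m))"
  proof (rule sum_mono)
    fix i assume "i \<in> {..<m}"
    then have i: "i < m" by simp
    have pos: "0 < real n" "0 < real n - real i" using i assms by auto
    have d: "real k / real n - (real k - real i) / (real n - real i)
        = (real i / (real n - real i)) * ((real n - real k) / real n)"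
      using pos by (simp add: field_simps)
    have "norm (real k / real n - (real k - real i) / (real n - real i))
        = (real i / (real n - real i)) * ((real n - real k) / real n)"
      unfolding d using pos assms by simp
    also have "\<dots> \<le> (real i / (real n - real i)) * 1"
      using pos assms by (intro mult_left_mono) auto
    also have "\<dots> \<le> real m / real (n - m)"
      using i assms by (simp, intro frac_le) (auto simp: of_nat_diff)
    finally show "norm (real k / real n - (real k - real i) / (real n - real i)) \<le> real m / real (n - m)" .
  qed
  finally show ?thesis by (simp add: eq)
qed

text \<open>The Bernstein weights \<open>(n choose k) c k (n - k)\<close> at the points \<open>k / n\<close> form probability
  measures whose moments converge; Helly's theorem provides the limit measure.\<close>

theorem hausdorff_moment_problem:
  fixes c :: "nat \<Rightarrow> nat \<Rightarrow> real"
  assumes rec: "\<And>k j. c (Suc k) j + c k (Suc j) = c k j"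
    and nonneg: "\<And>k j. 0 \<le> c k j" and one: "c 0 0 = 1"
  obtains \<mu> :: "real measure" where "prob_space \<mu>" "sets \<mu> = sets borel"
    "AE x in \<mu>. 0 \<le> x \<and> x \<le> 1" "\<And>m. (LINT x|\<mu>. x ^ m) = c m 0"
proof -
  define w where "w n k = real (n choose k) * c k (n - k)" for n k
  define P where "P n = point_measure {..n} (\<lambda>k. ennreal (w n k))" for n
  define \<mu> where "\<mu> n = distr (P n) borel (\<lambda>k. real k / real n)" for n
  have w0: "0 \<le> w n k" for n k by (simp add: w_def nonneg)
  have w1: "(\<Sum>k\<le>n. w n k) = 1" for n
    using bernstein_sum_eq[of c n 0 0] rec one by (simp add: w_def)
  have meas: "(\<lambda>k. real k / real n) \<in> measurable (P n) borel" for n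
    by (simp add: P_def point_measure_def)
  have integral_\<mu>: "(LINT x|\<mu> n. f x) = (\<Sum>k\<le>n. w n k * f (real k / real n))"
    if [measurable]: "f \<in> borel_measurable borel" for f :: "real \<Rightarrow> real" and n
  proof -
    have "(LINT x|\<mu> n. f x) = (LINT k|P n. f (real k / real n))"
      unfolding \<mu>_def by (rule integral_distr[OF meas]) simp
    also have "\<dots> = (\<Sum>k\<le>n. w n k * f (real k / real n))"
      unfolding P_def by (subst lebesgue_integral_point_measure_finite) (auto simp: w0)
    finally show ?thesis .
  qed
  have em: "emeasure (\<mu> n) (space (\<mu> n)) = 1" for n
  proof -
    have "emeasure (\<mu> n) (space (\<mu> n)) = emeasure (P n) (space (P n))"
      unfolding \<mu>_def by (simp add: emeasure_distr[OF meas])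
    also have "\<dots> = (\<Sum>k\<le>n. ennreal (w n k))"
      unfolding P_def by (simp add: space_point_measure emeasure_point_measure_finite)
    also have "\<dots> = 1" using w0 w1 by (simp add: sum_ennreal)
    finally show ?thesis .
  qed
  have rd: "real_distribution (\<mu> n)" for n
    unfolding real_distribution_def real_distribution_axioms_def
    using em by (auto intro: prob_spaceI simp: \<mu>_def)
  \<comment> \<open>All mass sits on the points k / n of [0, 1]; for n = 0 the only point is 0 / 0 =
    0. The half-open interval has the shape that tightness is stated with.\<close>
  have big: "1 - \<epsilon> < measure (\<mu> n) {-1<..1}" if \<epsilon>: "0 < \<epsilon>" for \<epsilon> :: real and n
  proof -
    interpret real_distribution "\<mu> n" by (rule rd)
    have "measure (\<mu> n) {-1<..1} = (LINT x|\<mu> n. indicator {-1<..1} x)" by simp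
    also have "\<dots> = (\<Sum>k\<le>n. w n k * indicator {-1<..1} (real k / real n))"
      by (rule integral_\<mu>) simp
    also have "\<dots> = (\<Sum>k\<le>n. w n k * 1)"
    proof (intro sum.cong refl arg_cong[of _ _ "\<lambda>x. w n _ * x"])
      fix k assume "k \<in> {..n}"
      then have "real k / real n \<le> 1" by (cases "n = 0") auto
      moreover have "-1 < real k / real n" by (rule less_le_trans[of _ 0]) auto
      ultimately show "indicator {-1<..1} (real k / real n) = (1 :: real)" by simp
    qed
    finally show ?thesis using \<epsilon> w1 by simp
  qed
  have "tight \<mu>"
    unfolding tight_def
  proof (intro conjI allI impI rd)
    fix \<epsilon> :: real assume "0 < \<epsilon>"
    then show "\<exists>a b. a < b \<and> (\<forall>n. 1 - \<epsilon> < measure (\<mu> n) {a<..b})"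
      by (intro exI[of _ "-1"] exI[of _ 1]) (use big in auto)
  qed
  from tight_imp_convergent_subsubsequence[OF this strict_mono_id] obtain r M where
    r: "strict_mono (r :: nat \<Rightarrow> nat)" and M: "real_distribution M" and wc: "weak_conv_m (\<mu> \<circ> r) M"
    by auto
  interpret M: real_distribution M by (rule M)
  \<comment> \<open>Clamping to [0, 1] makes the powers bounded and continuous on the whole line, as
    weak convergence requires. Taking the image of the limit under \<open>cl\<close> also puts it on
    [0, 1], with no argument about its support.\<close>
  define cl :: "real \<Rightarrow> real" where "cl x = max 0 (min 1 x)" for x
  have cl_cont: "continuous_on UNIV cl" unfolding cl_def by (intro continuous_intros)
  then have [measurable]: "cl \<in> borel_measurable borel" by (rule borel_measurable_continuous_onI)
  have "(\<lambda>n. LINT x|(\<mu> \<circ> r) n. cl x ^ m) \<longlonglongrightarrow> (LINT x|M. cl x ^ m)" for m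
  proof (rule weak_conv_imp_integral_bdd_continuous_conv[OF _ M wc])
    show "isCont (\<lambda>x. cl x ^ m) x" for x
      using cl_cont by (auto simp: continuous_on_eq_continuous_at intro!: continuous_intros)
    show "norm (cl x ^ m) \<le> 1" for x
      by (auto simp: cl_def norm_power intro!: power_le_one)
  qed (use rd in auto)
  moreover have "(\<lambda>n. LINT x|(\<mu> \<circ> r) n. cl x ^ m) \<longlonglongrightarrow> c m 0" for m
  proof -
    have "(\<lambda>n. LINT x|\<mu> n. cl x ^ m) \<longlonglongrightarrow> c m 0"
    proof (rule Lim_transform2)
      show "(\<lambda>n. c m 0) \<longlonglongrightarrow> c m 0" by simp
      have "\<forall>\<^sub>F n in sequentially. norm (c m 0 - (LINT x|\<mu> n. cl x ^ m)) \<le> real m * (real m / real (n - m))"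
        using eventually_gt_at_top[of "2 * m"]
      proof eventually_elim
        case (elim n)
        \<comment> \<open>With binomial quotients in place of powers the sum equals
          \<open>c m 0\<close> exactly, for every n > 2 m; the moment of \<open>\<mu> n\<close>
          differs from it only by the error of \<open>binomial_ratio_approx\<close>.\<close>
        have "(\<Sum>k\<le>n. w n k * (real (k choose m) / real (n choose m)))
            = (\<Sum>k\<in>{m..n}. w n k * (real (k choose m) / real (n choose m)))"
          by (rule sum.mono_neutral_right) auto
        also have "\<dots> = (\<Sum>i\<in>{0..n - m}. w n (m + i) * (real ((m + i) choose m) / real (n choose m)))"
          using elim by (intro sum.reindex_bij_witness[of _ "\<lambda>i. m + i" "\<lambda>k. k - m"]) auto
        also have "\<dots> = (\<Sum>i\<le>n - m. real ((n - m) choose i) * c (m + i) (0 + ((n - m) - i)))"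
        proof (intro sum.cong)
          fix i assume "i \<in> {..n - m}"
          then have i: "m + i \<le> n" using elim by auto
          have "(n choose (m + i)) * ((m + i) choose m) = (n choose m) * ((n - m) choose i)"
            using choose_mult[of m "m + i" n] i by simp
          then have "real (n choose (m + i)) * real ((m + i) choose m) = real (n choose m) * real ((n - m) choose i)"
            by (metis of_nat_mult)
          moreover have "real (n choose m) \<noteq> 0" using elim by simp
          ultimately show "w n (m + i) * (real ((m + i) choose m) / real (n choose m))
              = real ((n - m) choose i) * c (m + i) (0 + ((n - m) - i))"
            by (simp add: w_def field_simps)
        qed auto
        also have "\<dots> = c m 0" by (rule bernstein_sum_eq) (rule rec)
        finally have cm: "c m 0 = (\<Sum>k\<le>n. w n k * (real (k choose m) / real (n choose m)))" ..
        have cl_id: "cl (real k / real n) = real k / real n" if "k \<le> n" for k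
          using that by (cases "n = 0") (auto simp: cl_def)
        have "(LINT x|\<mu> n. cl x ^ m) = (\<Sum>k\<le>n. w n k * (cl (real k / real n)) ^ m)"
          by (rule integral_\<mu>) simp
        also have "\<dots> = (\<Sum>k\<le>n. w n k * (real k / real n) ^ m)"
          by (intro sum.cong) (auto simp: cl_id)
        finally have "(LINT x|\<mu> n. cl x ^ m) - c m 0
            = (\<Sum>k\<le>n. w n k * ((real k / real n) ^ m - real (k choose m) / real (n choose m)))"
          by (simp add: cm sum_subtractf right_diff_distrib)
        also have "norm \<dots> \<le> (\<Sum>k\<le>n. w n k * (real m * (real m / real (n - m))))"
          using binomial_ratio_approx[OF elim] w0
          by (intro sum_norm_le) (simp add: abs_mult mult_left_mono del: times_divide_eq_right)
        also have "\<dots> = real m * (real m / real (n - m))"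
          by (simp only: sum_distrib_right[symmetric] w1 mult_1)
        finally show ?case by (simp only: norm_minus_commute)
      qed
      moreover have "(\<lambda>n. real m * (real m / real (n - m))) \<longlonglongrightarrow> 0"
      proof (rule tendsto_mult_right_zero)
        have "(\<lambda>n. real m / real n) \<longlonglongrightarrow> 0" by (rule lim_const_over_n)
        then show "(\<lambda>n. real m / real (n - m)) \<longlonglongrightarrow> 0"
          by (rule filterlim_compose) (rule filterlim_minus_const_nat_at_top)
      qed
      ultimately show "(\<lambda>n. c m 0 - (LINT x|\<mu> n. cl x ^ m)) \<longlonglongrightarrow> 0"
        by (rule Lim_null_comparison)
    qed
    from LIMSEQ_subseq_LIMSEQ[OF this r] show ?thesis by (simp add: comp_def)
  qed
  ultimately have mom: "(LINT x|M. cl x ^ m) = c m 0" for m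
    by (rule LIMSEQ_unique)
  show ?thesis
  proof (rule that[of "distr M borel cl"])
    show "prob_space (distr M borel cl)" by (rule M.prob_space_distr) simp
    show "AE x in distr M borel cl. 0 \<le> x \<and> x \<le> 1"
      by (subst AE_distr_iff) (auto simp: cl_def)
    show "(LINT x|distr M borel cl. x ^ m) = c m 0" for m
      by (subst integral_distr) (auto simp: mom)
  qed simp
qed

subsection \<open>A Stieltjes transform\<close>

lemma contour_integral_linepath_same_Im:
  assumes "a < b"
  shows "contour_integral (linepath (Complex a c) (Complex b c)) f = integral {a..b} (\<lambda>x. f (Complex x c))"
proof -
  have "contour_integral (linepath (Complex a c) (Complex b c)) f =
         (Complex b c - Complex a c) * integral {0..1} (\<lambda>x. f (linepath (Complex a c) (Complex b c) x))"
    by (simp add: contour_integral_integral)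
  also have "Complex b c - Complex a c = of_real (b - a)"
    by (simp add: complex_eq_iff)
  also have "integral {0..1} (\<lambda>x. f (linepath (Complex a c) (Complex b c) x)) =
             integral {0..1} (\<lambda>x. f (Complex (a + (b - a) * x) c))"
    by (simp add: linepath_def Complex_eq scaleR_conv_of_real algebra_simps)
  also have "\<dots> = integral {0..(b - a) / (b - a)} (\<lambda>x. f (Complex (a + (b - a) * x) c))"
    using \<open>a < b\<close> by simp
  also have "{0..(b - a) / (b - a)} = (\<lambda>x. x / (b - a)) ` {0..b - a}"
    using \<open>a < b\<close> by simp
  also have "integral \<dots> (\<lambda>x. f (Complex (a + (b - a) * x) c)) =
             integral {a-a..b-a} (\<lambda>x. f (Complex (x + a) c)) / of_real (b - a)"
    using \<open>a < b\<close> by (subst integral_stretch_real) (auto simp: scaleR_conv_of_real add_ac)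
  also have "\<dots> = integral {a..b} (\<lambda>x. f (Complex x c)) / of_real (b - a)"
    by (subst integral_shift_real_ivl) (rule refl)
  finally show ?thesis
    using \<open>a < b\<close> by simp
qed

context
  fixes \<alpha> p :: real
  assumes \<alpha>: "0 < \<alpha>" "\<alpha> < 1" and p: "1 < p"
begin

text \<open>The substitution \<open>\<zeta> = exp w\<close> turns the plane slit along the negative axis into the
  strip \<open>\<bar>Im w\<bar> < \<pi>\<close>. The difference of the boundary values of the following function on the
  two sides of the strip is the integrand of the Stieltjes transform.\<close>

definition strip_fun :: "complex \<Rightarrow> complex" where
  "strip_fun w = exp (of_real \<alpha> * w) / (exp (of_real \<alpha> * w) - 1) / (of_real p + \<i> * exp w)"

text \<open>The logarithm of i p, where p + i exp w vanishes.\<close>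

definition strip_pole :: complex where "strip_pole = Complex (ln p) (pi / 2)"

text \<open>An open neighbourhood of the closed strip |Im w| \<le> \<pi> that holds just two poles.
  The next zeros of p + i exp w have imaginary part -3\<pi>/2 and 5\<pi>/2, the first one exactly on
  the excluded boundary; the nonzero solutions of exp (\<alpha> w) = 1 have height at least
  2\<pi>/\<alpha>, which exceeds 2\<pi>.\<close>

definition strip_dom :: "complex set" where "strip_dom = {w. - (3/2 * pi) < Im w \<and> Im w < 3/2 * pi}"

lemma strip_domI: "- pi \<le> Im w \<Longrightarrow> Im w \<le> pi \<Longrightarrow> w \<in> strip_dom"
  using pi_gt_zero unfolding strip_dom_def mem_Collect_eq by linarith

lemma exp_strip_pole: "exp strip_pole = \<i> * of_real p"
proof -
  have "exp strip_pole = of_real (exp (ln p)) * cis (pi / 2)"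
    unfolding strip_pole_def exp_eq_polar by simp
  then show ?thesis using p by simp
qed

lemma strip_zero1:
  assumes "w \<in> strip_dom" "exp (of_real \<alpha> * w) = 1" shows "w = 0"
proof -
  obtain n :: int where n: "Re (of_real \<alpha> * w) = 0" "Im (of_real \<alpha> * w) = of_int (2 * n) * pi"
    using assms(2) unfolding exp_eq_1 by blast
  have "\<bar>of_int (2 * n) * pi\<bar> = \<alpha> * \<bar>Im w\<bar>"
    using n(2)[symmetric] \<alpha> by (simp add: abs_mult)
  also have "\<dots> \<le> 1 * \<bar>Im w\<bar>" using \<alpha> by (intro mult_right_mono) auto
  also have "\<dots> < 2 * pi" using assms(1) pi_gt_zero by (auto simp: strip_dom_def)
  finally have "\<bar>of_int (2 * n) * pi\<bar> < 2 * pi" .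
  then have "\<bar>real_of_int n\<bar> < 1" using pi_gt_zero by (simp add: abs_mult)
  then have "n = 0" by simp
  then show ?thesis using n \<alpha> by (simp add: complex_eq_iff)
qed

lemma strip_zero2:
  assumes "w \<in> strip_dom" "of_real p + \<i> * exp w = 0" shows "w = strip_pole"
proof -
  have "exp w = - \<i> * (\<i> * exp w)" by simp
  also have "\<i> * exp w = - of_real p" using assms(2) by (simp add: add_eq_0_iff)
  finally have "exp w = exp strip_pole" by (simp add: exp_strip_pole)
  then obtain n :: int where n: "w = strip_pole + (of_int (2 * n) * pi) * \<i>"
    unfolding exp_eq by blast
  then have "Im w = pi / 2 + 2 * real_of_int n * pi" by (simp add: strip_pole_def)
  then have "- (3/2 * pi) < pi / 2 + 2 * real_of_int n * pi" "pi / 2 + 2 * real_of_int n * pi < 3/2 * pi"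
    using assms(1) by (auto simp: strip_dom_def)
  then have "- 2 * pi < 2 * real_of_int n * pi" "2 * real_of_int n * pi < 1 * pi" by linarith+
  then have "- 2 < 2 * real_of_int n" "2 * real_of_int n < 1"
    using pi_gt_zero by (simp_all only: mult_less_cancel_right_pos)
  then have "n = 0" by linarith
  then show ?thesis using n by simp
qed

section \<open>Residues and the rectangular contour\<close>

lemma strip_fun_residue_0: "residue strip_fun 0 = 1 / (of_real \<alpha> * (of_real p + \<i>))"
proof -
  \<comment> \<open>On this half-plane |i exp w| < p, so the other denominator has no zero; p > 1
    ensures that it contains 0.\<close>
  define S where "S = {w :: complex. Re w < ln p}"
  have nz: "of_real p + \<i> * exp w \<noteq> 0" if "w \<in> S" for w
  proof
    assume "of_real p + \<i> * exp w = 0"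
    then have "norm (\<i> * exp w) = norm (- of_real p :: complex)" by (metis add_eq_0_iff)
    then have "exp (Re w) = p" using p by (simp add: norm_mult)
    then show False using that p by (metis S_def exp_ln_iff less_irrefl ln_exp mem_Collect_eq)
  qed
  have "residue (\<lambda>w. (exp (of_real \<alpha> * w) / (of_real p + \<i> * exp w)) / (exp (of_real \<alpha> * w) - 1)) 0
      = (exp (of_real \<alpha> * 0) / (of_real p + \<i> * exp 0)) / of_real \<alpha>"
  proof (rule residue_simple_pole_deriv[of _ S])
    show "(\<lambda>w. exp (of_real \<alpha> * w) / (of_real p + \<i> * exp w)) holomorphic_on S"
      using nz by (intro holomorphic_intros) auto
    show "(\<lambda>w. exp (of_real \<alpha> * w) - 1) holomorphic_on S" by (intro holomorphic_intros)
    show "open S" unfolding S_def by (rule open_halfspace_Re_lt)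
    show "connected S" unfolding S_def by (intro convex_connected convex_halfspace_Re_lt)
    show "0 \<in> S" using p by (simp add: S_def)
    show "((\<lambda>w. exp (of_real \<alpha> * w) - 1) has_field_derivative of_real \<alpha>) (at 0)"
      by (auto intro!: derivative_eq_intros)
    show "exp (of_real \<alpha> * 0) / (of_real p + \<i> * exp 0) \<noteq> (0 :: complex)"
      using nz[of 0] p by (simp add: S_def)
  qed (use \<alpha> in auto)
  moreover have "strip_fun = (\<lambda>w. (exp (of_real \<alpha> * w) / (of_real p + \<i> * exp w)) / (exp (of_real \<alpha> * w) - 1))"
    by (intro ext) (simp add: strip_fun_def mult.commute)
  ultimately show ?thesis by (simp add: mult.commute)
qed

lemma strip_fun_residue_pole:
  "residue strip_fun strip_pole
    = - (exp (of_real \<alpha> * strip_pole) / (exp (of_real \<alpha> * strip_pole) - 1) / of_real p)"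
proof -
  \<comment> \<open>Here |exp (\<alpha> w)| > 1, so the first denominator has no zero; p > 1 gives
    the pole positive real part.\<close>
  define S where "S = {w :: complex. 0 < Re w}"
  have nz: "exp (of_real \<alpha> * w) - 1 \<noteq> 0" if "w \<in> S" for w :: complex
  proof
    assume "exp (of_real \<alpha> * w) - 1 = 0"
    then have "norm (exp (of_real \<alpha> * w)) = 1" by simp
    then show False using that \<alpha> by (auto simp: S_def)
  qed
  have inS: "strip_pole \<in> S" using p by (simp add: S_def strip_pole_def)
  have "residue (\<lambda>w. (exp (of_real \<alpha> * w) / (exp (of_real \<alpha> * w) - 1)) / (of_real p + \<i> * exp w)) strip_pole
      = (exp (of_real \<alpha> * strip_pole) / (exp (of_real \<alpha> * strip_pole) - 1)) / (\<i> * exp strip_pole)"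
  proof (rule residue_simple_pole_deriv[of _ S])
    show "(\<lambda>w. exp (of_real \<alpha> * w) / (exp (of_real \<alpha> * w) - 1)) holomorphic_on S"
      using nz by (intro holomorphic_intros) auto
    show "(\<lambda>w. of_real p + \<i> * exp w) holomorphic_on S" by (intro holomorphic_intros)
    show "open S" unfolding S_def by (rule open_halfspace_Re_gt)
    show "connected S" unfolding S_def by (intro convex_connected convex_halfspace_Re_gt)
    show "strip_pole \<in> S" by fact
    show "((\<lambda>w. of_real p + \<i> * exp w) has_field_derivative \<i> * exp strip_pole) (at strip_pole)"
      by (auto intro!: derivative_eq_intros)
    show "exp (of_real \<alpha> * strip_pole) / (exp (of_real \<alpha> * strip_pole) - 1) \<noteq> 0"
      using nz[OF inS] by simp
    show "of_real p + \<i> * exp strip_pole = 0" by (simp add: exp_strip_pole mult.assoc[symmetric])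
  qed simp
  moreover have "\<i> * exp strip_pole = - of_real p" by (simp add: exp_strip_pole mult.assoc[symmetric])
  ultimately show ?thesis by (simp add: strip_fun_def[abs_def] divide_minus_right)
qed

lemma strip_fun_holomorphic: "strip_fun holomorphic_on (strip_dom - {0, strip_pole})"
  unfolding strip_fun_def[abs_def]
  using strip_zero1 strip_zero2 by (intro holomorphic_intros) auto

lemma strip_rectangle:
  assumes R: "ln p < R"
  shows "contour_integral (rectpath (Complex (-R) (-pi)) (Complex R pi)) strip_fun
    = 2 * of_real pi * \<i> * (residue strip_fun 0 + residue strip_fun strip_pole)"
proof -
  have R0: "0 < R" using R p by (meson less_trans ln_gt_zero)
  let ?g = "rectpath (Complex (-R) (-pi)) (Complex R pi)"
  have lnp: "0 < ln p" using p by simp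
  have in0: "0 \<in> box (Complex (-R) (-pi)) (Complex R pi)"
    and in1: "strip_pole \<in> box (Complex (-R) (-pi)) (Complex R pi)"
    using R0 R lnp by (auto simp: in_box_complex_iff strip_pole_def)
  have img: "path_image ?g \<subseteq> strip_dom - {0, strip_pole}"
  proof -
    have "path_image ?g = cbox (Complex (-R) (-pi)) (Complex R pi) - box (Complex (-R) (-pi)) (Complex R pi)"
      using R0 by (intro path_image_rectpath_cbox_minus_box) auto
    moreover have "cbox (Complex (-R) (-pi)) (Complex R pi) \<subseteq> strip_dom"
    proof
      fix w assume "w \<in> cbox (Complex (-R) (-pi)) (Complex R pi)"
      then show "w \<in> strip_dom" by (intro strip_domI) (auto simp: in_cbox_complex_iff)
    qed
    ultimately show ?thesis using in0 in1 by auto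
  qed
  have cv: "convex strip_dom"
    unfolding strip_dom_def Collect_conj_eq
    by (intro convex_Int convex_halfspace_Im_gt convex_halfspace_Im_lt)
  have "contour_integral ?g strip_fun
      = 2 * pi * \<i> * (\<Sum>q\<in>{0, strip_pole}. winding_number ?g q * residue strip_fun q)"
  proof (rule Residue_theorem)
    show "open strip_dom" unfolding strip_dom_def Collect_conj_eq
      by (intro open_Int open_halfspace_Im_gt open_halfspace_Im_lt)
    show "connected strip_dom" using cv by (rule convex_connected)
    show "\<forall>z. z \<notin> strip_dom \<longrightarrow> winding_number ?g z = 0"
      using img cv by (auto intro!: winding_number_zero_outside[of _ strip_dom])
  qed (use img strip_fun_holomorphic in auto)
  also have "(\<Sum>q\<in>{0, strip_pole}. winding_number ?g q * residue strip_fun q)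
      = residue strip_fun 0 + residue strip_fun strip_pole"
  proof -
    have "strip_pole \<noteq> 0" using p by (auto simp: strip_pole_def complex_eq_iff)
    then show ?thesis using winding_number_rectpath[OF in0] winding_number_rectpath[OF in1] by auto
  qed
  finally show ?thesis by simp
qed

text \<open>After subtracting the horizontal sides of the rectangle only the vertical ones remain,
  each of length 2\<pi>. The first summand bounds the integrand at Re w = R, where exp w in the
  denominator is large; the second bounds it at Re w = -R, where the numerator exp (\<alpha> w) is
  small.\<close>

lemma strip_horizontal_estimate:
  assumes R: "ln p < R"
  shows "norm (2 * of_real pi * \<i> * (residue strip_fun 0 + residue strip_fun strip_pole)
      - integral {-R..R} (\<lambda>v. strip_fun (Complex v (-pi)) - strip_fun (Complex v pi)))
    \<le> 2 * pi * (exp (\<alpha> * R) / (exp (\<alpha> * R) - 1) / (exp R - p)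
      + exp (- \<alpha> * R) / (1 - exp (- \<alpha> * R)) / (p - exp (- R)))"
proof -
  have lnp: "0 < ln p" using p by simp
  have R0: "0 < R" using R lnp by linarith
  define a1 a2 a3 a4 where a: "a1 = Complex (-R) (-pi)" "a2 = Complex R (-pi)" "a3 = Complex R pi"
    "a4 = Complex (-R) pi"
  have rp: "rectpath a1 a3 = linepath a1 a2 +++ linepath a2 a3 +++ linepath a3 a4 +++ linepath a4 a1"
    by (simp add: rectpath_def Let_def a)
  have cont: "continuous_on (strip_dom - {0, strip_pole}) strip_fun"
    using strip_fun_holomorphic by (rule holomorphic_on_imp_continuous_on)
  have seg: "closed_segment a1 a2 \<subseteq> strip_dom - {0, strip_pole}" "closed_segment a2 a3 \<subseteq> strip_dom - {0, strip_pole}"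
    "closed_segment a3 a4 \<subseteq> strip_dom - {0, strip_pole}" "closed_segment a4 a1 \<subseteq> strip_dom - {0, strip_pole}"
    using R R0 lnp unfolding a
    by (auto simp: closed_segment_same_Re closed_segment_same_Im strip_pole_def closed_segment_eq_real_ivl
      intro!: strip_domI)
  have ci: "strip_fun contour_integrable_on linepath a1 a2" "strip_fun contour_integrable_on linepath a2 a3"
    "strip_fun contour_integrable_on linepath a3 a4" "strip_fun contour_integrable_on linepath a4 a1"
    using seg by (auto intro!: contour_integrable_continuous_linepath continuous_on_subset[OF cont])
  have eq: "contour_integral (rectpath a1 a3) strip_fun
      = contour_integral (linepath a1 a2) strip_fun + contour_integral (linepath a2 a3) strip_fun
        + contour_integral (linepath a3 a4) strip_fun + contour_integral (linepath a4 a1) strip_fun"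
    unfolding rp using ci by (simp add: contour_integrable_joinI)
  have h1: "contour_integral (linepath a1 a2) strip_fun = integral {-R..R} (\<lambda>v. strip_fun (Complex v (-pi)))"
    unfolding a using R0 by (intro contour_integral_linepath_same_Im) simp
  \<comment> \<open>The upper side is traversed from right to left, hence the sign.\<close>
  have h3: "contour_integral (linepath a3 a4) strip_fun = - integral {-R..R} (\<lambda>v. strip_fun (Complex v pi))"
  proof -
    have "contour_integral (linepath a3 a4) strip_fun = - contour_integral (linepath a4 a3) strip_fun"
      using seg(3) by (intro contour_integral_reverse_linepath continuous_on_subset[OF cont]) (simp add: closed_segment_commute)
    also have "contour_integral (linepath a4 a3) strip_fun = integral {-R..R} (\<lambda>v. strip_fun (Complex v pi))"
      unfolding a using R0 by (intro contour_integral_linepath_same_Im) simp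
    finally show ?thesis .
  qed
  have int: "(\<lambda>v. strip_fun (Complex v y)) integrable_on {-R..R}" if "y = pi \<or> y = - pi" for y
  proof (rule integrable_continuous_interval)
    have "continuous_on {-R..R} (strip_fun \<circ> (\<lambda>v. Complex v y))"
      using that
      by (intro continuous_on_compose continuous_on_subset[OF cont] continuous_intros)
        (auto simp: strip_pole_def complex_eq_iff intro!: strip_domI)
    then show "continuous_on {-R..R} (\<lambda>v. strip_fun (Complex v y))" by (simp add: comp_def)
  qed
  have b2: "norm (contour_integral (linepath a2 a3) strip_fun)
      \<le> exp (\<alpha> * R) / (exp (\<alpha> * R) - 1) / (exp R - p) * norm (a3 - a2)"
  proof (rule contour_integral_bound_linepath[OF ci(2)])
    have pe: "p < exp R" using R p by (metis exp_less_mono exp_ln less_trans zero_less_one)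
    have ae: "1 < exp (\<alpha> * R)" using R0 \<alpha> by simp
    show "0 \<le> exp (\<alpha> * R) / (exp (\<alpha> * R) - 1) / (exp R - p)" using pe ae by simp
    fix w assume "w \<in> closed_segment a2 a3"
    then have w: "Re w = R" unfolding a by (auto simp: closed_segment_same_Re)
    have "exp (\<alpha> * R) - 1 \<le> norm (exp (of_real \<alpha> * w) - 1)"
      using norm_triangle_ineq2[of "exp (of_real \<alpha> * w)" 1] w by simp
    moreover have "exp R - p \<le> norm (of_real p + \<i> * exp w)"
      using norm_diff_ineq[of "\<i> * exp w" "of_real p"] w p by (simp add: norm_mult add.commute)
    ultimately show "norm (strip_fun w) \<le> exp (\<alpha> * R) / (exp (\<alpha> * R) - 1) / (exp R - p)"
      unfolding strip_fun_def norm_divide using pe ae w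
      by (intro frac_le divide_nonneg_nonneg) auto
  qed
  have b4: "norm (contour_integral (linepath a4 a1) strip_fun)
      \<le> exp (- \<alpha> * R) / (1 - exp (- \<alpha> * R)) / (p - exp (- R)) * norm (a1 - a4)"
  proof (rule contour_integral_bound_linepath[OF ci(4)])
    have pe: "exp (- R) < p" using R0 p by (metis exp_less_one_iff less_trans neg_less_0_iff_less)
    have ae: "exp (- \<alpha> * R) < 1" using R0 \<alpha> by simp
    show "0 \<le> exp (- \<alpha> * R) / (1 - exp (- \<alpha> * R)) / (p - exp (- R))" using pe ae by simp
    fix w assume "w \<in> closed_segment a4 a1"
    then have w: "Re w = - R" unfolding a by (auto simp: closed_segment_same_Re)
    have "1 - exp (- \<alpha> * R) \<le> norm (exp (of_real \<alpha> * w) - 1)"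
      using norm_triangle_ineq2[of 1 "exp (of_real \<alpha> * w)"] w by (simp add: norm_minus_commute)
    moreover have "p - exp (- R) \<le> norm (of_real p + \<i> * exp w)"
      using norm_diff_ineq[of "of_real p" "\<i> * exp w"] w p by (simp add: norm_mult)
    ultimately show "norm (strip_fun w) \<le> exp (- \<alpha> * R) / (1 - exp (- \<alpha> * R)) / (p - exp (- R))"
      unfolding strip_fun_def norm_divide using pe ae w
      by (intro frac_le divide_nonneg_nonneg) auto
  qed
  have n: "norm (a3 - a2) = 2 * pi" "norm (a1 - a4) = 2 * pi"
    unfolding a by (simp_all add: cmod_def real_sqrt_mult)
  have "2 * of_real pi * \<i> * (residue strip_fun 0 + residue strip_fun strip_pole)
      - integral {-R..R} (\<lambda>v. strip_fun (Complex v (-pi)) - strip_fun (Complex v pi))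
      = contour_integral (linepath a2 a3) strip_fun + contour_integral (linepath a4 a1) strip_fun"
    unfolding strip_rectangle[OF R, folded a, symmetric] eq h1 h3
      Henstock_Kurzweil_Integration.integral_diff[OF int[of "-pi", simplified] int[of pi, simplified]]
    by simp
  also have "norm \<dots> \<le> 2 * pi * (exp (\<alpha> * R) / (exp (\<alpha> * R) - 1) / (exp R - p)
      + exp (- \<alpha> * R) / (1 - exp (- \<alpha> * R)) / (p - exp (- R)))"
    using norm_triangle_le[OF add_mono[OF b2 b4]] n by (simp add: algebra_simps)
  finally show ?thesis .
qed

lemma strip_limit:
  "(\<lambda>n. integral {-real n..real n} (\<lambda>v. strip_fun (Complex v (-pi)) - strip_fun (Complex v pi)))
    \<longlonglongrightarrow> 2 * of_real pi * \<i> * (residue strip_fun 0 + residue strip_fun strip_pole)"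
proof (rule Lim_transform2[OF tendsto_const])
  have "\<forall>\<^sub>F n in sequentially. norm (2 * of_real pi * \<i> * (residue strip_fun 0 + residue strip_fun strip_pole)
      - integral {-real n..real n} (\<lambda>v. strip_fun (Complex v (-pi)) - strip_fun (Complex v pi)))
    \<le> 2 * pi * (exp (\<alpha> * real n) / (exp (\<alpha> * real n) - 1) / (exp (real n) - p)
      + exp (- \<alpha> * real n) / (1 - exp (- \<alpha> * real n)) / (p - exp (- real n)))"
    using filterlim_real_sequentially[THEN filterlim_at_top_dense[THEN iffD1], rule_format, of "ln p"]
    by eventually_elim (rule strip_horizontal_estimate)
  moreover have "(\<lambda>n. 2 * pi * (exp (\<alpha> * real n) / (exp (\<alpha> * real n) - 1) / (exp (real n) - p)
      + exp (- \<alpha> * real n) / (1 - exp (- \<alpha> * real n)) / (p - exp (- real n)))) \<longlonglongrightarrow> 0"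
    using \<alpha> p by real_asymp
  ultimately show "(\<lambda>n. 2 * of_real pi * \<i> * (residue strip_fun 0 + residue strip_fun strip_pole)
      - integral {-real n..real n} (\<lambda>v. strip_fun (Complex v (-pi)) - strip_fun (Complex v pi))) \<longlonglongrightarrow> 0"
    by (rule Lim_null_comparison)
qed

end

subsection \<open>Laplace transforms\<close>

lemma continuous_zero_if_integrals_zero:
  fixes \<phi> :: "real \<Rightarrow> 'a::banach"
  assumes c: "continuous_on {0..} \<phi>" and z: "\<And>b. 0 \<le> b \<Longrightarrow> integral {0..b} \<phi> = 0" and t: "0 \<le> t"
  shows "\<phi> t = 0"
proof -
  have c': "continuous_on {0..t + 1} \<phi>" using c by (rule continuous_on_subset) auto
  have "((\<lambda>u. integral {0..u} \<phi>) has_vector_derivative \<phi> t) (at t within {0..t + 1})"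
    using integral_has_vector_derivative[OF c', of t] t by simp
  then have "((\<lambda>u. 0) has_vector_derivative \<phi> t) (at t within {0..t + 1})"
    by (rule has_vector_derivative_transform[rotated 2]) (use t in \<open>auto simp: z\<close>)
  moreover have "((\<lambda>u. 0) has_vector_derivative (0::'a)) (at t within {0..t + 1})"
    by (rule has_vector_derivative_const)
  ultimately show ?thesis
    using vector_derivative_unique_within_closed_interval[of 0 "t + 1" t "\<lambda>u. 0" "\<phi> t" 0] t by simp
qed

text \<open>\<open>has_bochner_integral\<close> carries integrability together with the value. The
  half-line is open, so that values at 0, such as that of \<open>t powr 0\<close>, do not
  interfere.\<close>

abbreviation has_laplace :: "real \<Rightarrow> (real \<Rightarrow> complex) \<Rightarrow> complex \<Rightarrow> bool" where
  "has_laplace p f x \<equiv> has_bochner_integral lborel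
     (\<lambda>t. indicator {0<..} t *\<^sub>R (of_real (exp (- p * t)) * f t)) x"

lemma integrable_exp_Ioi:
  assumes "0 < r" shows "integrable lborel (\<lambda>t. indicator {0<..} t * exp (- r * t) :: real)"
proof -
  have "integrable lborel (\<lambda>x::real. exp (- x) * indicator {0..} x)"
    using has_bochner_integral_I0i_power_exp_m'[of 0] by (simp add: has_bochner_integral_iff)
  from lborel_integrable_real_affine[OF this, of r 0] have
    "integrable lborel (\<lambda>x. exp (- (r * x)) * indicator {0..} (r * x))"
    using assms by simp
  moreover have "AE x in lborel. exp (- (r * x)) * indicator {0..} (r * x) = indicator {0<..} x * exp (- r * x)"
    using AE_lborel_singleton[of "0::real"] by eventually_elim (use assms in \<open>auto simp: indicator_def zero_le_mult_iff\<close>)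
  ultimately show ?thesis
    by (subst (asm) integrable_cong_AE) auto
qed

lemma has_laplace_exp:
  assumes z: "Re z < p"
  shows "has_laplace p (\<lambda>t. exp (z * of_real t)) (1 / (of_real p - z))"
proof -
  define c where "c = of_real p - z"
  define f where "f t = indicator {0<..} t *\<^sub>R (of_real (exp (- p * t)) * exp (z * of_real t))" for t
  have feq: "f t = indicator {0<..} t *\<^sub>R exp (- c * of_real t)" for t
    by (simp add: c_def f_def exp_of_real[symmetric] exp_add[symmetric] algebra_simps)
  have int: "integrable lborel f"
  proof (rule Bochner_Integration.integrable_bound[OF integrable_exp_Ioi[of "p - Re z"]])
    show "f \<in> borel_measurable lborel" unfolding f_def by measurable
    show "AE t in lborel. norm (f t) \<le> norm (indicator {0<..} t * exp (- (p - Re z) * t))"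
      by (simp add: feq c_def indicator_def)
  qed (use z in simp)
  have nz: "c \<noteq> 0" using z by (auto simp: c_def)
  have "(\<lambda>n. LINT t|lborel. indicator {..real n} t *\<^sub>R f t) \<longlonglongrightarrow> (LINT t|lborel. f t)"
    using filterlim_compose[OF tendsto_integral_at_top[OF _ int] filterlim_real_sequentially] by simp
  moreover have "(LINT t|lborel. indicator {..real n} t *\<^sub>R f t)
      = (1 - exp (- c * of_real (real n))) / c" for n
  proof -
    have "(LINT t|lborel. indicator {..real n} t *\<^sub>R f t)
        = (LINT t|lborel. indicator {0..real n} t *\<^sub>R exp (- c * of_real t))"
      using AE_lborel_singleton[of "0::real"]
      by (intro integral_cong_AE) (auto simp: feq indicator_def f_def)
    also have "\<dots> = - (1 / c) * exp (- c * of_real (real n))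
        - (- (1 / c) * exp (- c * of_real 0))"
    proof (rule integral_FTC_Icc)
      fix x
      show "((\<lambda>t. - (1 / c) * exp (- c * of_real t)) has_vector_derivative
          exp (- c * of_real x)) (at x within {0..real n})"
        using nz by (intro has_vector_derivative_real_field) (auto intro!: derivative_eq_intros)
    qed (auto intro!: continuous_intros)
    finally show ?thesis by (simp add: diff_divide_distrib)
  qed
  moreover have "(\<lambda>n. (1 - exp (- c * of_real (real n))) / c)
      \<longlonglongrightarrow> (1 - 0) / c"
  proof (intro tendsto_intros nz)
    have "(\<lambda>n. exp (- (p - Re z) * real n)) \<longlonglongrightarrow> 0" using z by real_asymp
    then show "(\<lambda>n. exp (- c * of_real (real n))) \<longlonglongrightarrow> 0"
      by (rule_tac tendsto_norm_zero_cancel) (simp add: c_def)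
  qed
  ultimately have "(LINT t|lborel. f t) = 1 / c"
    by (auto intro: LIMSEQ_unique)
  then show ?thesis using int unfolding has_bochner_integral_iff f_def c_def by simp
qed

lemma has_laplace_powr:
  assumes s: "0 \<le> s" and p: "0 < p"
  shows "has_laplace p (\<lambda>t. of_real (t powr s)) (of_real (Gamma (s + 1) * p powr (- s - 1)))"
proof -
  have "has_bochner_integral lborel (\<lambda>t. indicator {0..} t * t powr (s + 1 - 1) / exp t) (Gamma (s + 1))"
    using s Gamma_conv_nn_integral_real[of "s + 1"]
    by (intro has_bochner_integral_nn_integral) (auto simp: indicator_def Gamma_real_pos less_imp_le)
  then have i: "integrable lborel (\<lambda>t. indicator {0..} t * t powr s / exp t)"
    and v: "(LINT t|lborel. indicator {0..} t * t powr s / exp t) = Gamma (s + 1)"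
    by (simp_all add: has_bochner_integral_iff)
  have i': "integrable lborel (\<lambda>t. indicator {0..} (p * t) * (p * t) powr s / exp (p * t))"
    using lborel_integrable_real_affine[OF i, of p 0] p by simp
  have v': "(LINT t|lborel. indicator {0..} (p * t) * (p * t) powr s / exp (p * t)) = Gamma (s + 1) / p"
    using v lborel_integral_real_affine[of p "\<lambda>t. indicator {0..} t * t powr s / exp t" 0] p
    by (simp add: field_simps)
  have "has_bochner_integral lborel
      (\<lambda>t. p powr (- s) * (indicator {0..} (p * t) * (p * t) powr s / exp (p * t))) (p powr (- s) * (Gamma (s + 1) / p))"
    using i' v' by (intro has_bochner_integral_mult_right) (simp add: has_bochner_integral_iff)
  then have "has_bochner_integral lborel
      (\<lambda>t. complex_of_real (p powr (- s) * (indicator {0..} (p * t) * (p * t) powr s / exp (p * t))))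
      (of_real (p powr (- s) * (Gamma (s + 1) / p)))"
    by (rule has_bochner_integral_of_real)
  moreover have eq: "p powr (- s) * (Gamma (s + 1) / p) = Gamma (s + 1) * p powr (- s - 1)"
    using p by (simp add: powr_diff)
  moreover have "AE t in lborel. complex_of_real (p powr (- s) * (indicator {0..} (p * t) * (p * t) powr s / exp (p * t)))
      = indicator {0<..} t *\<^sub>R (of_real (exp (- p * t)) * of_real (t powr s))"
    using AE_lborel_singleton[of "0::real"]
  proof eventually_elim
    case (elim t)
    show ?case
    proof (cases "0 < t")
      case True
      have "p powr (- s) * (p * t) powr s = t powr s"
        using True p by (simp add: powr_mult powr_minus)
      then have "p powr (- s) * (indicator {0..} (p * t) * (p * t) powr s / exp (p * t)) = exp (- p * t) * t powr s"
        using True p by (simp add: exp_minus field_simps)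
      then show ?thesis using True by (simp only: of_real_mult) simp
    next
      case False
      then have "p * t < 0" using elim p by (simp add: mult_pos_neg)
      then show ?thesis using False by simp
    qed
  qed
  ultimately show ?thesis
    unfolding eq by (subst (asm) has_bochner_integral_cong_AE) auto
qed

text \<open>A form of Lerch's theorem that samples the transform only at q + n. With x = exp (-t)
  these values are the moments of exp (-q t) d t, so its integral over every interval [0, b]
  vanishes.\<close>

theorem laplace_zero_imp_zero:
  fixes d :: "real \<Rightarrow> complex"
  assumes c: "continuous_on {0..} d" and L: "\<And>n. has_laplace (q + real n) d 0" and t: "0 \<le> t"
  shows "d t = 0"
proof -
  define g where "g t = indicator {0<..} t *\<^sub>R (of_real (exp (- q * t)) * d t)" for t
  \<comment> \<open>The absolute value keeps \<open>\<beta>\<close> in [0, 1] on the whole line; on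
    the negative half-line \<open>g\<close> is zero anyway.\<close>
  define \<beta> where "\<beta> t = exp (- \<bar>t\<bar>)" for t :: real
  have c': "continuous_on {0..} (\<lambda>t. of_real (exp (- q * t)) * d t)"
    by (intro continuous_intros c)
  have g: "integrable lborel g" using L[of 0] by (simp add: g_def[abs_def] has_bochner_integral_iff)
  have int0: "integral {0..b} (\<lambda>t. of_real (exp (- q * t)) * d t) = 0" if b: "0 \<le> b" for b
  proof -
    have "(LINT t|lborel. g t * indicator {exp (-b)..1} (\<beta> t)) = 0"
    proof (rule moments_zero_imp_integral_zero[OF g])
      show "\<beta> \<in> borel_measurable lborel" unfolding \<beta>_def by measurable
      show "AE x in lborel. 0 \<le> \<beta> x \<and> \<beta> x \<le> 1" by (simp add: \<beta>_def)
      show "(LINT t|lborel. g t * of_real (\<beta> t ^ n)) = 0" for n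
      proof -
        have "g t * of_real (\<beta> t ^ n) = indicator {0<..} t *\<^sub>R (of_real (exp (- (q + real n) * t)) * d t)" for t
        proof (cases "0 < t")
          case True
          have "exp (- q * t) * \<beta> t ^ n = exp (- (q + real n) * t)"
            using True by (simp add: \<beta>_def exp_of_nat_mult[symmetric] exp_add[symmetric] algebra_simps)
          moreover have "g t * of_real (\<beta> t ^ n) = of_real (exp (- q * t) * \<beta> t ^ n) * d t"
            using True by (simp add: g_def)
          ultimately show ?thesis using True by (simp only: indicator_simps greaterThan_iff scaleR_one if_True)
        qed (simp add: g_def)
        then show ?thesis using L[of n] by (simp add: has_bochner_integral_iff)
      qed
    qed simp
    also have "(LINT t|lborel. g t * indicator {exp (-b)..1} (\<beta> t))
        = (LINT t:{0..b}|lborel. of_real (exp (- q * t)) * d t)"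
    proof -
      have "AE t in lborel. g t * indicator {exp (-b)..1} (\<beta> t) = indicator {0..b} t *\<^sub>R (of_real (exp (- q * t)) * d t)"
        using AE_lborel_singleton[of "0::real"]
        by eventually_elim (auto simp: g_def \<beta>_def indicator_def)
      moreover have "set_integrable lborel {0..b} (\<lambda>t. of_real (exp (- q * t)) * d t)"
        by (intro borel_integrable_atLeastAtMost' continuous_on_subset[OF c']) auto
      then have "(\<lambda>t. indicator {0..b} t *\<^sub>R (of_real (exp (- q * t)) * d t)) \<in> borel_measurable lborel"
        unfolding set_integrable_def by (rule borel_measurable_integrable)
      moreover have "(\<lambda>t. g t * indicator {exp (-b)..1} (\<beta> t)) \<in> borel_measurable lborel"
        using g unfolding \<beta>_def by measurable
      ultimately show ?thesis unfolding set_lebesgue_integral_def by (intro integral_cong_AE)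
    qed
    also have "\<dots> = integral {0..b} (\<lambda>t. of_real (exp (- q * t)) * d t)"
      by (intro set_borel_integral_eq_integral borel_integrable_atLeastAtMost' continuous_on_subset[OF c']) auto
    finally show ?thesis .
  qed
  have "of_real (exp (- q * t)) * d t = 0"
    by (rule continuous_zero_if_integrals_zero[OF c' int0 t])
  then show ?thesis by simp
qed

subsection \<open>The Mittag-Leffler function\<close>

text \<open>A crude replacement for Stirling's formula: keep the part of the Gamma integral beyond
  \<open>T\<close>, where t^s \<ge> T^s. The free parameter \<open>T\<close> is chosen later so that
  this beats a given geometric growth.\<close>

lemma Gamma_lower_bound:
  fixes s T :: real
  assumes s: "0 \<le> s" and T: "0 < T"
  shows "T powr s * exp (- T) \<le> Gamma (s + 1)"
proof -
  have f: "((\<lambda>t. exp (- 1 * t)) has_integral exp (- 1 * T) / 1) {T..}"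
    by (rule has_integral_exp_minus_to_infinity) simp
  have "((\<lambda>t. T powr s * exp (- 1 * t)) has_integral T powr s * (exp (- 1 * T) / 1)) {T..}"
    by (rule has_integral_mult_right[OF f])
  then have "((\<lambda>t. if t \<in> {T..} then T powr s * exp (- 1 * t) else 0) has_integral T powr s * (exp (- 1 * T) / 1)) {0..}"
    using T by (subst has_integral_restrict) auto
  moreover have "((\<lambda>t. t powr (s + 1 - 1) / exp t) has_integral Gamma (s + 1)) {0..}"
    using s by (intro Gamma_integral_real) simp
  ultimately have "T powr s * (exp (- 1 * T) / 1) \<le> Gamma (s + 1)"
  proof (rule has_integral_le)
    fix t :: real
    have "T powr s * exp (- t) \<le> t powr s * exp (- t)" if "T \<le> t"
      using that T s by (intro mult_right_mono powr_mono2) auto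
    then show "(if t \<in> {T..} then T powr s * exp (- 1 * t) else 0) \<le> t powr (s + 1 - 1) / exp t"
      by (simp add: exp_minus field_simps)
  qed
  then show ?thesis by simp
qed

lemma mittag_leffler_term_bound:
  assumes \<alpha>: "0 < \<alpha>" and R: "0 < R" and z: "norm z \<le> R"
  shows "norm (z ^ k / complex_of_real (Gamma (\<alpha> * real k + 1))) \<le> exp ((2 * R) powr (1 / \<alpha>)) * (1/2) ^ k"
proof -
  \<comment> \<open>Chosen with T^\<alpha> = 2 R, so that Gamma (\<alpha> k + 1) \<ge> (2 R)^k exp
    (-T) and the quotient retains a factor (1/2)^k.\<close>
  define T where "T = (2 * R) powr (1 / \<alpha>)"
  have T: "0 < T" using R by (simp add: T_def)
  have "T powr (\<alpha> * real k) = (2 * R) ^ k"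
    using \<alpha> R by (simp add: T_def powr_powr powr_realpow)
  then have G: "(2 * R) ^ k * exp (- T) \<le> Gamma (\<alpha> * real k + 1)"
    using Gamma_lower_bound[of "\<alpha> * real k" T] \<alpha> T by simp
  have "norm (z ^ k / complex_of_real (Gamma (\<alpha> * real k + 1))) = norm z ^ k / Gamma (\<alpha> * real k + 1)"
    using \<alpha> by (simp add: norm_divide norm_power abs_of_pos Gamma_real_pos add_nonneg_pos)
  also have "\<dots> \<le> R ^ k / ((2 * R) ^ k * exp (- T))"
    using z R G by (intro frac_le power_mono) auto
  also have "\<dots> = exp T * (1/2) ^ k"
    using R by (simp add: exp_minus power_mult_distrib power_divide field_simps)
  finally show ?thesis by (simp add: T_def)
qed

lemma mittag_leffler_summable:
  assumes \<alpha>: "0 < \<alpha>"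
  shows "summable (\<lambda>k. norm (z ^ k / complex_of_real (Gamma (\<alpha> * real k + 1))))"
proof (rule summable_comparison_test)
  show "\<exists>N. \<forall>k\<ge>N. norm (norm (z ^ k / complex_of_real (Gamma (\<alpha> * real k + 1))))
      \<le> exp ((2 * (norm z + 1)) powr (1 / \<alpha>)) * (1/2) ^ k"
    using mittag_leffler_term_bound[OF \<alpha>, of "norm z + 1" z] norm_ge_zero[of z] by auto
qed (intro summable_mult summable_geometric, simp)

lemma isCont_mittag_leffler:
  assumes \<alpha>: "0 < \<alpha>" shows "isCont (mittag_leffler \<alpha>) z"
proof -
  have "isCont (\<lambda>z. \<Sum>k. inverse (complex_of_real (Gamma (\<alpha> * real k + 1))) * z ^ k) z"
    using summable_norm_cancel[OF mittag_leffler_summable[OF \<alpha>]]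
    by (intro isCont_powser_converges_everywhere) (simp add: divide_inverse mult.commute)
  moreover have "mittag_leffler \<alpha> = (\<lambda>z. \<Sum>k. inverse (complex_of_real (Gamma (\<alpha> * real k + 1))) * z ^ k)"
    by (rule ext) (simp add: mittag_leffler_def divide_inverse mult.commute)
  ultimately show ?thesis by simp
qed

lemma norm_minus_i_powr [simp]: "norm (minus_i_powr \<alpha>) = 1"
  by (simp add: minus_i_powr_def)

lemma norm_minus_it_powr: "norm (minus_it_powr \<alpha> t) = t powr \<alpha>"
  by (simp add: minus_it_powr_def norm_mult)

lemma continuous_on_minus_it_powr:
  assumes "0 < \<alpha>" shows "continuous_on {0..} (minus_it_powr \<alpha>)"
  unfolding minus_it_powr_def using assms
  by (intro continuous_intros continuous_on_powr') auto

lemma minus_it_powr_power: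
  assumes "0 < t"
  shows "minus_it_powr \<alpha> t ^ k = minus_i_powr \<alpha> ^ k * of_real (t powr (\<alpha> * real k))"
  using assms by (simp add: minus_it_powr_def power_mult_distrib powr_powr[symmetric] powr_realpow)

lemma continuous_on_ml:
  assumes "0 < \<alpha>" shows "continuous_on {0..} (\<lambda>t. mittag_leffler \<alpha> (minus_it_powr \<alpha> t * c))"
proof (rule continuous_on_compose2[of UNIV "mittag_leffler \<alpha>"])
  show "continuous_on UNIV (mittag_leffler \<alpha>)"
    using isCont_mittag_leffler[OF assms] by (simp add: continuous_at_imp_continuous_on)
  show "continuous_on {0..} (\<lambda>t. minus_it_powr \<alpha> t * c)"
    by (intro continuous_intros continuous_on_minus_it_powr assms)
qed simp

text \<open>Transforming term by term cancels the Gamma factors and leaves a geometric series of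
  ratio (-i)^\<alpha> p^(-\<alpha>). For p > 1 the ratio has modulus below 1, which makes the
  integrals of the norms summable too and so justifies the exchange.\<close>

lemma has_laplace_mittag_leffler:
  assumes \<alpha>: "0 < \<alpha>" and p: "1 < p"
  shows "has_laplace p (\<lambda>t. mittag_leffler \<alpha> (minus_it_powr \<alpha> t))
    (1 / of_real p / (1 - minus_i_powr \<alpha> * of_real (p powr (- \<alpha>))))"
proof -
  define c where "c = minus_i_powr \<alpha>"
  define \<Gamma>k where "\<Gamma>k k = Gamma (\<alpha> * real k + 1)" for k
  have \<Gamma>: "0 < \<Gamma>k k" for k using \<alpha> by (simp add: \<Gamma>k_def Gamma_real_pos add_nonneg_pos)
  define f where "f k t = indicator {0<..} t *\<^sub>R (of_real (exp (- p * t)) * (c ^ k / of_real (\<Gamma>k k) * of_real (t powr (\<alpha> * real k))))"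
    for k t
  have pw: "p powr (- (\<alpha> * real k) - 1) = (p powr (- \<alpha>)) ^ k / p" for k
  proof -
    have "p powr (- (\<alpha> * real k)) = (p powr (- \<alpha>)) powr real k" by (simp add: powr_powr)
    also have "\<dots> = (p powr (- \<alpha>)) ^ k" using p by (simp add: powr_realpow)
    finally show ?thesis using p by (simp add: powr_diff)
  qed
  have L: "has_bochner_integral lborel (f k) ((c * of_real (p powr (- \<alpha>))) ^ k / of_real p)" for k
  proof -
    have "has_laplace p (\<lambda>t. of_real (t powr (\<alpha> * real k))) (of_real (\<Gamma>k k * p powr (- (\<alpha> * real k) - 1)))"
      unfolding \<Gamma>k_def using \<alpha> p by (intro has_laplace_powr) auto
    from has_bochner_integral_mult_right[OF this, of "c ^ k / of_real (\<Gamma>k k)"]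
    have "has_bochner_integral lborel
        (\<lambda>t. c ^ k / of_real (\<Gamma>k k) * (indicator {0<..} t *\<^sub>R (of_real (exp (- p * t)) * of_real (t powr (\<alpha> * real k)))))
        (c ^ k / of_real (\<Gamma>k k) * of_real (\<Gamma>k k * p powr (- (\<alpha> * real k) - 1)))" by simp
    moreover have "c ^ k / of_real (\<Gamma>k k) * of_real (\<Gamma>k k * p powr (- (\<alpha> * real k) - 1))
        = (c * of_real (p powr (- \<alpha>))) ^ k / of_real p"
      using \<Gamma>[of k] by (simp add: pw power_mult_distrib)
    moreover have "(\<lambda>t. c ^ k / of_real (\<Gamma>k k) * (indicator {0<..} t *\<^sub>R (of_real (exp (- p * t)) * of_real (t powr (\<alpha> * real k))))) = f k"
      by (auto simp: f_def fun_eq_iff indicator_def)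
    ultimately show ?thesis by simp
  qed
  have normL: "(LINT t|lborel. norm (f k t)) = (p powr (- \<alpha>)) ^ k / p" for k
  proof -
    have "has_laplace p (\<lambda>t. of_real (t powr (\<alpha> * real k))) (of_real (\<Gamma>k k * p powr (- (\<alpha> * real k) - 1)))"
      unfolding \<Gamma>k_def using \<alpha> p by (intro has_laplace_powr) auto
    then have "has_bochner_integral lborel (\<lambda>t. Re (indicator {0<..} t *\<^sub>R (of_real (exp (- p * t)) * of_real (t powr (\<alpha> * real k)))))
        (Re (of_real (\<Gamma>k k * p powr (- (\<alpha> * real k) - 1))))"
      by (rule has_bochner_integral_Re)
    from has_bochner_integral_mult_right[OF this, of "1 / \<Gamma>k k"]
    have "has_bochner_integral lborel (\<lambda>t. 1 / \<Gamma>k k * Re (indicator {0<..} t *\<^sub>R (of_real (exp (- p * t)) * of_real (t powr (\<alpha> * real k)))))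
      (1 / \<Gamma>k k * Re (of_real (\<Gamma>k k * p powr (- (\<alpha> * real k) - 1))))" by simp
    moreover have "1 / \<Gamma>k k * Re (of_real (\<Gamma>k k * p powr (- (\<alpha> * real k) - 1))) = (p powr (- \<alpha>)) ^ k / p"
      using \<Gamma>[of k] by (simp add: pw)
    moreover have "1 / \<Gamma>k k * Re (indicator {0<..} t *\<^sub>R (of_real (exp (- p * t)) * of_real (t powr (\<alpha> * real k)))) = norm (f k t)" for t
      using \<Gamma>[of k] by (simp add: f_def c_def norm_mult norm_divide norm_power indicator_def)
    ultimately have "has_bochner_integral lborel (\<lambda>t. norm (f k t)) ((p powr (- \<alpha>)) ^ k / p)"
      by (simp only:)
    then show ?thesis by (simp add: has_bochner_integral_iff)
  qed
  have pa: "p powr (- \<alpha>) < 1" using \<alpha> p by (simp add: powr_less_one)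
  have trm: "f k t = indicator {0<..} t *\<^sub>R (of_real (exp (- p * t)) * (minus_it_powr \<alpha> t ^ k / of_real (\<Gamma>k k)))" for k t
    by (cases "0 < t") (simp_all add: f_def c_def minus_it_powr_power)
  have summ: "summable (\<lambda>k. norm (f k t))" for t
  proof -
    have "summable (\<lambda>k. norm (indicator {0<..} t *\<^sub>R of_real (exp (- p * t)) :: complex) * norm (minus_it_powr \<alpha> t ^ k / of_real (\<Gamma>k k)))"
      unfolding \<Gamma>k_def by (intro summable_mult mittag_leffler_summable \<alpha>)
    then show ?thesis by (simp add: trm norm_mult norm_divide mult.assoc)
  qed
  have fint: "integrable lborel (f k)" for k using L by (simp add: has_bochner_integral_iff)
  have sn: "summable (\<lambda>k. LINT t|lborel. norm (f k t))"
    unfolding normL using pa by (intro summable_divide summable_geometric) simp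
  have sumf: "(\<Sum>k. f k t) = indicator {0<..} t *\<^sub>R (of_real (exp (- p * t)) * mittag_leffler \<alpha> (minus_it_powr \<alpha> t))" for t
  proof -
    have "summable (\<lambda>k. minus_it_powr \<alpha> t ^ k / of_real (\<Gamma>k k))"
      unfolding \<Gamma>k_def by (intro summable_norm_cancel[OF mittag_leffler_summable] \<alpha>)
    then have "(\<lambda>k. minus_it_powr \<alpha> t ^ k / of_real (\<Gamma>k k)) sums mittag_leffler \<alpha> (minus_it_powr \<alpha> t)"
      unfolding mittag_leffler_def \<Gamma>k_def[symmetric] by (rule summable_sums)
    then have "(\<lambda>k. f k t) sums (indicator {0<..} t *\<^sub>R (of_real (exp (- p * t)) * mittag_leffler \<alpha> (minus_it_powr \<alpha> t)))"
      unfolding trm by (intro sums_scaleR_right sums_mult)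
    then show ?thesis by (rule sums_unique[symmetric])
  qed
  have "integrable lborel (\<lambda>t. \<Sum>k. f k t)"
    by (rule integrable_suminf[OF fint _ sn]) (use summ in auto)
  moreover have "(LINT t|lborel. (\<Sum>k. f k t)) = (\<Sum>k. (c * of_real (p powr (- \<alpha>))) ^ k / of_real p)"
    using integral_suminf[OF fint _ sn] summ L by (simp add: has_bochner_integral_iff)
  moreover have "(\<Sum>k. (c * of_real (p powr (- \<alpha>))) ^ k / of_real p) = 1 / (1 - c * of_real (p powr (- \<alpha>))) / of_real p"
    using pa by (subst suminf_divide) (simp_all add: suminf_geometric c_def norm_mult summable_geometric)
  ultimately show ?thesis
    unfolding has_bochner_integral_iff sumf c_def by (simp add: mult.commute)
qed

text \<open>With r = exp v this is the density sin (\<pi>\<alpha>) / \<pi> * r^(\<alpha> - 1) /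
  (r^(2\<alpha>) - 2 r^\<alpha> cos (\<pi>\<alpha>) + 1) dr. It arises as the jump of z^\<alpha> /
  (z^\<alpha> - 1) across the negative axis, divided by 2\<pi>i.\<close>

definition ml_kernel :: "real \<Rightarrow> real \<Rightarrow> real" where
  "ml_kernel \<alpha> v = sin (pi * \<alpha>) / pi / (exp (\<alpha> * v) + exp (- \<alpha> * v) - 2 * cos (pi * \<alpha>))"

context
  fixes \<alpha> :: real
  assumes \<alpha>: "0 < \<alpha>" "\<alpha> < 1"
begin

lemma sin_cos_pi_\<alpha>: "0 < sin (pi * \<alpha>)" "\<bar>cos (pi * \<alpha>)\<bar> < 1"
proof -
  have "pi * \<alpha> < pi * 1" using \<alpha> pi_gt_zero by (intro mult_strict_left_mono) auto
  then show s: "0 < sin (pi * \<alpha>)" using \<alpha> pi_gt_zero by (intro sin_gt_zero) auto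
  have "(cos (pi * \<alpha>))\<^sup>2 = 1 - (sin (pi * \<alpha>))\<^sup>2" by (rule cos_squared_eq)
  also have "\<dots> < 1" using s by simp
  finally show "\<bar>cos (pi * \<alpha>)\<bar> < 1" by (simp add: abs_square_less_1)
qed

text \<open>With x = exp (\<alpha> |v|) the first two terms are x + 1/x \<ge> 2, so the cosine term
  is at most |cos (\<pi>\<alpha>)| (x + 1/x). As |cos (\<pi>\<alpha>)| < 1, a fixed fraction of x
  survives.\<close>

lemma ml_kernel_denom:
  "(1 - \<bar>cos (pi * \<alpha>)\<bar>) * exp (\<alpha> * \<bar>v\<bar>) \<le> exp (\<alpha> * v) + exp (- \<alpha> * v) - 2 * cos (pi * \<alpha>)"
proof -
  define x where "x = exp (\<alpha> * \<bar>v\<bar>)"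
  have x: "0 < x" by (simp add: x_def)
  have eq: "exp (\<alpha> * v) + exp (- \<alpha> * v) = x + 1 / x"
    by (cases "0 \<le> v") (simp_all add: x_def exp_minus field_simps)
  have "0 \<le> (x - 1)\<^sup>2 / x" using x by simp
  then have two: "2 \<le> x + 1 / x" using x by (simp add: power2_eq_square field_simps)
  have "2 * cos (pi * \<alpha>) \<le> \<bar>cos (pi * \<alpha>)\<bar> * 2" by simp
  also have "\<dots> \<le> \<bar>cos (pi * \<alpha>)\<bar> * (x + 1 / x)" using two by (intro mult_left_mono) auto
  finally have "x + 1 / x - 2 * cos (pi * \<alpha>) \<ge> (1 - \<bar>cos (pi * \<alpha>)\<bar>) * (x + 1 / x)"
    by (simp add: algebra_simps)
  moreover have "(1 - \<bar>cos (pi * \<alpha>)\<bar>) * x \<le> (1 - \<bar>cos (pi * \<alpha>)\<bar>) * (x + 1 / x)"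
    using x sin_cos_pi_\<alpha>(2) by (intro mult_left_mono) auto
  ultimately show ?thesis unfolding eq x_def[symmetric] by linarith
qed

lemma ml_kernel_denom_pos: "0 < exp (\<alpha> * v) + exp (- \<alpha> * v) - 2 * cos (pi * \<alpha>)"
proof -
  have "0 < (1 - \<bar>cos (pi * \<alpha>)\<bar>) * exp (\<alpha> * \<bar>v\<bar>)"
    using sin_cos_pi_\<alpha>(2) by (intro mult_pos_pos) auto
  then show ?thesis using ml_kernel_denom[of v] by linarith
qed

lemma ml_kernel_nonneg: "0 \<le> ml_kernel \<alpha> v"
  using ml_kernel_denom_pos[of v] sin_cos_pi_\<alpha>(1) by (simp add: ml_kernel_def)

lemma ml_kernel_bound:
  "ml_kernel \<alpha> v \<le> sin (pi * \<alpha>) / pi / (1 - \<bar>cos (pi * \<alpha>)\<bar>) * exp (- \<alpha> * \<bar>v\<bar>)"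
proof -
  have "ml_kernel \<alpha> v \<le> sin (pi * \<alpha>) / pi / ((1 - \<bar>cos (pi * \<alpha>)\<bar>) * exp (\<alpha> * \<bar>v\<bar>))"
    unfolding ml_kernel_def
    using ml_kernel_denom[of v] sin_cos_pi_\<alpha> by (intro divide_left_mono mult_pos_pos ml_kernel_denom_pos) auto
  also have "\<dots> = sin (pi * \<alpha>) / pi / (1 - \<bar>cos (pi * \<alpha>)\<bar>) * exp (- \<alpha> * \<bar>v\<bar>)"
    by (simp add: exp_minus field_simps)
  finally show ?thesis .
qed

lemma ml_kernel_measurable [measurable]: "ml_kernel \<alpha> \<in> borel_measurable borel"
  unfolding ml_kernel_def[abs_def] by measurable

lemma ml_kernel_integrable: "integrable lborel (ml_kernel \<alpha>)"
proof (rule Bochner_Integration.integrable_bound)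
  define C where "C = sin (pi * \<alpha>) / pi / (1 - \<bar>cos (pi * \<alpha>)\<bar>)"
  have e: "integrable lborel (\<lambda>v. indicator {0<..} v * exp (- \<alpha> * v))"
    using \<alpha> by (intro integrable_exp_Ioi)
  have e': "integrable lborel (\<lambda>v. indicator {0<..} (-v) * exp (- \<alpha> * (-v)))"
    using lborel_integrable_real_affine[OF e, of "-1" 0] by simp
  show "integrable lborel (\<lambda>v. C * (indicator {0<..} v * exp (- \<alpha> * v) + indicator {0<..} (-v) * exp (- \<alpha> * (-v))))"
    by (intro integrable_mult_right Bochner_Integration.integrable_add e e')
  have "C \<ge> 0" using sin_cos_pi_\<alpha> by (simp add: C_def)
  show "AE v in lborel. norm (ml_kernel \<alpha> v)
      \<le> norm (C * (indicator {0<..} v * exp (- \<alpha> * v) + indicator {0<..} (-v) * exp (- \<alpha> * (-v))))"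
    using AE_lborel_singleton[of "0::real"]
  proof eventually_elim
    case (elim v)
    have "norm (ml_kernel \<alpha> v) \<le> C * exp (- \<alpha> * \<bar>v\<bar>)"
      using ml_kernel_bound[of v] ml_kernel_nonneg[of v] by (simp add: C_def)
    also have eq: "exp (- \<alpha> * \<bar>v\<bar>) = indicator {0<..} v * exp (- \<alpha> * v) + indicator {0<..} (-v) * exp (- \<alpha> * (-v))"
      using elim by (auto simp: indicator_def abs_if)
    finally show ?case by (rule order_trans) (simp only: real_norm_def abs_ge_self)
  qed
qed simp

text \<open>On the two sides exp w takes the same value - exp v, while exp (\<alpha> w) takes
  conjugate values, so only the factor with \<alpha> jumps.\<close>

lemma strip_fun_jump:
  assumes p: "1 < p"
  shows "strip_fun \<alpha> p (Complex v (-pi)) - strip_fun \<alpha> p (Complex v pi)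
    = 2 * of_real pi * \<i> * (of_real (ml_kernel \<alpha> v) / (of_real p - \<i> * of_real (exp v)))"
proof -
  define E where "E = exp (\<alpha> * v)"
  define s where "s = sin (pi * \<alpha>)"
  define c where "c = cos (pi * \<alpha>)"
  define z where "z = Complex (E * c) (E * s)"
  have E: "0 < E" by (simp add: E_def)
  have ez: "exp (of_real \<alpha> * Complex v pi) = z"
    by (simp add: exp_eq_polar z_def E_def s_def c_def complex_eq_iff mult.commute)
  have ez': "exp (of_real \<alpha> * Complex v (-pi)) = cnj z"
    by (simp add: exp_eq_polar z_def E_def s_def c_def complex_eq_iff mult.commute)
  have ev: "exp (Complex v pi) = - of_real (exp v)" "exp (Complex v (-pi)) = - of_real (exp v)"
    by (simp_all add: exp_eq_polar complex_eq_iff)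
  have cs: "s\<^sup>2 + c\<^sup>2 = 1" by (simp add: s_def c_def)
  have den: "E\<^sup>2 - 2 * E * c + 1 = E * (E + 1 / E - 2 * c)" using E by (simp add: field_simps power2_eq_square)
  have Einv: "exp (- \<alpha> * v) = 1 / E" by (simp add: E_def exp_minus field_simps)
  have pos: "0 < E + 1 / E - 2 * c"
    using ml_kernel_denom_pos[of v] unfolding Einv E_def[symmetric] c_def[symmetric] .
  have mod: "(z - 1) * (cnj z - 1) = of_real (E\<^sup>2 - 2 * E * c + 1)"
  proof -
    have "(z - 1) * (cnj z - 1) = (z - 1) * cnj (z - 1)" by simp
    also have "\<dots> = of_real ((E * c - 1)\<^sup>2 + (E * s)\<^sup>2)"
      by (simp only: complex_mult_cnj) (simp add: z_def)
    also have "(E * c - 1)\<^sup>2 + (E * s)\<^sup>2 = E\<^sup>2 * (s\<^sup>2 + c\<^sup>2) - 2 * E * c + 1"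
      by (simp add: power2_eq_square algebra_simps)
    finally show ?thesis by (simp add: cs)
  qed
  have nz: "z - 1 \<noteq> 0" "cnj z - 1 \<noteq> 0"
    using mod den E pos by (auto simp del: of_real_power of_real_diff of_real_add of_real_mult)
  have "cnj z / (cnj z - 1) - z / (z - 1) = (z - cnj z) / ((z - 1) * (cnj z - 1))"
    using nz by (simp add: divide_simps) (simp add: algebra_simps)
  also have "z - cnj z = 2 * \<i> * of_real (E * s)" by (simp add: z_def complex_eq_iff)
  also have "2 * \<i> * of_real (E * s) / ((z - 1) * (cnj z - 1)) = 2 * \<i> * of_real (s / (E + 1 / E - 2 * c))"
    unfolding mod den using E by simp
  also have "s / (E + 1 / E - 2 * c) = pi * ml_kernel \<alpha> v"
    unfolding ml_kernel_def Einv E_def[symmetric] s_def[symmetric] c_def[symmetric] by simp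
  finally have "cnj z / (cnj z - 1) - z / (z - 1) = 2 * of_real pi * \<i> * of_real (ml_kernel \<alpha> v)" by simp
  moreover have "of_real p + \<i> * - complex_of_real (exp v) = of_real p - \<i> * of_real (exp v)" by simp
  ultimately show ?thesis
    unfolding strip_fun_def[OF \<alpha> p] ez ez' ev
    by (simp only: diff_divide_distrib[symmetric] times_divide_eq_right)
qed

lemma norm_stieltjes_denom: "0 \<le> p \<Longrightarrow> p \<le> norm (of_real p - \<i> * of_real x)"
  using abs_Re_le_cmod[of "of_real p - \<i> * of_real x"] by simp

text \<open>The residue at 0 is the Laplace transform of exp (-it) / \<alpha>, and the residue at
  \<open>strip_pole\<close> is minus that of E_\<alpha>((-it)^\<alpha>). Since 1 / (p - i exp v) is
  the transform of exp (i t exp v), this is the representation formula on the Laplace side.\<close>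

lemma stieltjes_ml_kernel:
  assumes p: "1 < p"
  shows "has_bochner_integral lborel (\<lambda>v. of_real (ml_kernel \<alpha> v) / (of_real p - \<i> * of_real (exp v)))
    (1 / (of_real \<alpha> * (of_real p + \<i>)) - 1 / of_real p / (1 - minus_i_powr \<alpha> * of_real (p powr (- \<alpha>))))"
proof -
  define F where "F v = of_real (ml_kernel \<alpha> v) / (of_real p - \<i> * of_real (exp v))" for v
  have bound: "norm (F v) \<le> ml_kernel \<alpha> v / p" for v
    unfolding F_def norm_divide using p norm_stieltjes_denom[of p "exp v"] ml_kernel_nonneg[of v]
    by (intro frac_le) auto
  have [measurable]: "F \<in> borel_measurable borel" unfolding F_def[abs_def] by measurable
  have int: "integrable lborel F"
  proof (rule Bochner_Integration.integrable_bound)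
    show "integrable lborel (\<lambda>v. ml_kernel \<alpha> v / p)" using ml_kernel_integrable by simp
    show "AE v in lborel. norm (F v) \<le> norm (ml_kernel \<alpha> v / p)"
      using bound ml_kernel_nonneg p by (simp add: abs_of_nonneg)
  qed simp
  have contF: "continuous_on S F" for S
    unfolding F_def[abs_def] ml_kernel_def using ml_kernel_denom_pos norm_stieltjes_denom[of p] p
    by (intro continuous_intros) (force simp: less_imp_neq[symmetric])+
  have fin: "(LINT v|lborel. indicator {-real n..real n} v *\<^sub>R F v) = integral {-real n..real n} F" for n
    using set_borel_integral_eq_integral(2)[OF borel_integrable_atLeastAtMost'[OF contF]]
    by (simp add: set_lebesgue_integral_def)
  have lim1: "(\<lambda>n. integral {-real n..real n} F) \<longlonglongrightarrow> (LINT v|lborel. F v)"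
    unfolding fin[symmetric]
  proof (rule integral_dominated_convergence[where w = "\<lambda>v. norm (F v)"])
    show "AE v in lborel. (\<lambda>n. indicator {-real n..real n} v *\<^sub>R F v) \<longlonglongrightarrow> F v"
    proof (intro AE_I2 tendsto_eventually)
      fix v
      obtain N :: nat where "\<bar>v\<bar> \<le> real N" using real_arch_simple by blast
      then show "\<forall>\<^sub>F n in sequentially. indicator {-real n..real n} v *\<^sub>R F v = F v"
        unfolding eventually_sequentially by (intro exI[of _ N]) (auto simp: indicator_def)
    qed
    show "AE v in lborel. norm (indicator {-real n..real n} v *\<^sub>R F v) \<le> norm (F v)" for n
      by (auto simp: indicator_def)
  qed (use int in auto)
  have "integral {-real n..real n} (\<lambda>v. strip_fun \<alpha> p (Complex v (-pi)) - strip_fun \<alpha> p (Complex v pi))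
      = 2 * of_real pi * \<i> * integral {-real n..real n} F" for n
    unfolding strip_fun_jump[OF p] F_def[symmetric] by (rule integral_mult_right)
  then have "(\<lambda>n. 2 * of_real pi * \<i> * integral {-real n..real n} F)
      \<longlonglongrightarrow> 2 * of_real pi * \<i> * (residue (strip_fun \<alpha> p) 0 + residue (strip_fun \<alpha> p) (strip_pole p))"
    using strip_limit[OF \<alpha> p] by simp
  moreover have "(\<lambda>n. 2 * of_real pi * \<i> * integral {-real n..real n} F)
      \<longlonglongrightarrow> 2 * of_real pi * \<i> * (LINT v|lborel. F v)"
    by (intro tendsto_intros lim1)
  ultimately have "2 * of_real pi * \<i> * (LINT v|lborel. F v)
      = 2 * of_real pi * \<i> * (residue (strip_fun \<alpha> p) 0 + residue (strip_fun \<alpha> p) (strip_pole p))"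
    using LIMSEQ_unique by blast
  then have I: "(LINT v|lborel. F v) = residue (strip_fun \<alpha> p) 0 + residue (strip_fun \<alpha> p) (strip_pole p)"
    by simp
  \<comment> \<open>The pole is log (i p), so this is (i p)^\<alpha>, the reciprocal of
    (-i)^\<alpha> p^(-\<alpha>).\<close>
  have "exp (of_real \<alpha> * strip_pole p) = of_real (p powr \<alpha>) * cis (\<alpha> * pi / 2)"
    unfolding strip_pole_def[OF \<alpha> p] exp_eq_polar using p by (simp add: powr_def mult.commute)
  also have "cis (\<alpha> * pi / 2) = inverse (minus_i_powr \<alpha>)"
    by (simp add: minus_i_powr_def cis_conv_exp exp_minus)
  finally have ep: "exp (of_real \<alpha> * strip_pole p) = inverse (minus_i_powr \<alpha> * of_real (p powr (- \<alpha>)))"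
    by (simp add: powr_minus)
  define q where "q = minus_i_powr \<alpha> * of_real (p powr (- \<alpha>))"
  have q0: "q \<noteq> 0" using p by (simp add: q_def minus_i_powr_def)
  have "inverse q / (inverse q - 1) = 1 / (1 - q)"
    using q0 by (simp add: divide_simps)
  then show ?thesis
    using I int unfolding has_bochner_integral_iff F_def[symmetric]
      strip_fun_residue_0[OF \<alpha> p] strip_fun_residue_pole[OF \<alpha> p] ep q_def[symmetric]
    by (simp add: mult.commute)
qed

section \<open>The remainder integral and boundedness on the ray\<close>

definition ml_rest :: "real \<Rightarrow> complex" where
  "ml_rest t = (LINT v|lborel. exp (\<i> * of_real (t * exp v)) * of_real (ml_kernel \<alpha> v))"

lemma norm_ml_integrand: "norm (exp (\<i> * of_real x) * of_real (ml_kernel \<alpha> v)) = ml_kernel \<alpha> v"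
  using ml_kernel_nonneg[of v] by (simp add: norm_mult)

lemma ml_rest_integrable: "integrable lborel (\<lambda>v. exp (\<i> * of_real (t * exp v)) * of_real (ml_kernel \<alpha> v))"
  by (rule Bochner_Integration.integrable_bound[OF ml_kernel_integrable])
    (simp_all only: norm_ml_integrand, auto)

lemma norm_ml_rest: "norm (ml_rest t) \<le> (LINT v|lborel. ml_kernel \<alpha> v)"
  unfolding ml_rest_def using integral_norm_bound[of lborel "\<lambda>v. exp (\<i> * of_real (t * exp v)) * of_real (ml_kernel \<alpha> v)"]
  by (simp only: norm_ml_integrand)

lemma continuous_on_ml_rest: "continuous_on S ml_rest"
  unfolding continuous_on_sequentially
proof (intro allI ballI impI, elim conjE)
  fix x :: "nat \<Rightarrow> real" and a assume x: "x \<longlonglongrightarrow> a"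
  show "(ml_rest \<circ> x) \<longlonglongrightarrow> ml_rest a"
    unfolding ml_rest_def comp_def
  proof (rule integral_dominated_convergence[where w = "ml_kernel \<alpha>"])
    show "AE v in lborel. (\<lambda>i. exp (\<i> * of_real (x i * exp v)) * of_real (ml_kernel \<alpha> v))
        \<longlonglongrightarrow> exp (\<i> * of_real (a * exp v)) * of_real (ml_kernel \<alpha> v)"
      by (intro AE_I2 tendsto_intros x)
    show "AE v in lborel. norm (exp (\<i> * of_real (x i * exp v)) * of_real (ml_kernel \<alpha> v)) \<le> ml_kernel \<alpha> v" for i
      by (simp only: norm_ml_integrand) simp
  qed (use ml_kernel_integrable in auto)
qed

text \<open>Fubini with the majorant exp (-p t) \<open>ml_kernel \<alpha> v\<close>; integrating in
  t first gives the Stieltjes integrand.\<close>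

lemma has_laplace_ml_rest:
  assumes p: "1 < p"
  shows "has_laplace p ml_rest
    (1 / (of_real \<alpha> * (of_real p + \<i>)) - 1 / of_real p / (1 - minus_i_powr \<alpha> * of_real (p powr (- \<alpha>))))"
proof -
  define f where "f t v = indicator {0<..} t *\<^sub>R (of_real (exp (- p * t)) * (exp (\<i> * of_real (t * exp v)) * of_real (ml_kernel \<alpha> v)))"
    for t v
  have nf: "norm (f t v) = indicator {0<..} t * exp (- p * t) * ml_kernel \<alpha> v" for t v
    unfolding f_def norm_scaleR norm_mult[of "of_real _"] norm_ml_integrand by (simp add: indicator_def)
  have [measurable]: "case_prod f \<in> borel_measurable (lborel \<Otimes>\<^sub>M lborel)"
    unfolding f_def[abs_def] case_prod_beta by measurable
  have int: "integrable (lborel \<Otimes>\<^sub>M lborel) (case_prod f)"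
  proof (rule lborel_pair.Fubini_integrable)
    show "integrable lborel (\<lambda>t. LINT v|lborel. norm (case (t, v) of (t, v) \<Rightarrow> f t v))"
      using integrable_exp_Ioi[of p] p by (simp add: nf)
    show "AE t in lborel. integrable lborel (\<lambda>v. case (t, v) of (t, v) \<Rightarrow> f t v)"
      unfolding f_def prod.case
      by (intro AE_I2 integrable_scaleR_right integrable_mult_right ml_rest_integrable)
  qed simp
  have in_t: "(LINT t|lborel. f t v) = of_real (ml_kernel \<alpha> v) / (of_real p - \<i> * of_real (exp v))" for v
  proof -
    have "has_laplace p (\<lambda>t. exp (\<i> * of_real (exp v) * of_real t)) (1 / (of_real p - \<i> * of_real (exp v)))"
      using p by (intro has_laplace_exp) simp
    from has_bochner_integral_mult_right[OF this, of "of_real (ml_kernel \<alpha> v)"]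
    show ?thesis by (simp add: has_bochner_integral_iff f_def mult_ac)
  qed
  have in_v: "(LINT v|lborel. f t v) = indicator {0<..} t *\<^sub>R (of_real (exp (- p * t)) * ml_rest t)" for t
    by (simp add: f_def ml_rest_def)
  have "integrable lborel (\<lambda>t. LINT v|lborel. f t v)"
    using lborel_pair.integrable_fst'[OF int] by simp
  moreover have "(LINT t|lborel. LINT v|lborel. f t v) = (LINT v|lborel. LINT t|lborel. f t v)"
    using lborel_pair.Fubini_integral[OF int] by simp
  ultimately show ?thesis
    using stieltjes_ml_kernel[OF p] unfolding in_t in_v has_bochner_integral_iff by simp
qed

theorem mittag_leffler_representation:
  assumes t: "0 \<le> t"
  shows "mittag_leffler \<alpha> (minus_it_powr \<alpha> t) = exp (- \<i> * of_real t) / of_real \<alpha> - ml_rest t"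
proof -
  define d where "d t = mittag_leffler \<alpha> (minus_it_powr \<alpha> t) - exp (- \<i> * of_real t) * (1 / of_real \<alpha>) + ml_rest t" for t
  have "continuous_on {0..} d"
    unfolding d_def[abs_def] using \<alpha> continuous_on_ml[of \<alpha> 1]
    by (intro continuous_intros continuous_on_ml_rest) auto
  moreover have "has_laplace (2 + real n) d 0" for n
  proof -
    \<comment> \<open>The sampling starts at 2 because the transforms are known only for p >
      1.\<close>
    define p where "p = 2 + real n"
    have p: "1 < p" by (simp add: p_def)
    have "has_laplace p (\<lambda>t. exp (- \<i> * of_real t)) (1 / (of_real p + \<i>))"
      using has_laplace_exp[of "- \<i>" p] p by simp
    from has_bochner_integral_mult_left[OF this, of "1 / of_real \<alpha>"]
    have e: "has_laplace p (\<lambda>t. exp (- \<i> * of_real t) * (1 / of_real \<alpha>)) (1 / (of_real \<alpha> * (of_real p + \<i>)))"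
      by (simp add: mult_ac)
    have "has_bochner_integral lborel
      (\<lambda>t. indicator {0<..} t *\<^sub>R (of_real (exp (- p * t)) * mittag_leffler \<alpha> (minus_it_powr \<alpha> t))
        - indicator {0<..} t *\<^sub>R (of_real (exp (- p * t)) * (exp (- \<i> * of_real t) * (1 / of_real \<alpha>)))
        + indicator {0<..} t *\<^sub>R (of_real (exp (- p * t)) * ml_rest t))
      (1 / of_real p / (1 - minus_i_powr \<alpha> * of_real (p powr (- \<alpha>))) - 1 / (of_real \<alpha> * (of_real p + \<i>))
        + (1 / (of_real \<alpha> * (of_real p + \<i>)) - 1 / of_real p / (1 - minus_i_powr \<alpha> * of_real (p powr (- \<alpha>)))))"
      by (intro has_bochner_integral_add has_bochner_integral_diff has_laplace_mittag_leffler e has_laplace_ml_rest \<alpha> p)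
    moreover have "indicator {0<..} t *\<^sub>R (of_real (exp (- p * t)) * mittag_leffler \<alpha> (minus_it_powr \<alpha> t))
        - indicator {0<..} t *\<^sub>R (of_real (exp (- p * t)) * (exp (- \<i> * of_real t) * (1 / of_real \<alpha>)))
        + indicator {0<..} t *\<^sub>R (of_real (exp (- p * t)) * ml_rest t)
        = indicator {0<..} t *\<^sub>R (of_real (exp (- p * t)) * d t)" for t
      unfolding d_def scaleR_add_right[symmetric] scaleR_diff_right[symmetric] distrib_left[symmetric]
        right_diff_distrib[symmetric] ..
    ultimately show ?thesis by (simp add: p_def)
  qed
  ultimately have "d t = 0" using laplace_zero_imp_zero t by blast
  then show ?thesis by (simp add: d_def field_simps)
qed

theorem mittag_leffler_bounded:
  obtains C where "0 \<le> C" "\<And>t a. 0 \<le> t \<Longrightarrow> 0 \<le> a \<Longrightarrow> norm (mittag_leffler \<alpha> (minus_it_powr \<alpha> t * of_real a)) \<le> C"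
proof (rule that)
  define C where "C = 1 / \<alpha> + (LINT v|lborel. ml_kernel \<alpha> v)"
  have b: "norm (mittag_leffler \<alpha> (minus_it_powr \<alpha> t)) \<le> C" if "0 \<le> t" for t
  proof -
    have "norm (exp (- \<i> * of_real t) / of_real \<alpha> :: complex) = 1 / \<alpha>"
      using \<alpha> by (simp add: norm_divide)
    then show ?thesis
      unfolding mittag_leffler_representation[OF that] C_def
      using norm_triangle_ineq4[of "exp (- \<i> * of_real t) / of_real \<alpha>" "ml_rest t"] norm_ml_rest[of t] by linarith
  qed
  show "0 \<le> C" using b[of 0] norm_ge_zero order_trans by blast
  fix t a :: real assume ta: "0 \<le> t" "0 \<le> a"
  \<comment> \<open>Homogeneity: (-it)^\<alpha> a = (-is)^\<alpha> with s = t a^(1/\<alpha>), so the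
    bound for a = 1 is uniform in \<open>a\<close>.\<close>
  have "(t * a powr (1 / \<alpha>)) powr \<alpha> = t powr \<alpha> * a"
    using \<alpha> ta by (simp add: powr_mult powr_powr)
  then have "minus_it_powr \<alpha> t * of_real a = minus_it_powr \<alpha> (t * a powr (1 / \<alpha>))"
    by (simp add: minus_it_powr_def mult.assoc flip: of_real_mult)
  then show "norm (mittag_leffler \<alpha> (minus_it_powr \<alpha> t * of_real a)) \<le> C"
    using b[of "t * a powr (1 / \<alpha>)"] ta by simp
qed

end

subsection \<open>Fractional integrals of continuous functions\<close>

lemma continuous_on_frac_arg:
  assumes "0 < \<beta>" shows "continuous_on {0..1} (\<lambda>\<rho>::real. \<rho> powr (1 / \<beta>))"
  using assms by (intro continuous_on_powr') (auto intro: continuous_intros)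

lemma frac_arg_range:
  fixes t \<rho> \<beta> :: real
  assumes "0 \<le> t" "0 \<le> \<rho>" "\<rho> \<le> 1" "0 < \<beta>"
  shows "0 \<le> t * (1 - \<rho> powr (1 / \<beta>))" "t * (1 - \<rho> powr (1 / \<beta>)) \<le> t"
proof -
  have "\<rho> powr (1 / \<beta>) \<le> 1" using assms by (intro powr_le1) auto
  then show "0 \<le> t * (1 - \<rho> powr (1 / \<beta>))" "t * (1 - \<rho> powr (1 / \<beta>)) \<le> t"
    using assms by (auto intro!: mult_nonneg_nonneg mult_left_le)
qed

lemma continuous_on_frac_integrand:
  fixes u :: "real \<Rightarrow> 'a::topological_space"
  assumes "0 < \<beta>" "0 \<le> t" "continuous_on {0..t} u"
  shows "continuous_on {0..1} (\<lambda>\<rho>. u (t * (1 - \<rho> powr (1 / \<beta>))))"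
  by (rule continuous_on_compose2[OF assms(3)])
    (use assms frac_arg_range in \<open>auto intro!: continuous_intros continuous_on_frac_arg\<close>)

text \<open>The substitution \<open>s = t (1 - \<rho> powr (1 / \<beta>))\<close> removes the singularity of the kernel.\<close>

lemma has_integral_frac_conv:
  fixes u :: "real \<Rightarrow> 'h::complex_hilbert_space"
  assumes \<beta>: "0 < \<beta>" and t: "0 \<le> t" and u: "continuous_on {0..t} u"
  shows "((\<lambda>s. frac_kernel \<beta> (t - s) *\<^sub>R u s) has_integral
    (t powr \<beta> / Gamma (\<beta> + 1)) *\<^sub>R integral {0..1} (\<lambda>\<rho>. u (t * (1 - \<rho> powr (1 / \<beta>))))) {0..t}"
proof (cases "t = 0")
  case True
  then show ?thesis by (simp add: has_integral_refl)
next
  case False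
  then have t: "0 < t" using t by simp
  define h where "h \<rho> = u (t * (1 - \<rho> powr (1 / \<beta>)))" for \<rho>
  have h: "continuous_on {0..1} h"
    unfolding h_def using continuous_on_frac_integrand[OF \<beta> _ u] t by simp
  define G where "G x = integral {0..x} h" for x
  define \<phi> where "\<phi> s = ((t - s) / t) powr \<beta>" for s
  \<comment> \<open>The integral of the kernel over [0, t].\<close>
  define K where "K = t powr \<beta> / Gamma (\<beta> + 1)"
  have \<phi>01: "0 \<le> \<phi> s" "\<phi> s \<le> 1" if "0 \<le> s" "s \<le> t" for s
    using that t \<beta> by (auto simp: \<phi>_def intro!: powr_le1)
  have contG: "continuous_on {0..1} G"
    unfolding G_def by (intro indefinite_integral_continuous_1 integrable_continuous_interval h)
  have cont\<phi>: "continuous_on {0..t} \<phi>"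
    unfolding \<phi>_def using t \<beta> by (intro continuous_on_powr' continuous_intros) auto
  \<comment> \<open>The antiderivative is - K G (\<phi> s). For \<beta> < 1 the derivative of \<phi>
    blows up at s = t, so the fundamental theorem is used with derivatives in the open interval
    only.\<close>
  have "((\<lambda>s. frac_kernel \<beta> (t - s) *\<^sub>R u s) has_integral - (K *\<^sub>R G (\<phi> t)) - (- (K *\<^sub>R G (\<phi> 0)))) {0..t}"
  proof (rule fundamental_theorem_of_calculus_interior)
    show "continuous_on {0..t} (\<lambda>s. - (K *\<^sub>R G (\<phi> s)))"
      by (intro continuous_intros continuous_on_compose2[OF contG cont\<phi>]) (use \<phi>01 in auto)
    fix s assume s: "s \<in> {0<..<t}"
    have q: "0 < (t - s) / t" "(t - s) / t < 1" using s by auto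
    have "(\<phi> has_real_derivative \<beta> * ((t - s) / t) powr (\<beta> - 1) * (- 1 / t)) (at s)"
      unfolding \<phi>_def using q t
      by (intro DERIV_chain'[where g = "\<lambda>x. x powr \<beta>" and f = "\<lambda>s. (t - s) / t", THEN DERIV_cong]
          has_real_derivative_powr) (auto intro!: derivative_eq_intros)
    then have d\<phi>: "(\<phi> has_vector_derivative \<beta> * ((t - s) / t) powr (\<beta> - 1) * (- 1 / t)) (at s)"
      by (simp add: has_real_derivative_iff_has_vector_derivative)
    have \<phi>s: "0 < \<phi> s" "\<phi> s < 1" using q \<beta> powr_less_mono2[of \<beta> "(t - s) / t" 1] by (auto simp: \<phi>_def)
    have "(G has_vector_derivative h (\<phi> s)) (at (\<phi> s) within {0..1})"
      unfolding G_def using \<phi>s by (intro integral_has_vector_derivative h) auto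
    then have dG: "(G has_vector_derivative h (\<phi> s)) (at (\<phi> s))"
      using \<phi>s by (simp add: at_within_Icc_at)
    have "(x powr \<beta>) powr (1 / \<beta>) = x" if "0 < x" for x :: real using that \<beta> by (simp add: powr_powr)
    from this[OF q(1)] have "\<phi> s powr (1 / \<beta>) = (t - s) / t" by (simp only: \<phi>_def)
    moreover have "t * (1 - (t - s) / t) = s" using t by (simp add: field_simps)
    ultimately have hs: "h (\<phi> s) = u s" by (simp add: h_def)
    have "((\<lambda>s. - (K *\<^sub>R G (\<phi> s))) has_vector_derivative
        - (K *\<^sub>R ((\<beta> * ((t - s) / t) powr (\<beta> - 1) * (- 1 / t)) *\<^sub>R h (\<phi> s)))) (at s)"
      using vector_diff_chain_at[OF d\<phi> dG] unfolding comp_def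
      by (intro has_vector_derivative_minus bounded_linear.has_vector_derivative[OF bounded_linear_scaleR_right])
    moreover have "- (K *\<^sub>R ((\<beta> * ((t - s) / t) powr (\<beta> - 1) * (- 1 / t)) *\<^sub>R h (\<phi> s)))
        = frac_kernel \<beta> (t - s) *\<^sub>R u s"
    proof -
      have "((t - s) / t) powr (\<beta> - 1) = (t - s) powr (\<beta> - 1) / (t powr \<beta> / t)"
        using s t by (simp add: powr_divide powr_diff)
      moreover have "Gamma (\<beta> + 1) = \<beta> * Gamma \<beta>"
        using \<beta> by (intro Gamma_plus1) (auto elim!: nonpos_Ints_cases)
      ultimately have "K * (\<beta> * ((t - s) / t) powr (\<beta> - 1) * (1 / t)) = frac_kernel \<beta> (t - s)"
        using t \<beta> Gamma_real_pos[OF \<beta>] by (simp add: K_def frac_kernel_def field_simps)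
      then show ?thesis by (simp add: hs)
    qed
    ultimately show "((\<lambda>s. - (K *\<^sub>R G (\<phi> s))) has_vector_derivative frac_kernel \<beta> (t - s) *\<^sub>R u s) (at s)"
      by simp
  qed (use t in auto)
  moreover have "\<phi> t = 0" "\<phi> 0 = 1" using t by (auto simp: \<phi>_def)
  ultimately show ?thesis by (simp add: G_def K_def h_def[abs_def])
qed

lemma frac_conv_eq:
  fixes u :: "real \<Rightarrow> 'h::complex_hilbert_space"
  assumes "0 < \<beta>" "0 \<le> t" "continuous_on {0..t} u"
  shows "frac_conv \<beta> u t = (t powr \<beta> / Gamma (\<beta> + 1)) *\<^sub>R integral {0..1} (\<lambda>\<rho>. u (t * (1 - \<rho> powr (1 / \<beta>))))"
  unfolding frac_conv_def by (rule integral_unique[OF has_integral_frac_conv[OF assms]])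

lemma frac_conv_integrable:
  fixes u :: "real \<Rightarrow> 'h::complex_hilbert_space"
  assumes "0 < \<beta>" "0 \<le> t" "continuous_on {0..t} u"
  shows "(\<lambda>s. frac_kernel \<beta> (t - s) *\<^sub>R u s) integrable_on {0..t}"
  using has_integral_frac_conv[OF assms] by blast

lemma frac_conv_cong:
  assumes "\<And>s. 0 \<le> s \<Longrightarrow> s \<le> t \<Longrightarrow> u s = v s" shows "frac_conv \<beta> u t = frac_conv \<beta> v t"
  unfolding frac_conv_def by (rule integral_cong) (use assms in auto)

lemma frac_conv_linear:
  fixes u :: "real \<Rightarrow> 'h::complex_hilbert_space" and T :: "'h \<Rightarrow> 'k::complex_hilbert_space"
  assumes T: "bounded_linear T" and "0 < \<beta>" "0 \<le> t" "continuous_on {0..t} u"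
  shows "frac_conv \<beta> (\<lambda>s. T (u s)) t = T (frac_conv \<beta> u t)"
  unfolding frac_conv_def
  using integral_linear[OF frac_conv_integrable[OF assms(2-4)] T]
  by (simp add: comp_def linear_simps(5)[OF T])

lemma frac_conv_add:
  fixes u v :: "real \<Rightarrow> 'h::complex_hilbert_space"
  assumes "0 < \<beta>" "0 \<le> t" "continuous_on {0..t} u" "continuous_on {0..t} v"
  shows "frac_conv \<beta> (\<lambda>s. u s + v s) t = frac_conv \<beta> u t + frac_conv \<beta> v t"
  unfolding frac_conv_def
  using integral_add[OF frac_conv_integrable[OF assms(1,2,3)] frac_conv_integrable[OF assms(1,2,4)]]
  by (simp add: scaleR_add_right)

lemma frac_conv_diff:
  fixes u v :: "real \<Rightarrow> 'h::complex_hilbert_space"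
  assumes "0 < \<beta>" "0 \<le> t" "continuous_on {0..t} u" "continuous_on {0..t} v"
  shows "frac_conv \<beta> (\<lambda>s. u s - v s) t = frac_conv \<beta> u t - frac_conv \<beta> v t"
  unfolding frac_conv_def
  using integral_diff[OF frac_conv_integrable[OF assms(1,2,3)] frac_conv_integrable[OF assms(1,2,4)]]
  by (simp add: scaleR_diff_right)

lemma frac_conv_cmult:
  fixes f :: "real \<Rightarrow> complex"
  assumes "0 < \<beta>" "0 \<le> t" "continuous_on {0..t} f"
  shows "frac_conv \<beta> (\<lambda>s. c * f s) t = c * frac_conv \<beta> f t"
  by (rule frac_conv_linear[OF bounded_linear_mult_right assms])

lemma frac_conv_zero [simp]: "frac_conv \<beta> (\<lambda>s. 0) t = 0"
  by (simp add: frac_conv_def)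

lemma frac_conv_sum:
  fixes f :: "'i \<Rightarrow> real \<Rightarrow> complex"
  assumes "0 < \<beta>" "0 \<le> t" "finite I" "\<And>i. i \<in> I \<Longrightarrow> continuous_on {0..t} (f i)"
  shows "frac_conv \<beta> (\<lambda>s. \<Sum>i\<in>I. c i * f i s) t = (\<Sum>i\<in>I. c i * frac_conv \<beta> (f i) t)"
  using assms(3,4)
proof (induction I rule: finite_induct)
  case (insert i I)
  have "frac_conv \<beta> (\<lambda>s. c i * f i s + (\<Sum>i\<in>I. c i * f i s)) t
      = frac_conv \<beta> (\<lambda>s. c i * f i s) t + frac_conv \<beta> (\<lambda>s. \<Sum>i\<in>I. c i * f i s) t"
    using insert(4) by (intro frac_conv_add assms(1,2) continuous_intros) auto
  then show ?case using insert assms by (simp add: frac_conv_cmult)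
qed simp

lemma norm_frac_conv_le:
  fixes u :: "real \<Rightarrow> 'h::complex_hilbert_space"
  assumes "0 < \<beta>" "0 \<le> t" "continuous_on {0..t} u"
    and M: "\<And>s. 0 \<le> s \<Longrightarrow> s \<le> t \<Longrightarrow> norm (u s) \<le> M"
  shows "norm (frac_conv \<beta> u t) \<le> t powr \<beta> / Gamma (\<beta> + 1) * M"
proof -
  have "norm (integral {0..1} (\<lambda>\<rho>. u (t * (1 - \<rho> powr (1 / \<beta>))))) \<le> M * (1 - 0)"
    by (rule integral_bound) (use assms frac_arg_range continuous_on_frac_integrand in auto)
  then have I: "norm (integral {0..1} (\<lambda>\<rho>. u (t * (1 - \<rho> powr (1 / \<beta>))))) \<le> M" by simp
  have K: "0 \<le> t powr \<beta> / Gamma (\<beta> + 1)"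
    using assms by (simp add: Gamma_real_pos less_imp_le)
  show ?thesis
    unfolding frac_conv_eq[OF assms(1-3)] norm_scaleR abs_of_nonneg[OF K] by (rule mult_left_mono[OF I K])
qed

lemma frac_conv_tendsto:
  fixes u :: "real \<Rightarrow> 'h::complex_hilbert_space"
  assumes \<beta>: "0 < \<beta>" "0 \<le> t" and u: "continuous_on {0..t} u" and f: "\<And>n. continuous_on {0..t} (f n)"
    and le: "\<And>n s. 0 \<le> s \<Longrightarrow> s \<le> t \<Longrightarrow> norm (f n s - u s) \<le> \<epsilon> n" and \<epsilon>: "\<epsilon> \<longlonglongrightarrow> 0"
  shows "(\<lambda>n. frac_conv \<beta> (f n) t) \<longlonglongrightarrow> frac_conv \<beta> u t"
proof (rule LIM_zero_cancel, rule Lim_null_comparison)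
  show "\<forall>\<^sub>F n in sequentially. norm (frac_conv \<beta> (f n) t - frac_conv \<beta> u t) \<le> t powr \<beta> / Gamma (\<beta> + 1) * \<epsilon> n"
    using norm_frac_conv_le[OF \<beta> continuous_on_diff[OF f u] le]
    by (simp add: frac_conv_diff[OF \<beta> f u])
  show "(\<lambda>n. t powr \<beta> / Gamma (\<beta> + 1) * \<epsilon> n) \<longlonglongrightarrow> 0"
    by (rule tendsto_mult_right_zero[OF \<epsilon>])
qed

text \<open>After the substitution the domain of integration is fixed and the singularity is gone:
  \<open>t\<close> enters through the prefactor and through a jointly continuous integrand.\<close>

lemma continuous_on_frac_conv:
  fixes u :: "real \<Rightarrow> 'h::complex_hilbert_space"
  assumes \<beta>: "0 < \<beta>" and u: "continuous_on {0..} u"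
  shows "continuous_on {0..} (frac_conv \<beta> u)"
proof -
  have "0 < Gamma (\<beta> + 1)" using \<beta> by (intro Gamma_real_pos) auto
  then have G: "Gamma (\<beta> + 1) \<noteq> 0" by simp
  have "continuous_on {0..} (\<lambda>t. (t powr \<beta> / Gamma (\<beta> + 1)) *\<^sub>R integral (cbox 0 1) (\<lambda>\<rho>. u (t * (1 - \<rho> powr (1 / \<beta>)))))"
  proof (intro continuous_on_scaleR continuous_on_divide continuous_on_const continuous_on_powr'
      continuous_on_id integral_continuous_on_param)
    show "continuous_on ({0..} \<times> cbox 0 1) (\<lambda>(t, \<rho>). u (t * (1 - \<rho> powr (1 / \<beta>))))"
      unfolding case_prod_beta
      by (rule continuous_on_compose2[OF u])
        (use \<beta> frac_arg_range in \<open>auto intro!: continuous_intros continuous_on_powr'\<close>)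
  qed (use \<beta> G in auto)
  then show ?thesis
    by (rule continuous_on_eq) (simp add: frac_conv_eq[OF \<beta>] continuous_on_subset[OF u])
qed

lemma frac_conv_one:
  fixes u :: "real \<Rightarrow> 'h::complex_hilbert_space"
  shows "frac_conv 1 u t = integral {0..t} u"
  unfolding frac_conv_def
  by (rule integral_spike[of "{t}"]) (auto simp: frac_kernel_def)

text \<open>Unlike \<open>s powr 0\<close>, the following power is continuous at \<open>0\<close> also for exponent \<open>0\<close>.\<close>

definition cpow :: "real \<Rightarrow> real \<Rightarrow> complex" where
  "cpow \<mu> s = (if \<mu> = 0 then 1 else of_real (s powr \<mu>))"

lemma continuous_on_cpow: "0 \<le> \<mu> \<Longrightarrow> continuous_on {0..} (cpow \<mu>)"
  unfolding cpow_def[abs_def] by (cases "\<mu> = 0") (auto intro!: continuous_intros continuous_on_powr')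

lemma cpow_of_nat: "0 \<le> s \<Longrightarrow> cpow (real n) s = of_real s ^ n"
  by (cases "s = 0"; cases "n = 0") (auto simp: cpow_def powr_realpow)

text \<open>Euler's Beta integral, rescaled to [0, t].\<close>

lemma frac_conv_cpow:
  assumes \<beta>: "0 < \<beta>" and \<mu>: "0 \<le> \<mu>" and t: "0 \<le> t"
  shows "frac_conv \<beta> (cpow \<mu>) t = of_real (Gamma (\<mu> + 1) / Gamma (\<mu> + \<beta> + 1)) * cpow (\<mu> + \<beta>) t"
proof (cases "t = 0")
  case True
  then show ?thesis using \<beta> \<mu> by (simp add: frac_conv_def cpow_def)
next
  case False
  then have t: "0 < t" using t by simp
  have "((\<lambda>x. x powr (\<mu> + 1 - 1) * (1 - x) powr (\<beta> - 1)) has_integral Beta (\<mu> + 1) \<beta>) (cbox 0 1)"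
    using has_integral_Beta_real[of "\<mu> + 1" \<beta>] \<beta> \<mu> by simp
  from has_integral_affinity'[OF this, of "1 / t" 0]
  have "((\<lambda>s. (s / t) powr \<mu> * (1 - s / t) powr (\<beta> - 1)) has_integral Beta (\<mu> + 1) \<beta> * t) {0..t}"
    using t by (simp add: divide_inverse mult.commute)
  from has_integral_mult_right[OF this, of "t powr (\<mu> + \<beta> - 1) / Gamma \<beta>"]
  have B: "((\<lambda>s. t powr (\<mu> + \<beta> - 1) / Gamma \<beta> * ((s / t) powr \<mu> * (1 - s / t) powr (\<beta> - 1))) has_integral
      t powr (\<mu> + \<beta> - 1) / Gamma \<beta> * (Beta (\<mu> + 1) \<beta> * t)) {0..t}" .
  have val: "t powr (\<mu> + \<beta> - 1) / Gamma \<beta> * (Beta (\<mu> + 1) \<beta> * t) = Gamma (\<mu> + 1) / Gamma (\<mu> + \<beta> + 1) * t powr (\<mu> + \<beta>)"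
  proof -
    have "Gamma \<beta> \<noteq> 0" using Gamma_real_pos[OF \<beta>] by simp
    then show ?thesis using t by (simp add: Beta_def powr_diff add_ac)
  qed
  have "((\<lambda>s. frac_kernel \<beta> (t - s) * s powr \<mu>) has_integral
      Gamma (\<mu> + 1) / Gamma (\<mu> + \<beta> + 1) * t powr (\<mu> + \<beta>)) {0..t}"
    unfolding val[symmetric]
  proof (rule has_integral_eq[OF _ B])
    fix s assume s: "s \<in> {0..t}"
    have "(1 - s / t) powr (\<beta> - 1) = (t - s) powr (\<beta> - 1) / t powr (\<beta> - 1)"
      using s t by (simp add: powr_divide[symmetric] diff_divide_distrib)
    moreover have "(s / t) powr \<mu> = s powr \<mu> / t powr \<mu>" using s t by (simp add: powr_divide)
    moreover have "t powr (\<mu> + \<beta> - 1) = t powr \<mu> * t powr (\<beta> - 1)"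
      by (simp add: powr_add[symmetric] add_diff_eq)
    ultimately show "t powr (\<mu> + \<beta> - 1) / Gamma \<beta> * ((s / t) powr \<mu> * (1 - s / t) powr (\<beta> - 1)) = frac_kernel \<beta> (t - s) * s powr \<mu>"
      using t by (simp add: frac_kernel_def)
  qed
  then have "((\<lambda>s. complex_of_real (frac_kernel \<beta> (t - s) * s powr \<mu>)) has_integral
      of_real (Gamma (\<mu> + 1) / Gamma (\<mu> + \<beta> + 1) * t powr (\<mu> + \<beta>))) {0..t}"
    by (rule has_integral_of_real)
  \<comment> \<open>The point 0 is excepted because there \<open>cpow 0\<close> is 1 while
    \<open>s powr 0\<close> is 0.\<close>
  then have "((\<lambda>s. frac_kernel \<beta> (t - s) *\<^sub>R cpow \<mu> s) has_integral
      of_real (Gamma (\<mu> + 1) / Gamma (\<mu> + \<beta> + 1) * t powr (\<mu> + \<beta>))) {0..t}"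
    by (rule has_integral_spike[of "{0}", rotated 2]) (auto simp: cpow_def scaleR_conv_of_real)
  then show ?thesis
    using \<beta> \<mu> unfolding frac_conv_def by (simp add: integral_unique cpow_def)
qed

section \<open>The semigroup law, from powers to continuous functions\<close>

lemma frac_conv_semigroup_cpow:
  assumes "0 < \<beta>" "0 < \<gamma>" "0 \<le> \<mu>" "0 \<le> t"
  shows "frac_conv \<beta> (frac_conv \<gamma> (cpow \<mu>)) t = frac_conv (\<beta> + \<gamma>) (cpow \<mu>) t"
proof -
  have "frac_conv \<beta> (frac_conv \<gamma> (cpow \<mu>)) t
      = frac_conv \<beta> (\<lambda>s. of_real (Gamma (\<mu> + 1) / Gamma (\<mu> + \<gamma> + 1)) * cpow (\<mu> + \<gamma>) s) t"
    by (rule frac_conv_cong) (use assms in \<open>simp add: frac_conv_cpow\<close>)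
  also have "\<dots> = of_real (Gamma (\<mu> + 1) / Gamma (\<mu> + \<gamma> + 1)) * frac_conv \<beta> (cpow (\<mu> + \<gamma>)) t"
    using assms by (intro frac_conv_cmult continuous_on_subset[OF continuous_on_cpow]) auto
  also have "\<dots> = of_real (Gamma (\<mu> + 1) / Gamma (\<mu> + \<gamma> + 1)) *
      (of_real (Gamma (\<mu> + \<gamma> + 1) / Gamma (\<mu> + \<gamma> + \<beta> + 1)) * cpow (\<mu> + \<gamma> + \<beta>) t)"
    using assms by (simp add: frac_conv_cpow)
  also have "0 < Gamma (\<mu> + \<gamma> + 1)"
    using assms by (intro Gamma_real_pos) auto
  then have "of_real (Gamma (\<mu> + 1) / Gamma (\<mu> + \<gamma> + 1)) *
      (of_real (Gamma (\<mu> + \<gamma> + 1) / Gamma (\<mu> + \<gamma> + \<beta> + 1)) * cpow (\<mu> + \<gamma> + \<beta>) t)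
      = of_real (Gamma (\<mu> + 1) / Gamma (\<mu> + (\<beta> + \<gamma>) + 1)) * cpow (\<mu> + (\<beta> + \<gamma>)) t"
    by (simp add: add_ac)
  also have "\<dots> = frac_conv (\<beta> + \<gamma>) (cpow \<mu>) t"
    using assms by (simp add: frac_conv_cpow)
  finally show ?thesis .
qed

lemma frac_conv_semigroup_poly:
  fixes p :: "real \<Rightarrow> real"
  assumes \<beta>: "0 < \<beta>" and \<gamma>: "0 < \<gamma>" and t: "0 \<le> t" and p: "real_polynomial_function p"
  shows "frac_conv \<beta> (frac_conv \<gamma> (\<lambda>s. complex_of_real (p s))) t = frac_conv (\<beta> + \<gamma>) (\<lambda>s. complex_of_real (p s)) t"
proof -
  obtain a n where pa: "p = (\<lambda>x. \<Sum>i\<le>n. a i * x ^ i)"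
    using p unfolding real_polynomial_function_iff_sum by blast
  have ps: "complex_of_real (p s) = (\<Sum>i\<le>n. of_real (a i) * cpow (real i) s)" if "0 \<le> s" for s
    using that by (simp add: pa cpow_of_nat)
  have cc: "continuous_on {0..s} (cpow (real i))" for i s
    by (rule continuous_on_subset[OF continuous_on_cpow]) auto
  have cf: "continuous_on {0..s} (frac_conv \<gamma> (cpow (real i)))" for i s
    by (rule continuous_on_subset[OF continuous_on_frac_conv[OF \<gamma> continuous_on_cpow]]) auto
  have inner: "frac_conv \<delta> (\<lambda>s. complex_of_real (p s)) s = (\<Sum>i\<le>n. of_real (a i) * frac_conv \<delta> (cpow (real i)) s)"
    if "0 < \<delta>" "0 \<le> s" for \<delta> s
  proof -
    have "frac_conv \<delta> (\<lambda>s. complex_of_real (p s)) s = frac_conv \<delta> (\<lambda>s. \<Sum>i\<le>n. of_real (a i) * cpow (real i) s) s"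
      by (rule frac_conv_cong) (simp add: ps)
    also have "\<dots> = (\<Sum>i\<le>n. of_real (a i) * frac_conv \<delta> (cpow (real i)) s)"
      using that by (intro frac_conv_sum cc) auto
    finally show ?thesis .
  qed
  have "frac_conv \<beta> (frac_conv \<gamma> (\<lambda>s. complex_of_real (p s))) t
      = frac_conv \<beta> (\<lambda>s. \<Sum>i\<le>n. of_real (a i) * frac_conv \<gamma> (cpow (real i)) s) t"
    by (rule frac_conv_cong) (simp add: inner \<gamma>)
  also have "\<dots> = (\<Sum>i\<le>n. of_real (a i) * frac_conv \<beta> (frac_conv \<gamma> (cpow (real i))) t)"
    using \<beta> t by (intro frac_conv_sum cf) auto
  also have "\<dots> = frac_conv (\<beta> + \<gamma>) (\<lambda>s. complex_of_real (p s)) t"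
    using assms by (simp add: inner frac_conv_semigroup_cpow)
  finally show ?thesis .
qed

text \<open>Weierstrass approximation on [0, t] replaces an interchange of two singular integrals.
  Fractional integration is continuous in the sup norm, and its bound is uniform for s \<le> t, so
  the error passes through the inner integral into the outer one.\<close>

lemma frac_conv_semigroup_real:
  fixes \<phi> :: "real \<Rightarrow> real"
  assumes \<beta>: "0 < \<beta>" and \<gamma>: "0 < \<gamma>" and t: "0 \<le> t" and \<phi>: "continuous_on {0..} \<phi>"
  shows "frac_conv \<beta> (frac_conv \<gamma> (\<lambda>s. complex_of_real (\<phi> s))) t = frac_conv (\<beta> + \<gamma>) (\<lambda>s. complex_of_real (\<phi> s)) t"
proof -
  have "\<exists>p. real_polynomial_function p \<and> (\<forall>s\<in>{0..t}. \<bar>\<phi> s - p s\<bar> < 1 / real (Suc n))" for n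
  proof -
    have "continuous_on {0..t} \<phi>" by (rule continuous_on_subset[OF \<phi>]) auto
    from Stone_Weierstrass_real_polynomial_function[OF _ this, of "1 / real (Suc n)"] show ?thesis
      by (metis compact_Icc of_nat_0_less_iff zero_less_Suc zero_less_divide_1_iff)
  qed
  then obtain p where p: "\<And>n. real_polynomial_function (p n)"
    and le: "\<And>n s. 0 \<le> s \<Longrightarrow> s \<le> t \<Longrightarrow> \<bar>\<phi> s - p n s\<bar> < 1 / real (Suc n)"
    by (metis atLeastAtMost_iff)
  have cp: "continuous_on S (p n)" for n S
    using p by (intro continuous_on_polymonial_function) (simp add: real_polynomial_function_eq)
  have lim: "(\<lambda>n. 1 / real (Suc n)) \<longlonglongrightarrow> 0"
    using LIMSEQ_inverse_real_of_nat by (simp add: inverse_eq_divide)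
  have le': "norm (complex_of_real (p n s) - complex_of_real (\<phi> s)) \<le> 1 / real (Suc n)" if "0 \<le> s" "s \<le> t" for n s
    using le[OF that, of n] by (simp only: of_real_diff[symmetric] norm_of_real)
  have c\<phi>: "continuous_on S (\<lambda>s. complex_of_real (\<phi> s))" if "S \<subseteq> {0..}" for S
    using continuous_on_subset[OF \<phi> that] by (intro continuous_intros)
  have cfp: "continuous_on S (\<lambda>s. complex_of_real (p n s))" for n S by (intro continuous_intros cp)
  have cfc: "continuous_on {0..t} (frac_conv \<gamma> f)" if "continuous_on {0..} f" for f :: "real \<Rightarrow> complex"
    by (rule continuous_on_subset[OF continuous_on_frac_conv[OF \<gamma> that]]) auto
  have "(\<lambda>n. frac_conv (\<beta> + \<gamma>) (\<lambda>s. complex_of_real (p n s)) t) \<longlonglongrightarrow> frac_conv (\<beta> + \<gamma>) (\<lambda>s. complex_of_real (\<phi> s)) t"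
    by (rule frac_conv_tendsto[OF _ t _ _ le' lim]) (use \<beta> \<gamma> c\<phi> cfp in auto)
  moreover have "(\<lambda>n. frac_conv \<beta> (frac_conv \<gamma> (\<lambda>s. complex_of_real (p n s))) t) \<longlonglongrightarrow> frac_conv \<beta> (frac_conv \<gamma> (\<lambda>s. complex_of_real (\<phi> s))) t"
  proof (rule frac_conv_tendsto[OF \<beta> t])
    show "continuous_on {0..t} (frac_conv \<gamma> (\<lambda>s. complex_of_real (\<phi> s)))" by (rule cfc[OF c\<phi>]) simp
    show "continuous_on {0..t} (frac_conv \<gamma> (\<lambda>s. complex_of_real (p n s)))" for n by (rule cfc[OF cfp])
    have G: "0 < Gamma (\<gamma> + 1)" using \<gamma> by (intro Gamma_real_pos) auto
    show "norm (frac_conv \<gamma> (\<lambda>s. complex_of_real (p n s)) s - frac_conv \<gamma> (\<lambda>s. complex_of_real (\<phi> s)) s)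
        \<le> t powr \<gamma> / Gamma (\<gamma> + 1) * (1 / real (Suc n))" if s: "0 \<le> s" "s \<le> t" for n s
    proof -
      have "norm (frac_conv \<gamma> (\<lambda>s. complex_of_real (p n s)) s - frac_conv \<gamma> (\<lambda>s. complex_of_real (\<phi> s)) s)
          = norm (frac_conv \<gamma> (\<lambda>s. complex_of_real (p n s) - complex_of_real (\<phi> s)) s)"
        using c\<phi>[of "{0..s}"] cfp by (subst frac_conv_diff[OF \<gamma> s(1)]) auto
      also have "\<dots> \<le> s powr \<gamma> / Gamma (\<gamma> + 1) * (1 / real (Suc n))"
        using s le' c\<phi>[of "{0..s}"] cfp by (intro norm_frac_conv_le[OF \<gamma>] continuous_on_diff) auto
      also have "\<dots> \<le> t powr \<gamma> / Gamma (\<gamma> + 1) * (1 / real (Suc n))"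
        using s \<gamma> G by (intro mult_right_mono divide_right_mono powr_mono2) auto
      finally show ?thesis .
    qed
    show "(\<lambda>n. t powr \<gamma> / Gamma (\<gamma> + 1) * (1 / real (Suc n))) \<longlonglongrightarrow> 0"
      by (rule tendsto_mult_right_zero[OF lim])
  qed
  ultimately show ?thesis
    unfolding frac_conv_semigroup_poly[OF \<beta> \<gamma> t p] by (rule LIMSEQ_unique[rotated])
qed

theorem frac_conv_semigroup:
  fixes \<phi> :: "real \<Rightarrow> complex"
  assumes \<beta>: "0 < \<beta>" and \<gamma>: "0 < \<gamma>" and t: "0 \<le> t" and \<phi>: "continuous_on {0..} \<phi>"
  shows "frac_conv \<beta> (frac_conv \<gamma> \<phi>) t = frac_conv (\<beta> + \<gamma>) \<phi> t"
proof -
  define f g where "f s = complex_of_real (Re (\<phi> s))" and "g s = complex_of_real (Im (\<phi> s))" for s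
  have cf: "continuous_on {0..} f" and cg: "continuous_on {0..} g"
    unfolding f_def g_def by (intro continuous_intros \<phi>)+
  have sub: "continuous_on {0..s} h" if "continuous_on {0..} h" for h :: "real \<Rightarrow> complex" and s :: real
    by (rule continuous_on_subset[OF that]) auto
  have \<phi>eq: "\<phi> = (\<lambda>s. f s + \<i> * g s)" by (auto simp: f_def g_def complex_eq_iff)
  have dec: "frac_conv \<delta> \<phi> s = frac_conv \<delta> f s + \<i> * frac_conv \<delta> g s" if "0 < \<delta>" "0 \<le> s" for \<delta> s
    unfolding \<phi>eq using that sub[OF cf] sub[OF cg]
    by (subst frac_conv_add) (auto intro!: continuous_intros simp: frac_conv_cmult)
  have "frac_conv \<beta> (frac_conv \<gamma> \<phi>) t = frac_conv \<beta> (\<lambda>s. frac_conv \<gamma> f s + \<i> * frac_conv \<gamma> g s) t"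
    by (rule frac_conv_cong) (simp add: dec \<gamma>)
  also have "\<dots> = frac_conv \<beta> (frac_conv \<gamma> f) t + \<i> * frac_conv \<beta> (frac_conv \<gamma> g) t"
    using sub[OF continuous_on_frac_conv[OF \<gamma> cf]] sub[OF continuous_on_frac_conv[OF \<gamma> cg]] \<beta> t
    by (subst frac_conv_add) (auto intro!: continuous_intros simp: frac_conv_cmult)
  also have "\<dots> = frac_conv (\<beta> + \<gamma>) \<phi> t"
    using frac_conv_semigroup_real[OF \<beta> \<gamma> t continuous_on_Re[OF \<phi>]]
      frac_conv_semigroup_real[OF \<beta> \<gamma> t continuous_on_Im[OF \<phi>]] \<beta> \<gamma> t
    by (simp add: dec f_def[abs_def] g_def[abs_def])
  finally show ?thesis .
qed

section \<open>The scalar Volterra equation\<close>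

lemma minus_it_powr_power_cpow:
  assumes "0 < \<alpha>" "0 \<le> t"
  shows "minus_it_powr \<alpha> t ^ k = minus_i_powr \<alpha> ^ k * cpow (\<alpha> * real k) t"
proof (cases "t = 0")
  case True
  then show ?thesis using assms by (cases k) (auto simp: minus_it_powr_def cpow_def)
next
  case False
  then show ?thesis using assms minus_it_powr_power[of t \<alpha> k] by (auto simp: cpow_def)
qed

text \<open>The time-integrated form of D^\<alpha> e = (-i)^\<alpha> a e with e 0 = 1; the last term
  is the fractional integral of the initial value. It needs no differentiation of the series:
  integrating term k + 1 to order 1 - \<alpha> gives (-i)^\<alpha> a times the ordinary integral of
  term k.\<close>

theorem mittag_leffler_volterra:
  fixes a :: real
  assumes \<alpha>: "0 < \<alpha>" "\<alpha> < 1" and t: "0 \<le> t" and a: "0 \<le> a"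
  defines "e \<equiv> \<lambda>s. mittag_leffler \<alpha> (minus_it_powr \<alpha> s * of_real a)"
  shows "frac_conv (1 - \<alpha>) e t
    = minus_i_powr \<alpha> * of_real a * integral {0..t} e + of_real (t powr (1 - \<alpha>) / Gamma (2 - \<alpha>))"
proof -
  define d where "d = minus_i_powr \<alpha> * of_real a"
  define f where "f k s = cpow (\<alpha> * real k) s" for k s
  define \<Gamma>k where "\<Gamma>k k = complex_of_real (Gamma (\<alpha> * real k + 1))" for k
  define S where "S N s = (\<Sum>k<N. d ^ k / \<Gamma>k k * f k s)" for N s
  \<comment> \<open>Adding 1 keeps the radius positive when t = 0 or a = 0.\<close>
  define R where "R = t powr \<alpha> * a + 1"
  have R: "0 < R" using a by (simp add: R_def add_nonneg_pos)
  have cf: "continuous_on {0..t} (f k)" for k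
    unfolding f_def by (rule continuous_on_subset[OF continuous_on_cpow]) (use \<alpha> in auto)
  have cS: "continuous_on {0..t} (S N)" for N unfolding S_def by (intro continuous_intros cf)
  have ce: "continuous_on {0..t} e"
    unfolding e_def by (rule continuous_on_subset[OF continuous_on_ml]) (use \<alpha> in auto)
  have trm: "(minus_it_powr \<alpha> s * of_real a) ^ k / \<Gamma>k k = d ^ k / \<Gamma>k k * f k s" if "0 \<le> s" for k s
    using minus_it_powr_power_cpow[OF \<alpha>(1) that] by (simp add: d_def f_def power_mult_distrib)
  define q where "q = exp ((2 * R) powr (1 / \<alpha>))"
  have bnd: "norm (S N s - e s) \<le> q * (1/2) ^ N * 2" if s: "0 \<le> s" "s \<le> t" for N s
  proof -
    define z where "z = minus_it_powr \<alpha> s * of_real a"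
    have "norm z \<le> R"
    proof -
      have "norm z = s powr \<alpha> * a" using a by (simp add: z_def norm_mult norm_minus_it_powr)
      also have "\<dots> \<le> t powr \<alpha> * a" using s \<alpha> a by (intro mult_right_mono powr_mono2) auto
      finally show ?thesis by (simp add: R_def)
    qed
    then have tb: "norm (z ^ k / \<Gamma>k k) \<le> q * (1/2) ^ k" for k
      unfolding q_def \<Gamma>k_def by (rule mittag_leffler_term_bound[OF \<alpha>(1) R])
    have sm: "summable (\<lambda>k. norm (z ^ k / \<Gamma>k k))" unfolding \<Gamma>k_def by (rule mittag_leffler_summable[OF \<alpha>(1)])
    have smN: "summable (\<lambda>k. norm (z ^ (k + N) / \<Gamma>k (k + N)))"
      using summable_ignore_initial_segment[OF sm, of N] .
    have "e s = (\<Sum>k. z ^ (k + N) / \<Gamma>k (k + N)) + (\<Sum>k<N. z ^ k / \<Gamma>k k)"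
      unfolding e_def z_def[symmetric] mittag_leffler_def \<Gamma>k_def[symmetric]
      by (rule suminf_split_initial_segment[OF summable_norm_cancel[OF sm]])
    moreover have "S N s = (\<Sum>k<N. z ^ k / \<Gamma>k k)"
      unfolding S_def z_def by (simp add: trm s)
    ultimately have "norm (S N s - e s) = norm (\<Sum>k. z ^ (k + N) / \<Gamma>k (k + N))"
      by (simp add: norm_minus_commute)
    also have "\<dots> \<le> (\<Sum>k. norm (z ^ (k + N) / \<Gamma>k (k + N)))"
      by (rule summable_norm[OF smN])
    also have "\<dots> \<le> (\<Sum>k. q * (1/2) ^ N * (1/2) ^ k)"
    proof (rule suminf_le[OF _ smN])
      show "norm (z ^ (k + N) / \<Gamma>k (k + N)) \<le> q * (1/2) ^ N * (1/2) ^ k" for k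
        using tb[of "k + N"] by (simp add: power_add mult_ac)
      show "summable (\<lambda>k. q * (1/2) ^ N * (1/2::real) ^ k)" by (intro summable_mult summable_geometric) simp
    qed
    also have "\<dots> = q * (1/2) ^ N * 2"
      by (subst suminf_mult) (simp_all add: suminf_geometric summable_geometric)
    finally show ?thesis .
  qed
  have lim0: "(\<lambda>N. q * (1/2) ^ N * 2) \<longlonglongrightarrow> 0" by real_asymp
  have L1: "(\<lambda>N. frac_conv (1 - \<alpha>) (S N) t) \<longlonglongrightarrow> frac_conv (1 - \<alpha>) e t"
    by (rule frac_conv_tendsto[OF _ t ce cS bnd lim0]) (use \<alpha> in auto)
  have L2: "(\<lambda>N. frac_conv 1 (S N) t) \<longlonglongrightarrow> frac_conv 1 e t"
    by (rule frac_conv_tendsto[OF _ t ce cS bnd lim0]) auto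
  have SF: "frac_conv \<beta> (S N) t = (\<Sum>k<N. d ^ k / of_real (Gamma (\<alpha> * real k + \<beta> + 1)) * cpow (\<alpha> * real k + \<beta>) t)"
    if "0 < \<beta>" for \<beta> N
  proof -
    have "frac_conv \<beta> (S N) t = (\<Sum>k<N. d ^ k / \<Gamma>k k * frac_conv \<beta> (f k) t)"
      unfolding S_def[abs_def] by (intro frac_conv_sum that t cf) auto
    also have "\<dots> = (\<Sum>k<N. d ^ k / of_real (Gamma (\<alpha> * real k + \<beta> + 1)) * cpow (\<alpha> * real k + \<beta>) t)"
    proof (intro sum.cong refl)
      fix k
      have "0 < Gamma (\<alpha> * real k + 1)" using \<alpha> by (intro Gamma_real_pos) (simp add: add_nonneg_pos)
      then show "d ^ k / \<Gamma>k k * frac_conv \<beta> (f k) t = d ^ k / of_real (Gamma (\<alpha> * real k + \<beta> + 1)) * cpow (\<alpha> * real k + \<beta>) t"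
        unfolding f_def \<Gamma>k_def using \<alpha> t that frac_conv_cpow[of \<beta> "\<alpha> * real k" t] by simp
    qed
    finally show ?thesis .
  qed
  have step: "frac_conv (1 - \<alpha>) (S (Suc N)) t = of_real (t powr (1 - \<alpha>) / Gamma (2 - \<alpha>)) + d * frac_conv 1 (S N) t" for N
  proof -
    \<comment> \<open>The index shift of the proof: raising k by one adds \<alpha>, which restores
      the order of integration from 1 - \<alpha> to 1.\<close>
    have e1: "\<alpha> * real (Suc k) + (1 - \<alpha>) = \<alpha> * real k + 1" for k by (simp add: algebra_simps)
    have "frac_conv (1 - \<alpha>) (S (Suc N)) t
        = (\<Sum>k<Suc N. d ^ k / of_real (Gamma (\<alpha> * real k + (1 - \<alpha>) + 1)) * cpow (\<alpha> * real k + (1 - \<alpha>)) t)"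
      using \<alpha> by (intro SF) simp
    also have "\<dots> = d ^ 0 / of_real (Gamma (\<alpha> * real 0 + (1 - \<alpha>) + 1)) * cpow (\<alpha> * real 0 + (1 - \<alpha>)) t
      + (\<Sum>k<N. d ^ Suc k / of_real (Gamma (\<alpha> * real (Suc k) + (1 - \<alpha>) + 1)) * cpow (\<alpha> * real (Suc k) + (1 - \<alpha>)) t)"
      by (rule sum.lessThan_Suc_shift)
    also have "(\<Sum>k<N. d ^ Suc k / of_real (Gamma (\<alpha> * real (Suc k) + (1 - \<alpha>) + 1)) * cpow (\<alpha> * real (Suc k) + (1 - \<alpha>)) t)
        = d * frac_conv 1 (S N) t"
      unfolding e1 by (simp add: SF sum_distrib_left mult_ac)
    also have "d ^ 0 / of_real (Gamma (\<alpha> * real 0 + (1 - \<alpha>) + 1)) * cpow (\<alpha> * real 0 + (1 - \<alpha>)) t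
        = of_real (t powr (1 - \<alpha>) / Gamma (2 - \<alpha>))"
      using \<alpha> by (simp add: cpow_def add.commute)
    finally show ?thesis .
  qed
  have "(\<lambda>N. frac_conv (1 - \<alpha>) (S (Suc N)) t) \<longlonglongrightarrow> of_real (t powr (1 - \<alpha>) / Gamma (2 - \<alpha>)) + d * frac_conv 1 e t"
    unfolding step by (intro tendsto_intros L2)
  from LIMSEQ_unique[OF LIMSEQ_Suc[OF L1] this]
  show ?thesis by (simp add: frac_conv_one d_def add.commute)
qed

subsection \<open>Riemann sums\<close>

text \<open>Finite sums commute with the functional calculus, so this is the bridge between
  integrating vectors \<Phi>(\<phi> s) w and integrating the scalar functions \<phi> s; it is
  applied to both.\<close>

theorem riemann_sums_tendsto:
  fixes f :: "real \<Rightarrow> 'a::banach"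
  assumes f: "continuous_on {0..1} f"
  shows "(\<lambda>n. (\<Sum>k<Suc n. (1 / real (Suc n)) *\<^sub>R f (real k / real (Suc n)))) \<longlonglongrightarrow> integral {0..1} f"
proof (rule metric_LIMSEQ_I)
  fix e :: real assume e: "0 < e"
  have "uniformly_continuous_on {0..1} f" by (rule compact_uniformly_continuous[OF f]) simp
  then obtain d where d: "0 < d" "\<And>x y. x \<in> {0..1} \<Longrightarrow> y \<in> {0..1} \<Longrightarrow> dist y x < d \<Longrightarrow> dist (f y) (f x) < e / 2"
    unfolding uniformly_continuous_on_def using e by (metis half_gt_zero)
  obtain N :: nat where N: "1 / d < real N" using reals_Archimedean2 by blast
  have "dist (\<Sum>k<Suc n. (1 / real (Suc n)) *\<^sub>R f (real k / real (Suc n))) (integral {0..1} f) < e" if n: "N \<le> n" for n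
  proof -
    define m where "m = Suc n"
    have m: "0 < real m" "1 / real m < d"
    proof -
      show "0 < real m" by (simp add: m_def)
      have "1 / d < real m" using N n by (simp add: m_def)
      then show "1 / real m < d" using d(1) by (simp add: m_def field_simps)
    qed
    have sub: "continuous_on {x..y} f" if "0 \<le> x" "y \<le> 1" for x y
      using f by (rule continuous_on_subset) (use that in auto)
    have split: "j \<le> m \<Longrightarrow> integral {0..real j / real m} f = (\<Sum>k<j. integral {real k / real m..real (Suc k) / real m} f)" for j
    proof (induction j)
      case (Suc j)
      have "integral {0..real j / real m} f + integral {real j / real m..real (Suc j) / real m} f = integral {0..real (Suc j) / real m} f"
        using m Suc.prems by (intro Henstock_Kurzweil_Integration.integral_combine integrable_continuous_interval sub) (auto simp: divide_right_mono)
      then show ?case using Suc by simp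
    qed simp
    have "integral {0..1} f = (\<Sum>k<m. integral {real k / real m..real (Suc k) / real m} f)"
      using split[of m] m by simp
    then have "(\<Sum>k<m. (1 / real m) *\<^sub>R f (real k / real m)) - integral {0..1} f
        = (\<Sum>k<m. (1 / real m) *\<^sub>R f (real k / real m) - integral {real k / real m..real (Suc k) / real m} f)"
      by (simp add: sum_subtractf)
    also have "norm \<dots> \<le> (\<Sum>k<m. e / 2 * (1 / real m))"
    proof (rule sum_norm_le)
      fix k assume "k \<in> {..<m}"
      then have k: "Suc k \<le> m" by simp
      have r: "0 \<le> real k / real m" "real k / real m \<le> real (Suc k) / real m" "real (Suc k) / real m \<le> 1"
        using m k by (auto simp: divide_right_mono)
      have len: "real (Suc k) / real m - real k / real m = 1 / real m" by (simp add: diff_divide_distrib[symmetric])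
      have c: "continuous_on {real k / real m..real (Suc k) / real m} f" using r by (intro sub) auto
      have "(1 / real m) *\<^sub>R f (real k / real m) = integral {real k / real m..real (Suc k) / real m} (\<lambda>x. f (real k / real m))"
        using r len by simp
      then have "(1 / real m) *\<^sub>R f (real k / real m) - integral {real k / real m..real (Suc k) / real m} f
          = integral {real k / real m..real (Suc k) / real m} (\<lambda>x. f (real k / real m) - f x)"
        using c by (simp add: integral_diff integrable_continuous_interval)
      also have "norm \<dots> \<le> e / 2 * (real (Suc k) / real m - real k / real m)"
      proof (rule integral_bound)
        fix x assume x: "x \<in> {real k / real m..real (Suc k) / real m}"
        then have "\<bar>real k / real m - x\<bar> \<le> 1 / real m" using len by auto
        then have "dist (real k / real m) x < d" using m(2) by (simp add: dist_real_def)
        moreover have "0 \<le> x" "x \<le> 1" using r x unfolding atLeastAtMost_iff by linarith+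
        ultimately have "dist (f (real k / real m)) (f x) < e / 2" using r by (intro d(2)) auto
        then show "norm (f (real k / real m) - f x) \<le> e / 2" by (simp add: dist_norm)
      qed (use r c in \<open>auto intro!: continuous_intros\<close>)
      finally show "norm ((1 / real m) *\<^sub>R f (real k / real m) - integral {real k / real m..real (Suc k) / real m} f) \<le> e / 2 * (1 / real m)"
        unfolding len .
    qed
    also have "\<dots> = e / 2" using m by simp
    also have "\<dots> < e" using e by simp
    finally show ?thesis unfolding dist_norm m_def .
  qed
  then show "\<exists>no. \<forall>n\<ge>no. dist (\<Sum>k<Suc n. (1 / real (Suc n)) *\<^sub>R f (real k / real (Suc n))) (integral {0..1} f) < e"
    by blast
qed

subsection \<open>Cyclic decomposition\<close>

text \<open>The properties of (I + A)^(-1) on which the spectral representation rests.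
  \<open>B_sq\<close> states that B - B^2 is positive.\<close>

locale positive_contraction =
  fixes B :: "'h::complex_hilbert_space \<Rightarrow> 'h"
  assumes B_add: "B (x + y) = B x + B y"
    and B_scale: "B (c *\<^sub>C x) = c *\<^sub>C B x"
    and B_sym: "cinner (B x) y = cinner x (B y)"
    and B_norm: "norm (B x) \<le> norm x"
    and B_sq: "(norm (B x))\<^sup>2 \<le> Re (cinner (B x) x)"
    and B_inj: "B x = 0 \<Longrightarrow> x = 0"
begin

abbreviation C where "C x \<equiv> x - B x"

lemma B_diff: "B (x - y) = B x - B y"
  using B_add[of x "(-1) *\<^sub>C y"] B_scale[of "-1" y] by (simp add: scaleC_minus_one)

lemma B_zero: "B 0 = 0"
  using B_diff[of 0 0] by simp

lemma Bn_diff: "(B ^^ n) (x - y) = (B ^^ n) x - (B ^^ n) y"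
  by (induction n) (simp_all add: B_diff)

lemma Bn_sym: "cinner ((B ^^ n) x) y = cinner x ((B ^^ n) y)"
proof (induction n arbitrary: x y)
  case (Suc n)
  have "cinner ((B ^^ Suc n) x) y = cinner ((B ^^ n) x) (B y)" by (simp add: B_sym)
  also have "\<dots> = cinner x ((B ^^ n) (B y))" by (rule Suc)
  finally show ?case by (simp add: funpow_swap1)
qed simp

lemma Bn_Bm: "cinner ((B ^^ n) x) ((B ^^ m) y) = cinner ((B ^^ (n + m)) x) y"
  using Bn_sym[of m "(B ^^ n) x" y] by (simp add: add.commute[of n m] funpow_add)

lemma BkC: "(B ^^ k) (C x) = C ((B ^^ k) x)"
  by (simp add: Bn_diff funpow_swap1)

lemma C_sym: "cinner (C x) y = cinner x (C y)"
  by (simp add: cinner_diff_left cinner_diff_right B_sym)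

lemma CjB: "(C ^^ j) (B x) = B ((C ^^ j) x)"
  by (induction j) (simp_all add: B_diff)

text \<open>B and I - B commute and are symmetric, so one of two equal factors can be moved to the
  other side of the inner product, which replaces \<open>h\<close> by B h or (I - B) h. This lowers
  both exponents to 0 or 1; the four remaining cases are |h|^2 and positivity of B, I - B and B -
  B^2.\<close>

lemma mixed_moment_nonneg: "0 \<le> Re (cinner ((B ^^ k) ((C ^^ j) h)) h)"
proof (induction k arbitrary: h rule: nat_less_induct)
  case IH: (1 k)
  show ?case
  proof (cases "2 \<le> k")
    case True
    then obtain k' where k: "k = Suc (Suc k')" by (metis add_2_eq_Suc le_Suc_ex)
    have "cinner ((B ^^ k) ((C ^^ j) h)) h = cinner (B ((B ^^ k') (B ((C ^^ j) h)))) h"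
      by (simp add: k funpow_swap1)
    also have "\<dots> = cinner ((B ^^ k') ((C ^^ j) (B h))) (B h)" by (simp add: B_sym CjB)
    finally show ?thesis using IH k by simp
  next
    case False
    then have k: "k = 0 \<or> k = 1" by auto
    show ?thesis
    proof (induction j arbitrary: h rule: nat_less_induct)
      case IH: (1 j)
      show ?case
      proof (cases "2 \<le> j")
        case True
        then obtain j' where j: "j = Suc (Suc j')" by (metis add_2_eq_Suc le_Suc_ex)
        have "(B ^^ k) ((C ^^ j) h) = (B ^^ k) (C (C ((C ^^ j') h)))" by (simp add: j)
        also have "\<dots> = C ((B ^^ k) (C ((C ^^ j') h)))" by (rule BkC)
        also have "C ((C ^^ j') h) = (C ^^ j') (C h)" by (rule funpow_swap1)
        finally have "(B ^^ k) ((C ^^ j) h) = C ((B ^^ k) ((C ^^ j') (C h)))" .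
        then have "cinner ((B ^^ k) ((C ^^ j) h)) h = cinner ((B ^^ k) ((C ^^ j') (C h))) (C h)"
          by (simp only: C_sym)
        then show ?thesis using IH j by simp
      next
        case False
        then have j: "j = 0 \<or> j = 1" by auto
        have nn: "0 \<le> Re (cinner (B h) h)" using B_sq[of h] zero_le_power2[of "norm (B h)"] by linarith
        have "(norm (B h))\<^sup>2 \<le> (norm h)\<^sup>2" using B_norm[of h] by (intro power_mono) auto
        moreover have "cmod (cinner (B h) h) \<le> norm (B h) * norm h" by (rule cinner_Cauchy_Schwarz)
        then have "Re (cinner (B h) h) \<le> norm (B h) * norm h"
          using complex_Re_le_cmod order_trans by blast
        moreover have "norm (B h) * norm h \<le> norm h * norm h" using B_norm by (intro mult_right_mono) auto
        ultimately have c1: "0 \<le> Re (cinner (C h) h)"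
          by (simp add: cinner_diff_left cinner_self power2_eq_square del: of_real_mult of_real_power)
        have c2: "0 \<le> Re (cinner (B (C h)) h)"
          using B_sq[of h] by (simp add: B_diff cinner_diff_left B_sym[of "B h"] cinner_self del: of_real_power)
        show ?thesis using j k nn c1 c2 by (auto simp: cinner_self)
      qed
    qed
  qed
qed

lemma moment_real: "cinner ((B ^^ n) h) h = of_real (Re (cinner ((B ^^ n) h) h))"
proof -
  have "cinner ((B ^^ n) h) h = cnj (cinner ((B ^^ n) h) h)"
    using Bn_sym[of n h h] cinner_commute[of h "(B ^^ n) h"] by simp
  from arg_cong[OF this, of Im] show ?thesis by (simp add: complex_eq_iff)
qed

text \<open>The numbers (B^k (I - B)^j h, h) satisfy Hausdorff's recursion because B + (I - B) = I;
  the unit norm normalises the measure.\<close>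

lemma vector_measure_exists:
  assumes h: "norm h = 1"
  shows "\<exists>\<mu>. prob_space \<mu> \<and> sets \<mu> = sets (borel :: real measure) \<and> (AE x in \<mu>. 0 \<le> x \<and> x \<le> 1)
    \<and> (\<forall>m. cinner ((B ^^ m) h) h = of_real (LINT x|\<mu>. x ^ m))"
proof -
  define c where "c k j = Re (cinner ((B ^^ k) ((C ^^ j) h)) h)" for k j
  have 1: "c (Suc k) j + c k (Suc j) = c k j" for k j
  proof -
    have "(B ^^ Suc k) ((C ^^ j) h) + (B ^^ k) ((C ^^ Suc j) h) = (B ^^ k) ((C ^^ j) h)"
      by (simp add: BkC funpow_swap1)
    from arg_cong[OF this, of "\<lambda>x. Re (cinner x h)"] show ?thesis
      unfolding c_def by (simp only: cinner_add_left plus_complex.sel(1))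
  qed
  have 2: "0 \<le> c k j" for k j unfolding c_def by (rule mixed_moment_nonneg)
  have 3: "c 0 0 = 1" using h by (simp add: c_def cinner_self)
  obtain \<mu> :: "real measure" where "prob_space \<mu>" "sets \<mu> = sets borel"
    "AE x in \<mu>. 0 \<le> x \<and> x \<le> 1" "\<And>m. (LINT x|\<mu>. x ^ m) = c m 0"
    using hausdorff_moment_problem[of c, OF 1 2 3] by blast
  moreover have "cinner ((B ^^ m) h) h = of_real (c m 0)" for m
    using moment_real[of m h] by (simp add: c_def)
  ultimately show ?thesis by metis
qed

text \<open>One power on the left suffices: symmetry of B merges powers on both sides into one, so
  the whole cyclic subspaces are orthogonal.\<close>

definition orthogonal_orbits :: "'h set \<Rightarrow> bool" where
  "orthogonal_orbits S \<longleftrightarrow> (\<forall>x\<in>S. norm x = 1) \<and> (\<forall>x\<in>S. \<forall>y\<in>S. x \<noteq> y \<longrightarrow> (\<forall>n. cinner ((B ^^ n) x) y = 0))"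

text \<open>A nonzero vector orthogonal to all orbits could be normalised and added to the set,
  against maximality. Its own orbit is again orthogonal to the old vectors because B is
  symmetric.\<close>

lemma maximal_orbits_exist:
  obtains S where "orthogonal_orbits S" "\<And>y. (\<And>x n. x \<in> S \<Longrightarrow> cinner ((B ^^ n) x) y = 0) \<Longrightarrow> y = 0"
proof -
  have "\<exists>S\<in>{S. orthogonal_orbits S}. \<forall>X\<in>{S. orthogonal_orbits S}. S \<subseteq> X \<longrightarrow> X = S"
  proof (rule subset_Zorn')
    fix \<C> assume ch: "subset.chain {S. orthogonal_orbits S} \<C>"
    then have 1: "\<And>X. X \<in> \<C> \<Longrightarrow> orthogonal_orbits X"
      and 2: "\<And>X Y. X \<in> \<C> \<Longrightarrow> Y \<in> \<C> \<Longrightarrow> X \<subseteq> Y \<or> Y \<subseteq> X"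
      by (auto simp: subset.chain_def)
    show "\<Union>\<C> \<in> {S. orthogonal_orbits S}"
      unfolding orthogonal_orbits_def mem_Collect_eq
    proof (intro conjI ballI impI allI)
      fix x assume "x \<in> \<Union>\<C>"
      then show "norm x = 1" using 1 by (auto simp: orthogonal_orbits_def)
    next
      fix x y n assume "x \<in> \<Union>\<C>" "y \<in> \<Union>\<C>" "x \<noteq> y"
      then obtain X Y where "X \<in> \<C>" "x \<in> X" "Y \<in> \<C>" "y \<in> Y" by auto
      then obtain Z where "Z \<in> \<C>" "x \<in> Z" "y \<in> Z" using 2 by blast
      then show "cinner ((B ^^ n) x) y = 0"
        using 1 \<open>x \<noteq> y\<close> unfolding orthogonal_orbits_def by blast
    qed
  qed
  then obtain S where S: "orthogonal_orbits S" and max: "\<And>X. orthogonal_orbits X \<Longrightarrow> S \<subseteq> X \<Longrightarrow> X = S"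
    by auto
  show ?thesis
  proof (rule that[OF S])
    fix y assume y: "\<And>x n. x \<in> S \<Longrightarrow> cinner ((B ^^ n) x) y = 0"
    show "y = 0"
    proof (rule ccontr)
      assume "y \<noteq> 0"
      define z where "z = (1 / norm y) *\<^sub>R y"
      have z1: "norm z = 1" using \<open>y \<noteq> 0\<close> by (simp add: z_def)
      have z: "cinner ((B ^^ n) x) z = 0" if "x \<in> S" for x n
        using y[OF that] by (simp add: z_def cinner_scaleR_right)
      have z': "cinner ((B ^^ n) z) x = 0" if "x \<in> S" for x n
        using z[OF that, of n] Bn_sym[of n z x] cinner_commute[of z "(B ^^ n) x"] by simp
      have "orthogonal_orbits (insert z S)"
        using S z z' z1 unfolding orthogonal_orbits_def by blast
      then have "z \<in> S" using max by blast
      from z[OF this, of 0] z1 show False by (simp add: cinner_self)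
    qed
  qed
qed

end

subsection \<open>Square integrable functions\<close>

definition l2norm :: "'b measure \<Rightarrow> ('b \<Rightarrow> complex) \<Rightarrow> real" where
  "l2norm M f = sqrt (LINT x|M. (cmod (f x))\<^sup>2)"

lemma square_integrableD:
  assumes "f \<in> square_integrable M"
  shows "f \<in> borel_measurable M" "integrable M (\<lambda>x. (cmod (f x))\<^sup>2)"
  using assms by (auto simp: square_integrable_def)

lemma l2norm_nonneg [simp]: "0 \<le> l2norm M f"
  by (simp add: l2norm_def)

lemma l2norm_sq: "(l2norm M f)\<^sup>2 = (LINT x|M. (cmod (f x))\<^sup>2)"
  by (simp add: l2norm_def)

lemma square_integrable_bound:
  assumes f: "f \<in> square_integrable M" and [measurable]: "g \<in> borel_measurable M"
    and le: "AE x in M. cmod (g x) \<le> C * cmod (f x)"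
  shows "g \<in> square_integrable M"
proof -
  note [measurable] = square_integrableD(1)[OF f]
  have "integrable M (\<lambda>x. (cmod (g x))\<^sup>2)"
  proof (rule Bochner_Integration.integrable_bound)
    show "integrable M (\<lambda>x. C\<^sup>2 * (cmod (f x))\<^sup>2)" using square_integrableD(2)[OF f] by simp
    show "AE x in M. norm ((cmod (g x))\<^sup>2) \<le> norm (C\<^sup>2 * (cmod (f x))\<^sup>2)"
      using le
    proof eventually_elim
      case (elim x)
      have "(cmod (g x))\<^sup>2 \<le> (C * cmod (f x))\<^sup>2" using elim by (intro power_mono) auto
      then show ?case by (simp add: power_mult_distrib)
    qed
  qed simp
  then show ?thesis by (simp add: square_integrable_def)
qed

lemma square_integrable_cmult:
  assumes "f \<in> square_integrable M" shows "(\<lambda>x. c * f x) \<in> square_integrable M"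
  by (rule square_integrable_bound[OF assms, of _ "cmod c"])
    (use square_integrableD(1)[OF assms] in \<open>auto simp: norm_mult\<close>)

lemma square_integrable_add:
  assumes f: "f \<in> square_integrable M" and g: "g \<in> square_integrable M"
  shows "(\<lambda>x. f x + g x) \<in> square_integrable M"
proof -
  note [measurable] = square_integrableD(1)[OF f] square_integrableD(1)[OF g]
  have "integrable M (\<lambda>x. (cmod (f x + g x))\<^sup>2)"
  proof (rule Bochner_Integration.integrable_bound)
    show "integrable M (\<lambda>x. 2 * (cmod (f x))\<^sup>2 + 2 * (cmod (g x))\<^sup>2)"
      using square_integrableD(2)[OF f] square_integrableD(2)[OF g] by simp
    show "AE x in M. norm ((cmod (f x + g x))\<^sup>2) \<le> norm (2 * (cmod (f x))\<^sup>2 + 2 * (cmod (g x))\<^sup>2)"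
    proof (rule AE_I2)
      fix x
      have "(cmod (f x + g x))\<^sup>2 \<le> (cmod (f x) + cmod (g x))\<^sup>2"
        by (intro power_mono norm_triangle_ineq) auto
      also have "\<dots> \<le> 2 * (cmod (f x))\<^sup>2 + 2 * (cmod (g x))\<^sup>2"
        using zero_le_power2[of "cmod (f x) - cmod (g x)"] by (simp add: power2_sum power2_diff)
      finally show "norm ((cmod (f x + g x))\<^sup>2) \<le> norm (2 * (cmod (f x))\<^sup>2 + 2 * (cmod (g x))\<^sup>2)" by simp
    qed
  qed simp
  then show ?thesis by (simp add: square_integrable_def)
qed

lemma square_integrable_diff:
  assumes "f \<in> square_integrable M" "g \<in> square_integrable M"
  shows "(\<lambda>x. f x - g x) \<in> square_integrable M"
  using square_integrable_add[OF assms(1) square_integrable_cmult[OF assms(2), of "-1"]] by simp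

lemma square_integrable_zero: "(\<lambda>x. 0) \<in> square_integrable M"
  by (simp add: square_integrable_def)

lemma borel_measurable_cnj [measurable (raw)]:
  "f \<in> borel_measurable M \<Longrightarrow> (\<lambda>x. cnj (f x)) \<in> borel_measurable M"
  by (rule borel_measurable_continuous_on[of cnj]) (auto intro: continuous_intros)

lemma square_integrable_mult_integrable:
  assumes f: "f \<in> square_integrable M" and g: "g \<in> square_integrable M"
  shows "integrable M (\<lambda>x. f x * cnj (g x))"
proof (rule Bochner_Integration.integrable_bound)
  note [measurable] = square_integrableD(1)[OF f] square_integrableD(1)[OF g]
  show "integrable M (\<lambda>x. (cmod (f x))\<^sup>2 + (cmod (g x))\<^sup>2)"
    using square_integrableD(2)[OF f] square_integrableD(2)[OF g] by simp
  show "(\<lambda>x. f x * cnj (g x)) \<in> borel_measurable M" by measurable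
  show "AE x in M. norm (f x * cnj (g x)) \<le> norm ((cmod (f x))\<^sup>2 + (cmod (g x))\<^sup>2)"
  proof (rule AE_I2)
    fix x
    have "0 \<le> (cmod (f x) - cmod (g x))\<^sup>2 + (cmod (f x))\<^sup>2 + (cmod (g x))\<^sup>2" by simp
    then have "cmod (f x) * cmod (g x) \<le> (cmod (f x))\<^sup>2 + (cmod (g x))\<^sup>2"
      by (simp add: power2_diff)
    then show "norm (f x * cnj (g x)) \<le> norm ((cmod (f x))\<^sup>2 + (cmod (g x))\<^sup>2)" by (simp add: norm_mult)
  qed
qed

lemma l2_Cauchy_Schwarz:
  assumes f: "f \<in> square_integrable M" and g: "g \<in> square_integrable M"
  shows "cmod (LINT x|M. f x * cnj (g x)) \<le> l2norm M f * l2norm M g"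
proof -
  note [measurable] = square_integrableD(1)[OF f] square_integrableD(1)[OF g]
  have fin: "integrable M (\<lambda>x. cmod (f x) * cmod (g x))"
    using square_integrable_mult_integrable[OF f g, THEN integrable_norm] by (simp add: norm_mult)
  define I where "I = (LINT x|M. cmod (f x) * cmod (g x))"
  have I0: "0 \<le> I" by (simp add: I_def)
  have nI: "(\<integral>\<^sup>+x. ennreal (cmod (f x)) * ennreal (cmod (g x)) \<partial>M) = ennreal I"
    unfolding I_def using nn_integral_eq_integral[OF fin] by (simp add: ennreal_mult)
  have nf: "(\<integral>\<^sup>+x. (ennreal (cmod (h x)))\<^sup>2 \<partial>M) = ennreal ((l2norm M h)\<^sup>2)" if "h \<in> square_integrable M" for h
    using nn_integral_eq_integral[OF square_integrableD(2)[OF that]] by (simp add: l2norm_sq ennreal_power)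
  have "(ennreal I)\<^sup>2 \<le> ennreal ((l2norm M f)\<^sup>2) * ennreal ((l2norm M g)\<^sup>2)"
    using Cauchy_Schwarz_nn_integral[of "\<lambda>x. ennreal (cmod (f x))" M "\<lambda>x. ennreal (cmod (g x))"]
    by (simp add: nI nf f g)
  then have "I\<^sup>2 \<le> (l2norm M f)\<^sup>2 * (l2norm M g)\<^sup>2"
    using I0 by (simp add: ennreal_power ennreal_mult[symmetric])
  then have "I\<^sup>2 \<le> (l2norm M f * l2norm M g)\<^sup>2" by (simp add: power_mult_distrib)
  then have "I \<le> l2norm M f * l2norm M g" by (rule power2_le_imp_le) simp
  moreover have "cmod (LINT x|M. f x * cnj (g x)) \<le> I"
    unfolding I_def using integral_norm_bound[of M "\<lambda>x. f x * cnj (g x)"] by (simp add: norm_mult)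
  ultimately show ?thesis by linarith
qed

lemma l2norm_triangle:
  assumes f: "f \<in> square_integrable M" and g: "g \<in> square_integrable M"
  shows "l2norm M (\<lambda>x. f x + g x) \<le> l2norm M f + l2norm M g"
proof (rule power2_le_imp_le)
  have fg: "integrable M (\<lambda>x. f x * cnj (g x))" by (rule square_integrable_mult_integrable[OF f g])
  have pt: "(cmod (f x + g x))\<^sup>2 = (cmod (f x))\<^sup>2 + (cmod (g x))\<^sup>2 + 2 * Re (f x * cnj (g x))" for x
    unfolding cmod_power2 by (simp add: power2_eq_square algebra_simps)
  have "(l2norm M (\<lambda>x. f x + g x))\<^sup>2 = (l2norm M f)\<^sup>2 + (l2norm M g)\<^sup>2 + 2 * Re (LINT x|M. f x * cnj (g x))"
    unfolding l2norm_sq pt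
    using square_integrableD(2)[OF f] square_integrableD(2)[OF g] fg
    by (simp add: integral_Re del: times_complex.sel)
  also have "Re (LINT x|M. f x * cnj (g x)) \<le> l2norm M f * l2norm M g"
    using l2_Cauchy_Schwarz[OF f g] complex_Re_le_cmod order_trans by blast
  finally show "(l2norm M (\<lambda>x. f x + g x))\<^sup>2 \<le> (l2norm M f + l2norm M g)\<^sup>2"
    by (simp add: power2_sum)
qed simp

lemma l2norm_cmult: "l2norm M (\<lambda>x. c * f x) = cmod c * l2norm M f"
  by (simp add: l2norm_def norm_mult power_mult_distrib real_sqrt_mult)

lemma l2norm_minus_commute: "l2norm M (\<lambda>x. f x - g x) = l2norm M (\<lambda>x. g x - f x)"
  by (simp add: l2norm_def norm_minus_commute)

lemma l2norm_triangle_diff: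
  assumes "f \<in> square_integrable M" "g \<in> square_integrable M" "h \<in> square_integrable M"
  shows "l2norm M (\<lambda>x. f x - h x) \<le> l2norm M (\<lambda>x. f x - g x) + l2norm M (\<lambda>x. g x - h x)"
  using l2norm_triangle[OF square_integrable_diff[OF assms(1,2)] square_integrable_diff[OF assms(2,3)]] by simp

lemma l2norm_eq_0_AE:
  assumes "f \<in> square_integrable M" "l2norm M f = 0" shows "AE x in M. f x = 0"
proof -
  have "(LINT x|M. (cmod (f x))\<^sup>2) = 0" using assms(2) by (simp add: l2norm_def)
  then have "AE x in M. (cmod (f x))\<^sup>2 = 0"
    using square_integrableD(2)[OF assms(1)] by (subst (asm) integral_nonneg_eq_0_iff_AE) auto
  then show ?thesis by simp
qed

lemma l2_inner_tendsto:
  assumes sq: "\<And>j. f j \<in> square_integrable M" "f' \<in> square_integrable M"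
      "\<And>j. g j \<in> square_integrable M" "g' \<in> square_integrable M"
    and f: "(\<lambda>j. l2norm M (\<lambda>x. f j x - f' x)) \<longlonglongrightarrow> 0" and g: "(\<lambda>j. l2norm M (\<lambda>x. g j x - g' x)) \<longlonglongrightarrow> 0"
  shows "(\<lambda>j. LINT x|M. f j x * cnj (g j x)) \<longlonglongrightarrow> (LINT x|M. f' x * cnj (g' x))"
proof (rule LIM_zero_cancel, rule Lim_null_comparison)
  let ?d = "\<lambda>j. l2norm M (\<lambda>x. f j x - f' x) * (l2norm M (\<lambda>x. g j x - g' x) + l2norm M g')
      + l2norm M f' * l2norm M (\<lambda>x. g j x - g' x)"
  have "norm ((LINT x|M. f j x * cnj (g j x)) - (LINT x|M. f' x * cnj (g' x))) \<le> ?d j" for j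
  proof -
    note df = square_integrable_diff[OF sq(1)[of j] sq(2)]
    note dg = square_integrable_diff[OF sq(3)[of j] sq(4)]
    have "(LINT x|M. f j x * cnj (g j x)) - (LINT x|M. f' x * cnj (g' x))
        = (LINT x|M. f j x * cnj (g j x) - f' x * cnj (g' x))"
      using sq by (intro Bochner_Integration.integral_diff[symmetric] square_integrable_mult_integrable)
    also have "\<dots> = (LINT x|M. (f j x - f' x) * cnj (g j x) + f' x * cnj (g j x - g' x))"
      by (intro Bochner_Integration.integral_cong refl) (simp add: algebra_simps)
    also have "\<dots> = (LINT x|M. (f j x - f' x) * cnj (g j x)) + (LINT x|M. f' x * cnj (g j x - g' x))"
      using sq df dg by (intro Bochner_Integration.integral_add square_integrable_mult_integrable)
    also have "norm \<dots> \<le> l2norm M (\<lambda>x. f j x - f' x) * l2norm M (g j) + l2norm M f' * l2norm M (\<lambda>x. g j x - g' x)"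
      by (rule norm_triangle_le[OF add_mono[OF l2_Cauchy_Schwarz[OF df sq(3)] l2_Cauchy_Schwarz[OF sq(2) dg]]])
    also have "l2norm M (g j) \<le> l2norm M (\<lambda>x. g j x - g' x) + l2norm M g'"
      using l2norm_triangle[OF dg sq(4)] by simp
    then have "l2norm M (\<lambda>x. f j x - f' x) * l2norm M (g j) + l2norm M f' * l2norm M (\<lambda>x. g j x - g' x) \<le> ?d j"
      by (intro add_right_mono mult_left_mono) auto
    finally show ?thesis .
  qed
  then show "\<forall>\<^sub>F j in sequentially. norm ((LINT x|M. f j x * cnj (g j x)) - (LINT x|M. f' x * cnj (g' x))) \<le> ?d j" by simp
  have "?d \<longlonglongrightarrow> 0 * (0 + l2norm M g') + l2norm M f' * 0" by (intro tendsto_intros f g)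
  then show "?d \<longlonglongrightarrow> 0" by simp
qed

text \<open>Completeness for sequences with geometric steps, which is all that
  \<open>G_total\<close> needs. The rate gives convergence almost everywhere, and Fatou's lemma
  upgrades it to convergence in norm.\<close>

theorem riesz_fischer:
  assumes p: "\<And>j. p j \<in> square_integrable M"
    and fast: "\<And>j. l2norm M (\<lambda>x. p (Suc j) x - p j x) \<le> (1/4) ^ j"
  obtains f where "f \<in> square_integrable M" "(\<lambda>j. l2norm M (\<lambda>x. p j x - f x)) \<longlonglongrightarrow> 0"
proof -
  have [measurable]: "p j \<in> borel_measurable M" for j using square_integrableD(1)[OF p] .
  define d where "d j x = p (Suc j) x - p j x" for j x
  have d: "d j \<in> square_integrable M" for j unfolding d_def by (intro square_integrable_diff p)
  have [measurable]: "d j \<in> borel_measurable M" for j using square_integrableD(1)[OF d] .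
  have "(\<integral>\<^sup>+x. ennreal ((cmod (d j x))\<^sup>2) \<partial>M) \<le> ennreal ((1/16) ^ j)" for j
  proof -
    have "(\<integral>\<^sup>+x. ennreal ((cmod (d j x))\<^sup>2) \<partial>M) = ennreal ((l2norm M (d j))\<^sup>2)"
      using nn_integral_eq_integral[OF square_integrableD(2)[OF d[of j]]] by (simp add: l2norm_sq)
    also have "(l2norm M (d j))\<^sup>2 \<le> ((1/4) ^ j)\<^sup>2"
      using fast[of j] unfolding d_def by (intro power_mono) auto
    also have "((1/4::real) ^ j)\<^sup>2 = (1/16) ^ j"
      by (simp add: power2_eq_square power_mult_distrib[symmetric])
    finally show ?thesis by (simp add: ennreal_leI)
  qed
  \<comment> \<open>The squared steps have integral at most 16^(-j), which leaves room for a weight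
    4^j. Where the weighted series is finite, |d j| is at most a constant times 2^(-j), and the
    steps are summable.\<close>
  then have dj: "(\<integral>\<^sup>+x. ennreal (4 ^ j * (cmod (d j x))\<^sup>2) \<partial>M) \<le> ennreal ((1/4) ^ j)" for j
  proof -
    have "(\<integral>\<^sup>+x. ennreal (4 ^ j * (cmod (d j x))\<^sup>2) \<partial>M) = ennreal (4 ^ j) * (\<integral>\<^sup>+x. ennreal ((cmod (d j x))\<^sup>2) \<partial>M)"
      by (simp add: ennreal_mult nn_integral_cmult)
    also have "\<dots> \<le> ennreal (4 ^ j) * ennreal ((1/16) ^ j)"
      by (intro mult_left_mono \<open>\<And>j. _ \<le> ennreal ((1/16) ^ j)\<close>) simp
    also have "\<dots> = ennreal ((1/4) ^ j)"
      by (simp add: ennreal_mult[symmetric] power_mult_distrib[symmetric])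
    finally show ?thesis .
  qed
  have "(\<integral>\<^sup>+x. (\<Sum>j. ennreal (4 ^ j * (cmod (d j x))\<^sup>2)) \<partial>M) = (\<Sum>j. \<integral>\<^sup>+x. ennreal (4 ^ j * (cmod (d j x))\<^sup>2) \<partial>M)"
    by (rule nn_integral_suminf) measurable
  also have "\<dots> \<le> (\<Sum>j. ennreal ((1/4) ^ j))" by (intro suminf_le dj summableI)
  also have "\<dots> = ennreal (\<Sum>j. (1/4) ^ j)"
    by (intro suminf_ennreal2 summable_geometric) auto
  also have "\<dots> < \<infinity>" by simp
  finally have "AE x in M. (\<Sum>j. ennreal (4 ^ j * (cmod (d j x))\<^sup>2)) \<noteq> \<infinity>"
    by (intro nn_integral_PInf_AE) auto
  then have conv: "AE x in M. convergent (\<lambda>j. p j x)"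
  proof eventually_elim
    case (elim x)
    have "summable (\<lambda>j. 4 ^ j * (cmod (d j x))\<^sup>2)"
      using elim by (intro summable_suminf_not_top) auto
    then have "(\<lambda>j. 4 ^ j * (cmod (d j x))\<^sup>2) \<longlonglongrightarrow> 0" by (rule summable_LIMSEQ_zero)
    then have "Bseq (\<lambda>j. 4 ^ j * (cmod (d j x))\<^sup>2)" by (rule convergent_imp_Bseq[OF convergentI])
    then obtain K where "\<forall>j. norm (4 ^ j * (cmod (d j x))\<^sup>2) \<le> K" by (rule BseqE)
    then have K: "norm (4 ^ j * (cmod (d j x))\<^sup>2) \<le> K" for j by blast
    have "norm (d j x) \<le> sqrt K * (1/2) ^ j" for j
    proof -
      have "(2 ^ j * cmod (d j x))\<^sup>2 \<le> K"
        using K[of j] by (simp add: power_mult_distrib) (simp add: power2_eq_square power_mult_distrib[symmetric])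
      then have "2 ^ j * cmod (d j x) \<le> sqrt K" by (rule real_le_rsqrt)
      then show ?thesis by (simp add: field_simps power_divide)
    qed
    then have "summable (\<lambda>j. d j x)"
      by (intro summable_comparison_test[of "\<lambda>j. d j x" "\<lambda>j. sqrt K * (1/2) ^ j"])
        (auto intro!: summable_mult summable_geometric)
    then have "convergent (\<lambda>j. \<Sum>i<j. d i x)" by (simp add: summable_iff_convergent)
    then have "convergent (\<lambda>j. p 0 x + (\<Sum>i<j. d i x))" by (intro convergent_add convergent_const)
    moreover have "p 0 x + (\<Sum>i<j. d i x) = p j x" for j
      unfolding d_def by (subst sum_lessThan_telescope) simp
    ultimately show ?case by simp
  qed
  define f where "f x = lim (\<lambda>j. p j x)" for x
  have [measurable]: "f \<in> borel_measurable M" unfolding f_def by measurable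
  have lim: "AE x in M. (\<lambda>j. p j x) \<longlonglongrightarrow> f x"
    using conv unfolding f_def by eventually_elim (simp add: convergent_LIMSEQ_iff)
  \<comment> \<open>The factor 1 - (1/4)^k makes the induction close; the constant 2 is larger than
    the sharp 4/3 but sufficient.\<close>
  have cauchy: "l2norm M (\<lambda>x. p j x - p (j + k) x) \<le> 2 * (1/4) ^ j * (1 - (1/4) ^ k)" for j k
  proof (induction k)
    case 0
    show ?case by (simp add: l2norm_def)
  next
    case (Suc k)
    have "l2norm M (\<lambda>x. p j x - p (j + Suc k) x) \<le> l2norm M (\<lambda>x. p j x - p (j + k) x) + l2norm M (\<lambda>x. p (j + k) x - p (j + Suc k) x)"
      by (rule l2norm_triangle_diff[OF p p p])
    also have "l2norm M (\<lambda>x. p (j + k) x - p (j + Suc k) x) \<le> (1/4) ^ (j + k)"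
      using fast[of "j + k"] by (subst l2norm_minus_commute) simp
    finally have "l2norm M (\<lambda>x. p j x - p (j + Suc k) x) \<le> 2 * (1/4) ^ j * (1 - (1/4) ^ k) + (1/4) ^ (j + k)"
      using Suc by simp
    moreover have "(1/4::real) ^ (j + k) = (1/4) ^ j * (1/4) ^ k" by (rule power_add)
    moreover have "2 * (1/4) ^ j * (1 - (1/4::real) ^ Suc k) = 2 * (1/4) ^ j - (1/4) ^ j * (1/4) ^ k / 2"
      "2 * (1/4) ^ j * (1 - (1/4::real) ^ k) = 2 * (1/4) ^ j - 2 * ((1/4) ^ j * (1/4) ^ k)"
      by (simp_all add: right_diff_distrib)
    moreover have "0 \<le> (1/4::real) ^ j * (1/4) ^ k" by simp
    ultimately show ?case by linarith
  qed
  \<comment> \<open>Fatou's lemma as k tends to infinity: the pointwise limit replaces p (j +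
    k).\<close>
  have bound: "(\<integral>\<^sup>+x. ennreal ((cmod (p j x - f x))\<^sup>2) \<partial>M) \<le> ennreal ((2 * (1/4) ^ j)\<^sup>2)" for j
  proof -
    have "(\<integral>\<^sup>+x. ennreal ((cmod (p j x - f x))\<^sup>2) \<partial>M)
        = (\<integral>\<^sup>+x. liminf (\<lambda>k. ennreal ((cmod (p j x - p (j + k) x))\<^sup>2)) \<partial>M)"
    proof (rule nn_integral_cong_AE, use lim in eventually_elim)
      fix x assume "(\<lambda>j. p j x) \<longlonglongrightarrow> f x"
      then have "(\<lambda>k. p (j + k) x) \<longlonglongrightarrow> f x" using LIMSEQ_ignore_initial_segment[of _ _ j] by (simp add: add.commute)
      then have "(\<lambda>k. ennreal ((cmod (p j x - p (j + k) x))\<^sup>2)) \<longlonglongrightarrow> ennreal ((cmod (p j x - f x))\<^sup>2)"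
        by (intro tendsto_ennrealI tendsto_intros)
      then show "ennreal ((cmod (p j x - f x))\<^sup>2) = liminf (\<lambda>k. ennreal ((cmod (p j x - p (j + k) x))\<^sup>2))"
        by (intro lim_imp_Liminf[symmetric]) auto
    qed
    also have "\<dots> \<le> liminf (\<lambda>k. \<integral>\<^sup>+x. ennreal ((cmod (p j x - p (j + k) x))\<^sup>2) \<partial>M)"
      by (rule nn_integral_liminf) measurable
    also have "\<dots> \<le> ennreal ((2 * (1/4) ^ j)\<^sup>2)"
    proof (rule order_trans[OF Liminf_le_Limsup Limsup_bounded], simp, rule always_eventually, rule allI)
      fix k
      have sq: "(\<lambda>x. p j x - p (j + k) x) \<in> square_integrable M" by (intro square_integrable_diff p)
      have "(\<integral>\<^sup>+x. ennreal ((cmod (p j x - p (j + k) x))\<^sup>2) \<partial>M) = ennreal ((l2norm M (\<lambda>x. p j x - p (j + k) x))\<^sup>2)"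
        using nn_integral_eq_integral[OF square_integrableD(2)[OF sq]] by (simp add: l2norm_sq)
      also have "l2norm M (\<lambda>x. p j x - p (j + k) x) \<le> 2 * (1/4) ^ j"
        by (rule order_trans[OF cauchy]) (simp add: mult_left_le)
      then have "ennreal ((l2norm M (\<lambda>x. p j x - p (j + k) x))\<^sup>2) \<le> ennreal ((2 * (1/4) ^ j)\<^sup>2)"
        by (intro ennreal_leI power_mono) auto
      finally show "(\<integral>\<^sup>+x. ennreal ((cmod (p j x - p (j + k) x))\<^sup>2) \<partial>M) \<le> ennreal ((2 * (1/4) ^ j)\<^sup>2)" .
    qed
    finally show ?thesis .
  qed
  have sqd: "(\<lambda>x. p j x - f x) \<in> square_integrable M" for j
  proof -
    have "integrable M (\<lambda>x. (cmod (p j x - f x))\<^sup>2)"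
      by (rule integrableI_bounded) (use bound[of j] in \<open>auto intro: le_less_trans\<close>)
    then show ?thesis by (simp add: square_integrable_def)
  qed
  have "f \<in> square_integrable M" using square_integrable_diff[OF p sqd, of 0 0] by simp
  moreover have "(\<lambda>j. l2norm M (\<lambda>x. p j x - f x)) \<longlonglongrightarrow> 0"
  proof (rule Lim_null_comparison)
    have "l2norm M (\<lambda>x. p j x - f x) \<le> 2 * (1/4) ^ j" for j
    proof (rule power2_le_imp_le)
      have "ennreal ((l2norm M (\<lambda>x. p j x - f x))\<^sup>2) \<le> ennreal ((2 * (1/4) ^ j)\<^sup>2)"
        using bound[of j] nn_integral_eq_integral[OF square_integrableD(2)[OF sqd[of j]]] by (simp add: l2norm_sq)
      then show "(l2norm M (\<lambda>x. p j x - f x))\<^sup>2 \<le> (2 * (1/4) ^ j)\<^sup>2" by (subst (asm) ennreal_le_iff) auto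
    qed simp
    then show "\<forall>\<^sub>F j in sequentially. norm (l2norm M (\<lambda>x. p j x - f x)) \<le> 2 * (1/4) ^ j" by simp
    show "(\<lambda>j. 2 * (1/4::real) ^ j) \<longlonglongrightarrow> 0" by real_asymp
  qed
  ultimately show ?thesis by (rule that)
qed

subsection \<open>Direct sums of measures on the real line\<close>

text \<open>The index set may be uncountable, so this is not a product of \<open>\<sigma>\<close>-finite measures.\<close>

definition sum_measure :: "('i \<Rightarrow> real measure) \<Rightarrow> ('i \<times> real) measure" where
  "sum_measure \<mu> = measure_of UNIV {X. \<forall>i. Pair i -` X \<in> sets borel}
     (\<lambda>X. \<integral>\<^sup>+i. emeasure (\<mu> i) (Pair i -` X) \<partial>count_space UNIV)"

context
  fixes \<mu> :: "'i \<Rightarrow> real measure"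
  assumes sets_\<mu>: "\<And>i. sets (\<mu> i) = sets borel"
begin

lemma sum_sigma_algebra: "sigma_algebra UNIV {X :: ('i \<times> real) set. \<forall>i. Pair i -` X \<in> sets borel}"
proof (unfold sigma_algebra_iff2, safe)
  fix X :: "('i \<times> real) set" and i assume "\<forall>i. Pair i -` X \<in> sets borel"
  moreover have "Pair i -` (UNIV - X) = UNIV - Pair i -` X" by auto
  ultimately show "Pair i -` (UNIV - X) \<in> sets borel" by auto
next
  fix F :: "nat \<Rightarrow> ('i \<times> real) set" and i
  assume "range F \<subseteq> {X. \<forall>i. Pair i -` X \<in> sets borel}"
  then have "Pair i -` F n \<in> sets borel" for n by auto
  then show "Pair i -` (\<Union>n. F n) \<in> sets borel" unfolding vimage_UN by (intro sets.countable_UN) auto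
qed auto

lemma space_sum_measure [simp]: "space (sum_measure \<mu>) = UNIV"
  by (simp add: sum_measure_def space_measure_of_conv)

lemma sets_sum_measure: "sets (sum_measure \<mu>) = {X. \<forall>i. Pair i -` X \<in> sets borel}"
  unfolding sum_measure_def by (rule sigma_algebra.sets_measure_of_eq[OF sum_sigma_algebra])

lemma emeasure_sum_measure:
  assumes X: "X \<in> sets (sum_measure \<mu>)"
  shows "emeasure (sum_measure \<mu>) X = (\<integral>\<^sup>+i. emeasure (\<mu> i) (Pair i -` X) \<partial>count_space UNIV)"
  unfolding sum_measure_def
proof (rule emeasure_measure_of_sigma[OF sum_sigma_algebra])
  show "positive {X. \<forall>i. Pair i -` X \<in> sets borel} (\<lambda>X. \<integral>\<^sup>+i. emeasure (\<mu> i) (Pair i -` X) \<partial>count_space UNIV)"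
    by (simp add: positive_def)
  show "countably_additive {X. \<forall>i. Pair i -` X \<in> sets borel} (\<lambda>X. \<integral>\<^sup>+i. emeasure (\<mu> i) (Pair i -` X) \<partial>count_space UNIV)"
  proof (rule countably_additiveI)
    fix F :: "nat \<Rightarrow> ('i \<times> real) set"
    assume F: "range F \<subseteq> {X. \<forall>i. Pair i -` X \<in> sets borel}" "disjoint_family F"
    have "(\<Sum>n. emeasure (\<mu> i) (Pair i -` F n)) = emeasure (\<mu> i) (Pair i -` (\<Union>n. F n))" for i
      unfolding vimage_UN
    proof (rule suminf_emeasure)
      show "range (\<lambda>n. Pair i -` F n) \<subseteq> sets (\<mu> i)" using F(1) by (auto simp: sets_\<mu>)
      show "disjoint_family (\<lambda>n. Pair i -` F n)" using F(2) unfolding disjoint_family_on_def by blast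
    qed
    then show "(\<Sum>n. \<integral>\<^sup>+i. emeasure (\<mu> i) (Pair i -` F n) \<partial>count_space UNIV)
        = (\<integral>\<^sup>+i. emeasure (\<mu> i) (Pair i -` (\<Union>n. F n)) \<partial>count_space UNIV)"
      by (subst nn_integral_suminf[symmetric]) auto
  qed
  show "X \<in> {X. \<forall>i. Pair i -` X \<in> sets borel}" using X by (simp add: sets_sum_measure)
qed

lemma Pair_measurable: "Pair i \<in> measurable (\<mu> i) (sum_measure \<mu>)"
  by (rule measurableI) (auto simp: sets_sum_measure sets_\<mu> sets_eq_imp_space_eq[OF sets_\<mu>])

text \<open>The \<sigma>-algebra imposes nothing across slices, so measurability is checked on each
  slice separately.\<close>

lemma measurable_sum_measureI:
  assumes "\<And>i. (\<lambda>b. f (i, b)) \<in> measurable borel N"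
  shows "f \<in> measurable (sum_measure \<mu>) N"
proof (rule measurableI)
  fix x show "f x \<in> space N" using measurable_space[OF assms[of "fst x"], of "snd x"] by simp
next
  fix A assume A: "A \<in> sets N"
  have "Pair i -` (f -` A) = (\<lambda>b. f (i, b)) -` A \<inter> space borel" for i by auto
  then show "f -` A \<inter> space (sum_measure \<mu>) \<in> sets (sum_measure \<mu>)"
    using measurable_sets[OF assms A] by (simp add: sets_sum_measure)
qed

lemma fst_set_measurable: "{x. fst x = i} \<in> sets (sum_measure \<mu>)"
proof -
  have "Pair j -` {x. fst x = i} = (if j = i then UNIV else {} :: real set)" for j by auto
  then show ?thesis by (simp add: sets_sum_measure)
qed

text \<open>Identifies a summand with the restriction of the sum to its slice, so that integrals
  over one slice reduce to integrals on the line without any product measure.\<close>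

lemma distr_slice:
  "distr (\<mu> i) (sum_measure \<mu>) (Pair i) = density (sum_measure \<mu>) (indicator {x. fst x = i})"
proof (rule measure_eqI)
  fix X assume "X \<in> sets (distr (\<mu> i) (sum_measure \<mu>) (Pair i))"
  then have X: "X \<in> sets (sum_measure \<mu>)" by simp
  have "emeasure (density (sum_measure \<mu>) (indicator {x. fst x = i})) X = emeasure (sum_measure \<mu>) ({x. fst x = i} \<inter> X)"
    using X fst_set_measurable by (subst emeasure_density) (auto simp: indicator_inter_arith[symmetric] nn_integral_indicator)
  also have "\<dots> = (\<integral>\<^sup>+j. emeasure (\<mu> j) (Pair j -` ({x. fst x = i} \<inter> X)) \<partial>count_space UNIV)"
    using X fst_set_measurable by (intro emeasure_sum_measure sets.Int)
  also have "\<dots> = (\<integral>\<^sup>+j. emeasure (\<mu> i) (Pair i -` X) * indicator {i} j \<partial>count_space UNIV)"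
  proof (rule nn_integral_cong)
    fix j
    have "Pair j -` ({x. fst x = i} \<inter> X) = (if j = i then Pair i -` X else {})" by auto
    then show "emeasure (\<mu> j) (Pair j -` ({x. fst x = i} \<inter> X)) = emeasure (\<mu> i) (Pair i -` X) * indicator {i} j" by simp
  qed
  also have "\<dots> = emeasure (\<mu> i) (Pair i -` X)" by (simp add: nn_integral_cmult_indicator)
  also have "\<dots> = emeasure (distr (\<mu> i) (sum_measure \<mu>) (Pair i)) X"
    using X Pair_measurable by (simp add: emeasure_distr sets_eq_imp_space_eq[OF sets_\<mu>])
  finally show "emeasure (distr (\<mu> i) (sum_measure \<mu>) (Pair i)) X = emeasure (density (sum_measure \<mu>) (indicator {x. fst x = i})) X" ..
qed simp

lemma slice_integral:
  fixes g :: "'i \<times> real \<Rightarrow> complex"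
  assumes g: "g \<in> borel_measurable (sum_measure \<mu>)"
  shows "integrable (sum_measure \<mu>) (\<lambda>x. indicator {x. fst x = i} x *\<^sub>R g x) \<longleftrightarrow> integrable (\<mu> i) (\<lambda>b. g (i, b))"
    and "(LINT x|sum_measure \<mu>. indicator {x. fst x = i} x *\<^sub>R g x) = (LINT b|\<mu> i. g (i, b))"
proof -
  have d: "density (sum_measure \<mu>) (indicator {x. fst x = i})
      = density (sum_measure \<mu>) (\<lambda>x. ennreal (indicator {x. fst x = i} x))"
    by (simp add: ennreal_indicator[abs_def])
  have m: "(indicator {x. fst x = i} :: 'i \<times> real \<Rightarrow> real) \<in> borel_measurable (sum_measure \<mu>)"
    using fst_set_measurable by simp
  show "integrable (sum_measure \<mu>) (\<lambda>x. indicator {x. fst x = i} x *\<^sub>R g x) \<longleftrightarrow> integrable (\<mu> i) (\<lambda>b. g (i, b))"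
    using integrable_distr_eq[OF Pair_measurable g, of i] integrable_density[OF g m]
    unfolding distr_slice d by simp
  show "(LINT x|sum_measure \<mu>. indicator {x. fst x = i} x *\<^sub>R g x) = (LINT b|\<mu> i. g (i, b))"
    using integral_distr[OF Pair_measurable g, of i] integral_density[OF g m]
    unfolding distr_slice d by simp
qed

text \<open>The measure of a measurable set is the sum over its slices, so even uncountably many
  null slices make up a null set. This is why the exceptional set itself is required to be
  measurable.\<close>

lemma AE_sum_measureI:
  assumes X: "{x. \<not> P x} \<in> sets (sum_measure \<mu>)" and P: "\<And>i. AE b in \<mu> i. P (i, b)"
  shows "AE x in sum_measure \<mu>. P x"
proof (rule AE_I[OF _ _ X])
  have "emeasure (\<mu> i) (Pair i -` {x. \<not> P x}) = 0" for i
  proof -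
    have "Pair i -` {x. \<not> P x} = {b \<in> space (\<mu> i). \<not> P (i, b)}"
      by (auto simp: sets_eq_imp_space_eq[OF sets_\<mu>])
    moreover have "Pair i -` {x. \<not> P x} \<in> sets (\<mu> i)" using X by (simp add: sets_sum_measure sets_\<mu>)
    ultimately show ?thesis using P[of i] by (simp add: AE_iff_measurable[OF _ refl])
  qed
  then show "emeasure (sum_measure \<mu>) {x. \<not> P x} = 0" by (simp add: emeasure_sum_measure[OF X])
qed simp

end

subsection \<open>The multiplication form of a positive contraction\<close>

text \<open>The sum runs over the whole vector space; the null measure outside \<open>S\<close>
  makes the other slices invisible.\<close>

locale spectral_data = positive_contraction B for B :: "'h::complex_hilbert_space \<Rightarrow> 'h" +
  fixes S :: "'h set" and \<mu> :: "'h \<Rightarrow> real measure"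
  assumes S: "orthogonal_orbits S"
    and S_max: "(\<And>x n. x \<in> S \<Longrightarrow> cinner ((B ^^ n) x) y = 0) \<Longrightarrow> y = 0"
    and sets_\<mu>: "\<And>h. sets (\<mu> h) = sets borel"
    and \<mu>_S: "h \<in> S \<Longrightarrow> prob_space (\<mu> h) \<and> (AE b in \<mu> h. 0 \<le> b \<and> b \<le> 1) \<and> (\<forall>m. cinner ((B ^^ m) h) h = of_real (LINT b|\<mu> h. b ^ m))"
    and \<mu>_not_S: "h \<notin> S \<Longrightarrow> \<mu> h = null_measure borel"
begin

abbreviation M where "M \<equiv> sum_measure \<mu>"

lemma \<mu>_AE: "AE b in \<mu> h. 0 \<le> b \<and> b \<le> 1"
proof (cases "h \<in> S")
  case False
  show ?thesis by (rule AE_I'[of UNIV]) (auto simp: \<mu>_not_S[OF False] null_sets_def)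
qed (use \<mu>_S in auto)

lemma snd_measurable [measurable]: "snd \<in> measurable M borel"
  by (rule measurable_sum_measureI[OF sets_\<mu>]) simp

lemma snd_AE: "AE x in M. 0 \<le> snd x \<and> snd x \<le> 1"
proof (rule AE_sum_measureI[OF sets_\<mu>])
  have "{x \<in> space M. \<not> (0 \<le> snd x \<and> snd x \<le> 1)} \<in> sets M" by measurable
  then show "{x. \<not> (0 \<le> snd x \<and> snd x \<le> 1)} \<in> sets M" by (simp add: space_sum_measure[OF sets_\<mu>])
qed (use \<mu>_AE in auto)

definition gen :: "'h \<Rightarrow> nat \<Rightarrow> 'h \<times> real \<Rightarrow> complex" where
  "gen h n x = indicator {x. fst x = h} x *\<^sub>R of_real (snd x ^ n)"

lemma ind_measurable [measurable]: "(indicator {x. fst x = h} :: _ \<Rightarrow> real) \<in> borel_measurable M"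
  using fst_set_measurable[of \<mu>, OF sets_\<mu>] by simp

lemma gen_measurable [measurable]: "gen h n \<in> borel_measurable M"
  unfolding gen_def[abs_def] by measurable

lemma gen_integral:
  assumes h: "h \<in> S"
  shows "integrable M (gen h n)" "(LINT x|M. gen h n x) = cinner ((B ^^ n) h) h"
proof -
  interpret prob_space "\<mu> h" using \<mu>_S[OF h] by simp
  have m: "(\<lambda>x. complex_of_real (snd x ^ n)) \<in> borel_measurable M" by measurable
  have "integrable (\<mu> h) (\<lambda>b. b ^ n)"
  proof (rule integrable_const_bound[of _ 1])
    show "AE b in \<mu> h. norm (b ^ n) \<le> 1"
      using \<mu>_AE[of h] by eventually_elim (auto intro: power_le_one)
    show "(\<lambda>b. b ^ n) \<in> borel_measurable (\<mu> h)" by (simp add: measurable_cong_sets[OF sets_\<mu> refl])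
  qed
  then show "integrable M (gen h n)"
    unfolding gen_def[abs_def] slice_integral(1)[OF sets_\<mu> m] by (simp del: of_real_power)
  show "(LINT x|M. gen h n x) = cinner ((B ^^ n) h) h"
    unfolding gen_def[abs_def] slice_integral(2)[OF sets_\<mu> m] using \<mu>_S[OF h] by (simp del: of_real_power)
qed

lemma gen_mult: "gen h n x * cnj (gen k m x) = (if h = k then gen h (n + m) x else 0)"
  by (auto simp: gen_def indicator_def power_add)

lemma gen_square_integrable:
  assumes h: "h \<in> S" shows "gen h n \<in> square_integrable M"
proof -
  have "complex_of_real ((cmod (gen h n x))\<^sup>2) = gen h (n + n) x" for x
    unfolding complex_norm_square gen_mult by simp
  then have "(\<lambda>x. (cmod (gen h n x))\<^sup>2) = (\<lambda>x. Re (gen h (n + n) x))"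
    by (metis Re_complex_of_real)
  then show ?thesis
    using gen_integral(1)[OF h, of "n + n"] by (simp add: square_integrable_def)
qed

lemma gen_inner:
  assumes "h \<in> S" "k \<in> S"
  shows "(LINT x|M. gen h n x * cnj (gen k m x)) = cinner ((B ^^ n) h) ((B ^^ m) k)"
proof (cases "h = k")
  case True
  then show ?thesis using gen_integral(2)[OF assms(1), of "n + m"] by (simp add: gen_mult Bn_Bm)
next
  case False
  then show ?thesis using assms S by (simp add: gen_mult Bn_Bm orthogonal_orbits_def)
qed

text \<open>\<open>G0\<close> is the graph of the isometry that sends \<open>gen h n\<close> to \<open>B\<^sup>n h\<close> on linear
  combinations. The description as a relation is symmetric in both sides, and its closure
  \<open>G\<close> is total on both by completeness.\<close>

inductive G0 :: "('h \<times> real \<Rightarrow> complex) \<Rightarrow> 'h \<Rightarrow> bool" where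
  G0_zero: "G0 (\<lambda>x. 0) 0"
| G0_gen: "h \<in> S \<Longrightarrow> G0 (gen h n) ((B ^^ n) h)"
| G0_add: "G0 f x \<Longrightarrow> G0 g y \<Longrightarrow> G0 (\<lambda>z. f z + g z) (x + y)"
| G0_scale: "G0 f x \<Longrightarrow> G0 (\<lambda>z. c * f z) (c *\<^sub>C x)"

lemma G0_sq: "G0 f x \<Longrightarrow> f \<in> square_integrable M"
  by (induction rule: G0.induct)
    (auto intro: square_integrable_zero gen_square_integrable square_integrable_add square_integrable_cmult)

lemma G0_diff: "G0 f x \<Longrightarrow> G0 g y \<Longrightarrow> G0 (\<lambda>z. f z - g z) (x - y)"
  using G0_add[OF _ G0_scale[of g y "-1"], of f x] by (simp add: scaleC_minus_one)

text \<open>First half of a double induction: with a generator on the right, linearity is needed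
  only on the left. \<open>G0_inner\<close> then inducts on the right argument.\<close>

lemma G0_inner_gen:
  assumes "G0 f x" and k: "k \<in> S"
  shows "(LINT z|M. f z * cnj (gen k m z)) = cinner x ((B ^^ m) k)"
  using assms(1)
proof (induction rule: G0.induct)
  case (G0_gen h n)
  then show ?case using gen_inner k by simp
next
  case (G0_add f x g y)
  have "(LINT z|M. (f z + g z) * cnj (gen k m z)) = (LINT z|M. f z * cnj (gen k m z) + g z * cnj (gen k m z))"
    by (simp add: distrib_right)
  also have "\<dots> = (LINT z|M. f z * cnj (gen k m z)) + (LINT z|M. g z * cnj (gen k m z))"
    by (intro Bochner_Integration.integral_add square_integrable_mult_integrable G0_sq[OF G0_add(1)] G0_sq[OF G0_add(2)] gen_square_integrable k)
  finally show ?case using G0_add by (simp add: cinner_add_left)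
next
  case (G0_scale f x c)
  then show ?case by (simp add: mult.assoc cinner_scaleC_left)
qed simp

lemma G0_inner:
  assumes "G0 g y" and f: "G0 f x"
  shows "(LINT z|M. f z * cnj (g z)) = cinner x y"
  using assms(1)
proof (induction rule: G0.induct)
  case (G0_gen h n)
  then show ?case using G0_inner_gen[OF f] by simp
next
  case (G0_add g y g' y')
  have "(LINT z|M. f z * cnj (g z + g' z)) = (LINT z|M. f z * cnj (g z) + f z * cnj (g' z))"
    by (simp add: distrib_left)
  also have "\<dots> = (LINT z|M. f z * cnj (g z)) + (LINT z|M. f z * cnj (g' z))"
    by (intro Bochner_Integration.integral_add square_integrable_mult_integrable G0_sq[OF G0_add(1)] G0_sq[OF G0_add(2)] G0_sq[OF f])
  finally show ?case using G0_add by (simp add: cinner_add_right)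
next
  case (G0_scale g y c)
  have "(LINT z|M. f z * cnj (c * g z)) = (LINT z|M. cnj c * (f z * cnj (g z)))" by (simp add: mult_ac)
  then show ?case using G0_scale by (simp add: cinner_scaleC_right)
qed simp

lemma G0_norm:
  assumes "G0 f x" shows "l2norm M f = norm x"
proof -
  have "complex_of_real ((l2norm M f)\<^sup>2) = (LINT z|M. complex_of_real ((cmod (f z))\<^sup>2))"
    by (simp add: l2norm_sq del: of_real_power)
  also have "\<dots> = (LINT z|M. f z * cnj (f z))" by (simp only: complex_norm_square)
  also have "\<dots> = of_real ((norm x)\<^sup>2)" using G0_inner[OF assms assms] by (simp add: cinner_self)
  finally have "(l2norm M f)\<^sup>2 = (norm x)\<^sup>2" by (simp only: of_real_eq_iff)
  then show ?thesis by (simp add: power2_eq_iff_nonneg)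
qed

lemma G0_mult: "G0 f x \<Longrightarrow> G0 (\<lambda>z. of_real (snd z) * f z) (B x)"
proof (induction rule: G0.induct)
  case G0_zero
  then show ?case using G0.G0_zero by (simp add: B_zero)
next
  case (G0_gen h n)
  have "(\<lambda>z. of_real (snd z) * gen h n z) = gen h (Suc n)"
    by (auto simp: gen_def fun_eq_iff)
  then show ?case using G0.G0_gen[OF G0_gen, of "Suc n"] by simp
next
  case (G0_add f x g y)
  then show ?case using G0.G0_add by (simp add: distrib_left B_add)
next
  case (G0_scale f x c)
  from G0.G0_scale[OF G0_scale(2), of c] show ?case by (simp add: B_scale mult_ac)
qed

lemma G0_dense: "closure {x. \<exists>f. G0 f x} = UNIV"
proof (rule ccontr)
  assume ne: "closure {x. \<exists>f. G0 f x} \<noteq> UNIV"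
  have "csubspace {x. \<exists>f. G0 f x}"
    unfolding csubspace_def by (auto intro: G0_zero G0_add G0_scale)
  then have "csubspace (closure {x. \<exists>f. G0 f x})" by (rule csubspace_closure)
  from orthogonal_vector_exists[OF this closed_closure ne] obtain y where
    y: "y \<noteq> 0" "\<And>x. x \<in> closure {x. \<exists>f. G0 f x} \<Longrightarrow> cinner x y = 0" by blast
  have "cinner ((B ^^ n) h) y = 0" if "h \<in> S" for h n
    using G0_gen[OF that, of n] closure_subset[of "{x. \<exists>f. G0 f x}"] by (intro y(2)) blast
  then have "y = 0" by (rule S_max)
  then show False using y(1) by simp
qed

section \<open>Completion of the isometry\<close>

definition G :: "('h \<times> real \<Rightarrow> complex) \<Rightarrow> 'h \<Rightarrow> bool" where
  "G f w \<longleftrightarrow> f \<in> square_integrable M \<and>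
    (\<exists>p x. (\<forall>j. G0 (p j) (x j)) \<and> (\<lambda>j. l2norm M (\<lambda>z. p j z - f z)) \<longlonglongrightarrow> 0 \<and> x \<longlonglongrightarrow> w)"

lemma GI:
  assumes "f \<in> square_integrable M" "\<And>j. G0 (p j) (x j)" "(\<lambda>j. l2norm M (\<lambda>z. p j z - f z)) \<longlonglongrightarrow> 0" "x \<longlonglongrightarrow> w"
  shows "G f w"
  using assms unfolding G_def by blast

lemma GE:
  assumes "G f w"
  obtains p x where "f \<in> square_integrable M" "\<And>j. G0 (p j) (x j)" "(\<lambda>j. l2norm M (\<lambda>z. p j z - f z)) \<longlonglongrightarrow> 0" "x \<longlonglongrightarrow> w"
  using assms unfolding G_def by blast

lemma G0_imp_G: "G0 f x \<Longrightarrow> G f x"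
  by (rule GI[of f "\<lambda>_. f" "\<lambda>_. x"]) (auto simp: G0_sq l2norm_def)

lemma G_total: "\<exists>f. G f w"
proof -
  \<comment> \<open>Half of (1/4)^j as tolerance makes consecutive approximants differ by at most
    (1/4)^j, the rate that \<open>riesz_fischer\<close> asks for.\<close>
  have "\<exists>x f. G0 f x \<and> dist x w < (1/4) ^ j / 2" for j
  proof -
    have "w \<in> closure {x. \<exists>f. G0 f x}" by (simp add: G0_dense)
    then have "\<exists>x\<in>{x. \<exists>f. G0 f x}. dist x w < (1/4) ^ j / 2"
      unfolding closure_approachable by (rule allE[of _ "(1/4) ^ j / 2"]) auto
    then show ?thesis by blast
  qed
  then obtain x p where xp: "\<And>j. G0 (p j) (x j)" "\<And>j. dist (x j) w < (1/4) ^ j / 2" by metis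
  have "l2norm M (\<lambda>z. p (Suc j) z - p j z) \<le> (1/4) ^ j" for j
  proof -
    have "l2norm M (\<lambda>z. p (Suc j) z - p j z) = dist (x (Suc j)) (x j)"
      using G0_norm[OF G0_diff[OF xp(1)[of "Suc j"] xp(1)[of j]]] by (simp add: dist_norm)
    also have "\<dots> \<le> dist (x (Suc j)) w + dist (x j) w" by (rule dist_triangle2)
    also have "\<dots> \<le> (1/4) ^ Suc j / 2 + (1/4) ^ j / 2" using xp(2)[of j] xp(2)[of "Suc j"] by linarith
    also have "\<dots> \<le> (1/4) ^ j" by simp
    finally show ?thesis .
  qed
  from riesz_fischer[OF G0_sq[OF xp(1)] this] obtain f where
    f: "f \<in> square_integrable M" "(\<lambda>j. l2norm M (\<lambda>z. p j z - f z)) \<longlonglongrightarrow> 0" by blast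
  have "x \<longlonglongrightarrow> w"
  proof (rule metric_tendsto_imp_tendsto)
    show "(\<lambda>j. (1/4::real) ^ j / 2) \<longlonglongrightarrow> 0" by real_asymp
    show "\<forall>\<^sub>F j in sequentially. dist (x j) w \<le> dist ((1/4::real) ^ j / 2) 0"
      using xp(2) by (auto simp: dist_real_def less_imp_le)
  qed
  then show ?thesis using GI[OF f(1) xp(1) f(2)] by blast
qed

lemma G_inner:
  assumes "G f w" "G g v" shows "(LINT z|M. f z * cnj (g z)) = cinner w v"
proof -
  obtain p x where p: "f \<in> square_integrable M" "\<And>j. G0 (p j) (x j)" "(\<lambda>j. l2norm M (\<lambda>z. p j z - f z)) \<longlonglongrightarrow> 0" "x \<longlonglongrightarrow> w"
    using GE[OF assms(1)] by blast
  obtain q y where q: "g \<in> square_integrable M" "\<And>j. G0 (q j) (y j)" "(\<lambda>j. l2norm M (\<lambda>z. q j z - g z)) \<longlonglongrightarrow> 0" "y \<longlonglongrightarrow> v"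
    using GE[OF assms(2)] by blast
  have "(\<lambda>j. cinner (x j) (y j)) \<longlonglongrightarrow> (LINT z|M. f z * cnj (g z))"
    using l2_inner_tendsto[OF G0_sq[OF p(2)] p(1) G0_sq[OF q(2)] q(1) p(3) q(3)] G0_inner[OF q(2) p(2)] by simp
  moreover have "(\<lambda>j. cinner (x j) (y j)) \<longlonglongrightarrow> cinner w v"
  proof (rule LIM_zero_cancel, rule Lim_null_comparison)
    have "norm (cinner (x j) (y j) - cinner w v) \<le> norm (x j - w) * norm (y j) + norm w * norm (y j - v)" for j
    proof -
      have "cinner (x j) (y j) - cinner w v = cinner (x j - w) (y j) + cinner w (y j - v)"
        by (simp add: cinner_simps)
      then show ?thesis
        using norm_triangle_le[OF add_mono[OF cinner_Cauchy_Schwarz[of "x j - w" "y j"] cinner_Cauchy_Schwarz[of w "y j - v"]]]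
        by simp
    qed
    then show "\<forall>\<^sub>F j in sequentially. norm (cinner (x j) (y j) - cinner w v) \<le> norm (x j - w) * norm (y j) + norm w * norm (y j - v)"
      by simp
    have "(\<lambda>j. norm (x j - w) * norm (y j) + norm w * norm (y j - v)) \<longlonglongrightarrow> norm (w - w) * norm v + norm w * norm (v - v)"
      by (intro tendsto_intros p q)
    then show "(\<lambda>j. norm (x j - w) * norm (y j) + norm w * norm (y j - v)) \<longlonglongrightarrow> 0" by simp
  qed
  ultimately show ?thesis by (rule LIMSEQ_unique)
qed

lemma G_add:
  assumes "G f w" "G g v" shows "G (\<lambda>z. f z + g z) (w + v)"
proof -
  obtain p x where p: "f \<in> square_integrable M" "\<And>j. G0 (p j) (x j)" "(\<lambda>j. l2norm M (\<lambda>z. p j z - f z)) \<longlonglongrightarrow> 0" "x \<longlonglongrightarrow> w"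
    using GE[OF assms(1)] by blast
  obtain q y where q: "g \<in> square_integrable M" "\<And>j. G0 (q j) (y j)" "(\<lambda>j. l2norm M (\<lambda>z. q j z - g z)) \<longlonglongrightarrow> 0" "y \<longlonglongrightarrow> v"
    using GE[OF assms(2)] by blast
  show ?thesis
  proof (rule GI[OF square_integrable_add[OF p(1) q(1)] G0_add[OF p(2) q(2)] _ tendsto_add[OF p(4) q(4)]])
    show "(\<lambda>j. l2norm M (\<lambda>z. p j z + q j z - (f z + g z))) \<longlonglongrightarrow> 0"
    proof (rule Lim_null_comparison)
      have "l2norm M (\<lambda>z. p j z + q j z - (f z + g z)) \<le> l2norm M (\<lambda>z. p j z - f z) + l2norm M (\<lambda>z. q j z - g z)" for j
        using l2norm_triangle[OF square_integrable_diff[OF G0_sq[OF p(2)[of j]] p(1)] square_integrable_diff[OF G0_sq[OF q(2)[of j]] q(1)]]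
        by (simp add: algebra_simps)
      then show "\<forall>\<^sub>F j in sequentially. norm (l2norm M (\<lambda>z. p j z + q j z - (f z + g z))) \<le> l2norm M (\<lambda>z. p j z - f z) + l2norm M (\<lambda>z. q j z - g z)"
        by simp
      show "(\<lambda>j. l2norm M (\<lambda>z. p j z - f z) + l2norm M (\<lambda>z. q j z - g z)) \<longlonglongrightarrow> 0"
        using tendsto_add[OF p(3) q(3)] by simp
    qed
  qed
qed

lemma G_scale:
  assumes "G f w" shows "G (\<lambda>z. c * f z) (c *\<^sub>C w)"
proof -
  obtain p x where p: "f \<in> square_integrable M" "\<And>j. G0 (p j) (x j)" "(\<lambda>j. l2norm M (\<lambda>z. p j z - f z)) \<longlonglongrightarrow> 0" "x \<longlonglongrightarrow> w"
    using GE[OF assms] by blast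
  have "(\<lambda>j. l2norm M (\<lambda>z. c * p j z - c * f z)) \<longlonglongrightarrow> 0"
    unfolding right_diff_distrib[symmetric] l2norm_cmult by (rule tendsto_mult_right_zero[OF p(3)])
  then show ?thesis
    by (rule GI[OF square_integrable_cmult[OF p(1)] G0_scale[OF p(2)] _ tendsto_scaleC[OF p(4)]])
qed

lemma G_mult:
  assumes "G f w" shows "G (\<lambda>z. of_real (snd z) * f z) (B w)"
proof -
  obtain p x where p: "f \<in> square_integrable M" "\<And>j. G0 (p j) (x j)" "(\<lambda>j. l2norm M (\<lambda>z. p j z - f z)) \<longlonglongrightarrow> 0" "x \<longlonglongrightarrow> w"
    using GE[OF assms] by blast
  have sq: "(\<lambda>z. of_real (snd z) * g z) \<in> square_integrable M"
    and le: "l2norm M (\<lambda>z. of_real (snd z) * g z) \<le> l2norm M g" if g: "g \<in> square_integrable M" for g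
  proof -
    note [measurable] = square_integrableD(1)[OF g]
    have ae: "AE z in M. cmod (of_real (snd z) * g z) \<le> 1 * cmod (g z)"
      using snd_AE by eventually_elim (auto simp: norm_mult intro: mult_left_le_one_le)
    show sq: "(\<lambda>z. of_real (snd z) * g z) \<in> square_integrable M"
      by (rule square_integrable_bound[OF g _ ae]) measurable
    have "(LINT z|M. (cmod (of_real (snd z) * g z))\<^sup>2) \<le> (LINT z|M. (cmod (g z))\<^sup>2)"
      using ae by (intro integral_mono_AE square_integrableD[OF sq] square_integrableD[OF g]) (auto intro: power_mono elim!: AE_mp)
    then show "l2norm M (\<lambda>z. of_real (snd z) * g z) \<le> l2norm M g" by (simp add: l2norm_def)
  qed
  have "B x' - B w = B (x' - w)" for x' by (simp add: B_diff)
  then have "norm (B (x j) - B w) \<le> norm (x j - w)" for j using B_norm by metis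
  then have Bx: "(\<lambda>j. B (x j)) \<longlonglongrightarrow> B w"
    using p(4) by (intro LIM_zero_cancel[OF Lim_null_comparison[OF _ tendsto_norm_zero[OF LIM_zero[OF p(4)]]]]) auto
  have "(\<lambda>j. l2norm M (\<lambda>z. of_real (snd z) * p j z - of_real (snd z) * f z)) \<longlonglongrightarrow> 0"
  proof (rule Lim_null_comparison[OF _ p(3)])
    show "\<forall>\<^sub>F j in sequentially. norm (l2norm M (\<lambda>z. of_real (snd z) * p j z - of_real (snd z) * f z)) \<le> l2norm M (\<lambda>z. p j z - f z)"
      using le[OF square_integrable_diff[OF G0_sq[OF p(2)] p(1)]] by (simp add: right_diff_distrib)
  qed
  then show ?thesis by (rule GI[OF sq[OF p(1)] G0_mult[OF p(2)] _ Bx])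
qed

text \<open>The inverse of the unitary map, with a chosen representative function instead of a
  class; its linearity therefore holds only almost everywhere.\<close>

definition V :: "'h \<Rightarrow> 'h \<times> real \<Rightarrow> complex" where "V w = (SOME f. G f w)"

lemma G_V: "G (V w) w"
  unfolding V_def using G_total by (rule someI_ex)

lemma V_sq: "V w \<in> square_integrable M"
  using GE[OF G_V[of w]] by blast

lemma V_inner: "(LINT z|M. V w z * cnj (V v z)) = cinner w v"
  by (rule G_inner[OF G_V G_V])

lemma G_zero_AE:
  assumes "G f 0" shows "AE z in M. f z = 0"
proof (rule l2norm_eq_0_AE)
  show "f \<in> square_integrable M" using GE[OF assms] by blast
  have "complex_of_real ((l2norm M f)\<^sup>2) = (LINT z|M. complex_of_real ((cmod (f z))\<^sup>2))"
    by (simp add: l2norm_sq del: of_real_power)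
  also have "\<dots> = (LINT z|M. f z * cnj (f z))" by (simp only: complex_norm_square)
  also have "\<dots> = 0" using G_inner[OF assms assms] by simp
  finally show "l2norm M f = 0" by simp
qed

lemma G_unique:
  assumes "G f w" shows "AE z in M. V w z = f z"
proof -
  have "G (\<lambda>z. V w z + (-1) * f z) (w + (-1) *\<^sub>C w)" by (intro G_add G_scale G_V assms)
  then have "G (\<lambda>z. V w z - f z) 0" by (simp add: scaleC_minus_one)
  from G_zero_AE[OF this] show ?thesis by simp
qed

lemma V_add: "AE z in M. V (w + v) z = V w z + V v z"
  by (rule G_unique[OF G_add[OF G_V G_V]])

lemma V_scale: "AE z in M. V (c *\<^sub>C w) z = c * V w z"
  by (rule G_unique[OF G_scale[OF G_V]])

lemma V_B: "AE z in M. V (B w) z = of_real (snd z) * V w z"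
  by (rule G_unique[OF G_mult[OF G_V]])

text \<open>On the slice of \<open>h\<close> the conditions say that all moments of the conjugate of
  \<open>g\<close> vanish, and a density on [0, 1] is determined by its moments. Taking n = 0 shows
  that the slice of \<open>g\<close> is integrable.\<close>

lemma orthogonal_gen_imp_zero:
  assumes g: "g \<in> square_integrable M" and orth: "\<And>h n. h \<in> S \<Longrightarrow> (LINT z|M. gen h n z * cnj (g z)) = 0"
  shows "AE z in M. g z = 0"
proof (rule AE_sum_measureI[OF sets_\<mu>])
  note [measurable] = square_integrableD(1)[OF g]
  have "{z \<in> space M. g z \<noteq> 0} \<in> sets M" by measurable
  then show "{z. g z \<noteq> 0} \<in> sets M" by (simp add: space_sum_measure[OF sets_\<mu>])
  fix h
  show "AE b in \<mu> h. g (h, b) = 0"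
  proof (cases "h \<in> S")
    case False
    show ?thesis by (rule AE_I'[of UNIV]) (auto simp: \<mu>_not_S[OF False] null_sets_def)
  next
    case True
    interpret prob_space "\<mu> h" using \<mu>_S[OF True] by simp
    have m: "(\<lambda>z. of_real (snd z ^ n) * cnj (g z)) \<in> borel_measurable M" for n by measurable
    have eq: "gen h n z * cnj (g z) = indicator {x. fst x = h} z *\<^sub>R (of_real (snd z ^ n) * cnj (g z))" for n z
      by (simp add: gen_def)
    have int: "integrable (\<mu> h) (\<lambda>b. of_real (b ^ n) * cnj (g (h, b)))" for n
      using slice_integral(1)[OF sets_\<mu> m, of h n] square_integrable_mult_integrable[OF gen_square_integrable[OF True, of n] g]
      by (simp add: eq)
    have val: "(LINT b|\<mu> h. of_real (b ^ n) * cnj (g (h, b))) = 0" for n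
      using slice_integral(2)[OF sets_\<mu> m, of h n] orth[OF True, of n] by (simp add: eq)
    have i0: "integrable (\<mu> h) (\<lambda>b. cnj (g (h, b)))" using int[of 0] by simp
    have "AE b in \<mu> h. cnj (g (h, b)) = 0"
    proof (rule density_zero[OF i0])
      fix E assume "E \<in> sets (\<mu> h)"
      then have E: "E \<in> sets borel" by (simp add: sets_\<mu>)
      have "(LINT b|\<mu> h. cnj (g (h, b)) * indicator E b) = 0"
      proof (rule moments_zero_imp_integral_zero[OF i0 _ _ _ E])
        show "(\<lambda>b. b) \<in> borel_measurable (\<mu> h)" by (simp add: measurable_cong_sets[OF sets_\<mu> refl])
        show "AE b in \<mu> h. 0 \<le> b \<and> b \<le> 1" by (rule \<mu>_AE)
        show "(LINT b|\<mu> h. cnj (g (h, b)) * of_real (b ^ n)) = 0" for n using val[of n] by (simp only: mult.commute)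
      qed
      moreover have "indicator E b *\<^sub>R cnj (g (h, b)) = cnj (g (h, b)) * indicator E b" for b
        by (simp add: indicator_def)
      ultimately show "(LINT b:E|\<mu> h. cnj (g (h, b))) = 0" by (simp add: set_lebesgue_integral_def)
    qed
    then show ?thesis by simp
  qed
qed

text \<open>The Riesz theorem in the Hilbert space represents w \<mapsto> (V w, f) by a vector
  \<open>v\<close>; then f - V v is orthogonal to all generators and hence zero.\<close>

lemma V_surj:
  assumes f: "f \<in> square_integrable M" shows "\<exists>w. AE z in M. V w z = f z"
proof -
  define F where "F w = (LINT z|M. V w z * cnj (f z))" for w
  have cong: "(LINT z|M. p z * cnj (f z)) = (LINT z|M. q z * cnj (f z))"
    if "AE z in M. p z = q z" "p \<in> square_integrable M" "q \<in> square_integrable M" for p q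
  proof (rule integral_cong_AE)
    show "AE z in M. p z * cnj (f z) = q z * cnj (f z)" using that(1) by eventually_elim simp
  qed (use square_integrable_mult_integrable[OF that(2) f] square_integrable_mult_integrable[OF that(3) f] in auto)
  have F_add: "F (w + v) = F w + F v" for w v
  proof -
    have "F (w + v) = (LINT z|M. (V w z + V v z) * cnj (f z))"
      unfolding F_def by (rule cong[OF V_add V_sq square_integrable_add[OF V_sq V_sq]])
    also have "\<dots> = (LINT z|M. V w z * cnj (f z) + V v z * cnj (f z))" by (simp add: distrib_right)
    also have "\<dots> = F w + F v"
      unfolding F_def by (intro Bochner_Integration.integral_add square_integrable_mult_integrable V_sq f)
    finally show ?thesis .
  qed
  have F_scale: "F (c *\<^sub>C w) = c * F w" for c w
  proof -
    have "F (c *\<^sub>C w) = (LINT z|M. (c * V w z) * cnj (f z))"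
      unfolding F_def by (rule cong[OF V_scale V_sq square_integrable_cmult[OF V_sq]])
    then show ?thesis unfolding F_def by (simp add: mult.assoc)
  qed
  have V_norm: "l2norm M (V w) = norm w" for w
  proof -
    have "complex_of_real ((l2norm M (V w))\<^sup>2) = (LINT z|M. complex_of_real ((cmod (V w z))\<^sup>2))"
      by (simp add: l2norm_sq del: of_real_power)
    also have "\<dots> = of_real ((norm w)\<^sup>2)" using V_inner[of w w] by (simp only: complex_norm_square cinner_self)
    finally have "(l2norm M (V w))\<^sup>2 = (norm w)\<^sup>2" by (simp only: of_real_eq_iff)
    then show ?thesis by (simp add: power2_eq_iff_nonneg)
  qed
  have "cmod (F w) \<le> l2norm M f * norm w" for w
    using l2_Cauchy_Schwarz[OF V_sq f, of w] by (simp add: F_def V_norm mult.commute)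
  from riesz_representation[OF F_add F_scale this] obtain v where v: "\<And>w. F w = cinner w v" by blast
  define g where "g z = f z - V v z" for z
  have g: "g \<in> square_integrable M" unfolding g_def by (rule square_integrable_diff[OF f V_sq])
  have "AE z in M. g z = 0"
  proof (rule orthogonal_gen_imp_zero[OF g])
    fix h n assume h: "h \<in> S"
    have ae: "AE z in M. V ((B ^^ n) h) z = gen h n z"
      by (rule G_unique[OF G0_imp_G[OF G0_gen[OF h]]])
    note sq = gen_square_integrable[OF h, of n]
    have "(LINT z|M. gen h n z * cnj (g z)) = (LINT z|M. gen h n z * cnj (f z) - gen h n z * cnj (V v z))"
      by (simp add: g_def right_diff_distrib)
    also have "\<dots> = (LINT z|M. gen h n z * cnj (f z)) - (LINT z|M. gen h n z * cnj (V v z))"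
      by (intro Bochner_Integration.integral_diff square_integrable_mult_integrable sq f V_sq)
    also have "(LINT z|M. gen h n z * cnj (f z)) = F ((B ^^ n) h)"
      unfolding F_def by (rule cong[symmetric, OF ae V_sq sq])
    also have "(LINT z|M. gen h n z * cnj (V v z)) = cinner ((B ^^ n) h) v"
      by (rule G_inner[OF G0_imp_G[OF G0_gen[OF h]] G_V])
    finally show "(LINT z|M. gen h n z * cnj (g z)) = 0" by (simp add: v)
  qed
  then have "AE z in M. V v z = f z" unfolding g_def by eventually_elim simp
  then show ?thesis by blast
qed

text \<open>The value \<open>0\<close> is irrelevant: the points outside \<open>[0, 1]\<close> form a null set, and all
  functions \<open>V w\<close> vanish at \<open>0\<close> since \<open>B\<close> is injective.\<close>

definition a :: "'h \<times> real \<Rightarrow> real" where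
  "a z = (if 0 < snd z \<and> snd z \<le> 1 then 1 / snd z - 1 else 0)"

lemma a_measurable: "a \<in> borel_measurable M"
  unfolding a_def[abs_def] by measurable

lemma a_nonneg: "0 \<le> a z"
  by (auto simp: a_def)

text \<open>The part of V w living on the fibre b = 0 is itself some V x by surjectivity.
  Multiplication by b annihilates it, so B x = 0 and x = 0 by injectivity.\<close>

lemma V_zero_fiber: "AE z in M. snd z = 0 \<longrightarrow> V w z = 0"
proof -
  note [measurable] = square_integrableD(1)[OF V_sq[of w]]
  define f where "f z = (if snd z = 0 then V w z else 0)" for z
  have "f \<in> borel_measurable M" unfolding f_def[abs_def] by measurable
  then have f: "f \<in> square_integrable M"
    by (rule square_integrable_bound[OF V_sq[of w], of _ 1]) (auto simp: f_def)
  from V_surj[OF this] obtain x where x: "AE z in M. V x z = f z" by blast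
  have "AE z in M. V (B x) z = 0"
    using V_B[of x] x by eventually_elim (auto simp: f_def)
  then have "(LINT z|M. V (B x) z * cnj (V (B x) z)) = (LINT z|M. 0)"
    using square_integrable_mult_integrable[OF V_sq[of "B x"] V_sq[of "B x"]]
    by (intro integral_cong_AE) auto
  then have "B x = 0" by (simp add: V_inner cinner_self)
  then have "x = 0" by (rule B_inj)
  then have "AE z in M. V x z = 0"
    using G_zero_AE[OF G_V] by simp
  with x show ?thesis by eventually_elim (auto simp: f_def)
qed

lemma V_resolvent: "AE z in M. V (B w) z = of_real (1 / (1 + a z)) * V w z"
  using V_B[of w] V_zero_fiber[of w] snd_AE
proof eventually_elim
  case (elim z)
  show ?case
  proof (cases "snd z = 0")
    case False
    then have "1 / (1 + a z) = snd z" using elim by (auto simp: a_def)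
    then show ?thesis using elim by simp
  qed (use elim in auto)
qed

end

theorem (in positive_contraction) multiplication_form:
  obtains M :: "('h \<times> real) measure" and a :: "'h \<times> real \<Rightarrow> real" and V :: "'h \<Rightarrow> 'h \<times> real \<Rightarrow> complex"
  where "\<And>w. V w \<in> square_integrable M" "\<And>w v. AE z in M. V (w + v) z = V w z + V v z"
    "\<And>c w. AE z in M. V (c *\<^sub>C w) z = c * V w z"
    "\<And>w v. (LINT z|M. V w z * cnj (V v z)) = cinner w v"
    "\<And>f. f \<in> square_integrable M \<Longrightarrow> \<exists>w. AE z in M. V w z = f z"
    "a \<in> borel_measurable M" "\<And>z. 0 \<le> a z"
    "\<And>w. AE z in M. V (B w) z = of_real (1 / (1 + a z)) * V w z"
proof -
  obtain S where S: "orthogonal_orbits S" "\<And>y. (\<And>x n. x \<in> S \<Longrightarrow> cinner ((B ^^ n) x) y = 0) \<Longrightarrow> y = 0"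
    using maximal_orbits_exist by blast
  define \<mu> where "\<mu> h = (if h \<in> S then SOME \<mu>. prob_space \<mu> \<and> sets \<mu> = sets (borel :: real measure)
    \<and> (AE x in \<mu>. 0 \<le> x \<and> x \<le> 1) \<and> (\<forall>m. cinner ((B ^^ m) h) h = of_real (LINT x|\<mu>. x ^ m)) else null_measure borel)" for h
  have \<mu>: "prob_space (\<mu> h) \<and> sets (\<mu> h) = sets borel \<and> (AE x in \<mu> h. 0 \<le> x \<and> x \<le> 1)
      \<and> (\<forall>m. cinner ((B ^^ m) h) h = of_real (LINT x|\<mu> h. x ^ m))" if "h \<in> S" for h
  proof -
    have "norm h = 1" using S(1) that by (simp add: orthogonal_orbits_def)
    from someI_ex[OF vector_measure_exists[OF this]] show ?thesis
      unfolding \<mu>_def if_P[OF that] .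
  qed
  interpret spectral_data B S \<mu>
  proof
    show "orthogonal_orbits S" by fact
    show "y = 0" if "\<And>x n. x \<in> S \<Longrightarrow> cinner ((B ^^ n) x) y = 0" for y using S(2) that by blast
    show null: "\<mu> h = null_measure borel" if "h \<notin> S" for h unfolding \<mu>_def if_not_P[OF that] ..
    show "sets (\<mu> h) = sets borel" for h
    proof (cases "h \<in> S")
      case True
      then show ?thesis using \<mu> by blast
    next
      case False
      show ?thesis unfolding null[OF False] by simp
    qed
    show "prob_space (\<mu> h) \<and> (AE b in \<mu> h. 0 \<le> b \<and> b \<le> 1) \<and> (\<forall>m. cinner ((B ^^ m) h) h = of_real (LINT b|\<mu> h. b ^ m))"
      if "h \<in> S" for h using \<mu>[OF that] by blast
  qed
  show ?thesis
    by (rule that[of V "sum_measure \<mu>" a])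
      (rule V_sq V_add V_scale V_inner V_surj a_measurable a_nonneg V_resolvent; assumption?)+
qed

subsection \<open>Functional calculus\<close>

locale multiplication_model =
  fixes M :: "'b measure" and a :: "'b \<Rightarrow> real" and V :: "'h::complex_hilbert_space \<Rightarrow> 'b \<Rightarrow> complex"
  assumes V_sq: "V w \<in> square_integrable M"
    and V_add: "AE z in M. V (w + v) z = V w z + V v z"
    and V_scale: "AE z in M. V (c *\<^sub>C w) z = c * V w z"
    and V_inner: "(LINT z|M. V w z * cnj (V v z)) = cinner w v"
    and V_surj: "f \<in> square_integrable M \<Longrightarrow> \<exists>w. AE z in M. V w z = f z"
    and a_meas [measurable]: "a \<in> borel_measurable M"
    and a_nonneg: "0 \<le> a z"
begin

lemma V_meas [measurable]: "V w \<in> borel_measurable M"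
  using square_integrableD(1)[OF V_sq] .

lemma V_norm: "(norm w)\<^sup>2 = (LINT z|M. (cmod (V w z))\<^sup>2)"
proof -
  have "complex_of_real (LINT z|M. (cmod (V w z))\<^sup>2) = (LINT z|M. complex_of_real ((cmod (V w z))\<^sup>2))"
    by (simp del: of_real_power)
  also have "\<dots> = of_real ((norm w)\<^sup>2)" using V_inner[of w w] by (simp only: complex_norm_square cinner_self)
  finally show ?thesis by (simp only: of_real_eq_iff)
qed

lemma V_diff: "AE z in M. V (w - v) z = V w z - V v z"
  using V_add[of w "(-1) *\<^sub>C v"] V_scale[of "-1" v]
  by eventually_elim (simp add: scaleC_minus_one)

lemma V_eqI:
  assumes "AE z in M. V w z = V v z" shows "w = v"
proof -
  have "AE z in M. V (w - v) z = 0" using assms V_diff[of w v] by eventually_elim simp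
  then have "(LINT z|M. (cmod (V (w - v) z))\<^sup>2) = (LINT z|M. 0)"
    by (intro integral_cong_AE) auto
  then have "norm (w - v) = 0" using V_norm[of "w - v"] by simp
  then show ?thesis by simp
qed

text \<open>The bound is required only for x \<ge> 0, where the values of \<open>a\<close> lie and
  where the Mittag-Leffler bound is available.\<close>

definition bdd_fun :: "(real \<Rightarrow> complex) \<Rightarrow> bool" where
  "bdd_fun \<phi> \<longleftrightarrow> \<phi> \<in> borel_measurable borel \<and> (\<exists>C. \<forall>x\<ge>0. cmod (\<phi> x) \<le> C)"

text \<open>The bounded Borel functional calculus: multiplication by \<phi> \<circ> a carried over
  to the Hilbert space. The chosen vector exists by \<open>V_surj\<close> for bounded \<phi> and is
  unique by \<open>V_eqI\<close>.\<close>

definition \<Phi> :: "(real \<Rightarrow> complex) \<Rightarrow> 'h \<Rightarrow> 'h" where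
  "\<Phi> \<phi> w = (SOME x. AE z in M. V x z = \<phi> (a z) * V w z)"

lemma bdd_funI: "\<phi> \<in> borel_measurable borel \<Longrightarrow> (\<And>x. 0 \<le> x \<Longrightarrow> cmod (\<phi> x) \<le> C) \<Longrightarrow> bdd_fun \<phi>"
  by (auto simp: bdd_fun_def)

lemma bdd_fun_mult:
  assumes "bdd_fun \<phi>" "bdd_fun \<psi>" shows "bdd_fun (\<lambda>x. \<phi> x * \<psi> x)"
proof -
  obtain C C' where C: "\<And>x. 0 \<le> x \<Longrightarrow> cmod (\<phi> x) \<le> C" "\<And>x. 0 \<le> x \<Longrightarrow> cmod (\<psi> x) \<le> C'"
    using assms unfolding bdd_fun_def by blast
  have "cmod (\<phi> x * \<psi> x) \<le> C * C'" if "0 \<le> x" for x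
    unfolding norm_mult using C[OF that] norm_ge_zero order_trans by (intro mult_mono) blast+
  then show ?thesis using assms by (intro bdd_funI) (auto simp: bdd_fun_def)
qed

lemma bdd_fun_add:
  assumes "bdd_fun \<phi>" "bdd_fun \<psi>" shows "bdd_fun (\<lambda>x. \<phi> x + \<psi> x)"
proof -
  obtain C C' where C: "\<And>x. 0 \<le> x \<Longrightarrow> cmod (\<phi> x) \<le> C" "\<And>x. 0 \<le> x \<Longrightarrow> cmod (\<psi> x) \<le> C'"
    using assms unfolding bdd_fun_def by blast
  have "cmod (\<phi> x + \<psi> x) \<le> C + C'" if "0 \<le> x" for x
    using C[OF that] norm_triangle_ineq[of "\<phi> x" "\<psi> x"] by linarith
  then show ?thesis using assms by (intro bdd_funI) (auto simp: bdd_fun_def)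
qed

lemma bdd_fun_const [simp]: "bdd_fun (\<lambda>x. c)"
  by (auto simp: bdd_fun_def)

lemma mult_square_integrable:
  assumes "bdd_fun \<phi>" shows "(\<lambda>z. \<phi> (a z) * V w z) \<in> square_integrable M"
proof -
  obtain C where C: "\<And>x. 0 \<le> x \<Longrightarrow> cmod (\<phi> x) \<le> C" and [measurable]: "\<phi> \<in> borel_measurable borel"
    using assms unfolding bdd_fun_def by blast
  show ?thesis
    by (rule square_integrable_bound[OF V_sq[of w], of _ C])
      (auto simp: norm_mult intro!: mult_right_mono C a_nonneg)
qed

lemma V_\<Phi>:
  assumes "bdd_fun \<phi>" shows "AE z in M. V (\<Phi> \<phi> w) z = \<phi> (a z) * V w z"
  unfolding \<Phi>_def by (rule someI_ex[OF V_surj[OF mult_square_integrable[OF assms]]])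

lemma \<Phi>_eqI:
  assumes "bdd_fun \<phi>" "AE z in M. V x z = \<phi> (a z) * V w z" shows "\<Phi> \<phi> w = x"
  by (rule V_eqI) (use V_\<Phi>[OF assms(1), of w] assms(2) in \<open>eventually_elim, simp\<close>)

lemma \<Phi>_cong:
  assumes "\<And>x. 0 \<le> x \<Longrightarrow> \<phi> x = \<psi> x" shows "\<Phi> \<phi> w = \<Phi> \<psi> w"
  unfolding \<Phi>_def using assms a_nonneg by simp

lemma \<Phi>_add_fun:
  assumes "bdd_fun \<phi>" "bdd_fun \<psi>" shows "\<Phi> (\<lambda>x. \<phi> x + \<psi> x) w = \<Phi> \<phi> w + \<Phi> \<psi> w"
  by (rule \<Phi>_eqI[OF bdd_fun_add[OF assms]])
    (use V_\<Phi>[OF assms(1), of w] V_\<Phi>[OF assms(2), of w] V_add[of "\<Phi> \<phi> w" "\<Phi> \<psi> w"] in \<open>eventually_elim, simp add: distrib_right\<close>)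

lemma \<Phi>_cmult_fun:
  assumes "bdd_fun \<phi>" shows "\<Phi> (\<lambda>x. c * \<phi> x) w = c *\<^sub>C \<Phi> \<phi> w"
  by (rule \<Phi>_eqI[OF bdd_fun_mult[OF bdd_fun_const assms]])
    (use V_\<Phi>[OF assms, of w] V_scale[of c "\<Phi> \<phi> w"] in \<open>eventually_elim, simp\<close>)

lemma \<Phi>_comp:
  assumes "bdd_fun \<phi>" "bdd_fun \<psi>" shows "\<Phi> \<phi> (\<Phi> \<psi> w) = \<Phi> (\<lambda>x. \<phi> x * \<psi> x) w"
  by (rule sym, rule \<Phi>_eqI[OF bdd_fun_mult[OF assms]])
    (use V_\<Phi>[OF assms(2), of w] V_\<Phi>[OF assms(1), of "\<Phi> \<psi> w"] in \<open>eventually_elim, simp\<close>)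

lemma \<Phi>_add:
  assumes "bdd_fun \<phi>" shows "\<Phi> \<phi> (w + v) = \<Phi> \<phi> w + \<Phi> \<phi> v"
  by (rule \<Phi>_eqI[OF assms])
    (use V_\<Phi>[OF assms, of w] V_\<Phi>[OF assms, of v] V_add[of w v] V_add[of "\<Phi> \<phi> w" "\<Phi> \<phi> v"] in
      \<open>eventually_elim, simp add: distrib_left\<close>)

lemma \<Phi>_diff:
  assumes "bdd_fun \<phi>" shows "\<Phi> \<phi> (w - v) = \<Phi> \<phi> w - \<Phi> \<phi> v"
  by (rule \<Phi>_eqI[OF assms])
    (use V_\<Phi>[OF assms, of w] V_\<Phi>[OF assms, of v] V_diff[of w v] V_diff[of "\<Phi> \<phi> w" "\<Phi> \<phi> v"] in
      \<open>eventually_elim, simp add: right_diff_distrib\<close>)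

lemma \<Phi>_one: "\<Phi> (\<lambda>x. 1) w = w"
  by (rule \<Phi>_eqI) auto

lemma \<Phi>_norm:
  assumes "bdd_fun \<phi>" and C: "\<And>x. 0 \<le> x \<Longrightarrow> cmod (\<phi> x) \<le> C" shows "norm (\<Phi> \<phi> w) \<le> C * norm w"
proof (rule power2_le_imp_le)
  have C0: "0 \<le> C" using C[of 0] norm_ge_zero order_trans by blast
  have "(norm (\<Phi> \<phi> w))\<^sup>2 = (LINT z|M. (cmod (V (\<Phi> \<phi> w) z))\<^sup>2)" by (rule V_norm)
  also have "\<dots> \<le> (LINT z|M. C\<^sup>2 * (cmod (V w z))\<^sup>2)"
  proof (rule integral_mono_AE)
    show "AE z in M. (cmod (V (\<Phi> \<phi> w) z))\<^sup>2 \<le> C\<^sup>2 * (cmod (V w z))\<^sup>2"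
      using V_\<Phi>[OF assms(1), of w]
    proof eventually_elim
      case (elim z)
      have "cmod (\<phi> (a z) * V w z) \<le> C * cmod (V w z)"
        unfolding norm_mult by (intro mult_right_mono C a_nonneg) simp
      then have "(cmod (\<phi> (a z) * V w z))\<^sup>2 \<le> (C * cmod (V w z))\<^sup>2" by (rule power_mono) simp
      then show ?case by (simp add: elim power_mult_distrib)
    qed
  qed (use square_integrableD(2)[OF V_sq] in auto)
  also have "\<dots> = (C * norm w)\<^sup>2" by (simp add: V_norm[symmetric] power_mult_distrib)
  finally show "(norm (\<Phi> \<phi> w))\<^sup>2 \<le> (C * norm w)\<^sup>2" .
  show "0 \<le> C * norm w" using C0 by simp
qed

lemma \<Phi>_adjoint:
  assumes "bdd_fun \<phi>" shows "cinner (\<Phi> \<phi> w) v = cinner w (\<Phi> (\<lambda>x. cnj (\<phi> x)) v)"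
proof -
  have b: "bdd_fun (\<lambda>x. cnj (\<phi> x))" using assms by (auto simp: bdd_fun_def)
  have "cinner (\<Phi> \<phi> w) v = (LINT z|M. V (\<Phi> \<phi> w) z * cnj (V v z))" by (simp add: V_inner)
  also have "\<dots> = (LINT z|M. V w z * cnj (V (\<Phi> (\<lambda>x. cnj (\<phi> x)) v) z))"
  proof (rule integral_cong_AE)
    show "AE z in M. V (\<Phi> \<phi> w) z * cnj (V v z) = V w z * cnj (V (\<Phi> (\<lambda>x. cnj (\<phi> x)) v) z)"
      using V_\<Phi>[OF assms, of w] V_\<Phi>[OF b, of v] by eventually_elim simp
  qed measurable
  finally show ?thesis by (simp add: V_inner)
qed

text \<open>Dominated convergence with majorant (2 C)^2 |V w|^2 turns bounded pointwise convergence
  of the multipliers into strong convergence of the operators.\<close>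

lemma \<Phi>_tendsto:
  assumes n: "\<And>n. \<phi> n \<in> borel_measurable borel" and m: "\<psi> \<in> borel_measurable borel"
    and C: "\<And>n x. 0 \<le> x \<Longrightarrow> cmod (\<phi> n x) \<le> C" and lim: "\<And>x. 0 \<le> x \<Longrightarrow> (\<lambda>n. \<phi> n x) \<longlonglongrightarrow> \<psi> x"
  shows "(\<lambda>n. \<Phi> (\<phi> n) w) \<longlonglongrightarrow> \<Phi> \<psi> w"
proof -
  have bn: "bdd_fun (\<phi> n)" for n using n C by (rule bdd_funI)
  have C\<psi>: "cmod (\<psi> x) \<le> C" if "0 \<le> x" for x
    using tendsto_norm[OF lim[OF that]] C[OF that] by (intro LIMSEQ_le_const2) auto
  have b: "bdd_fun \<psi>" using m C\<psi> by (rule bdd_funI)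
  note [measurable] = n m
  have "(\<lambda>n. LINT z|M. (cmod (\<phi> n (a z) * V w z - \<psi> (a z) * V w z))\<^sup>2) \<longlonglongrightarrow> (LINT z|M. 0)"
  proof (rule integral_dominated_convergence[where w = "\<lambda>z. (2 * C)\<^sup>2 * (cmod (V w z))\<^sup>2"])
    show "integrable M (\<lambda>z. (2 * C)\<^sup>2 * (cmod (V w z))\<^sup>2)" using square_integrableD(2)[OF V_sq] by simp
    show "AE z in M. (\<lambda>n. (cmod (\<phi> n (a z) * V w z - \<psi> (a z) * V w z))\<^sup>2) \<longlonglongrightarrow> 0"
    proof (rule AE_I2)
      fix z
      have "(\<lambda>n. (cmod (\<phi> n (a z) * V w z - \<psi> (a z) * V w z))\<^sup>2)
          \<longlonglongrightarrow> (cmod (\<psi> (a z) * V w z - \<psi> (a z) * V w z))\<^sup>2"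
        by (intro tendsto_intros lim a_nonneg)
      then show "(\<lambda>n. (cmod (\<phi> n (a z) * V w z - \<psi> (a z) * V w z))\<^sup>2) \<longlonglongrightarrow> 0" by simp
    qed
    show "AE z in M. norm ((cmod (\<phi> n (a z) * V w z - \<psi> (a z) * V w z))\<^sup>2) \<le> (2 * C)\<^sup>2 * (cmod (V w z))\<^sup>2" for n
    proof (rule AE_I2)
      fix z
      have "cmod (\<phi> n (a z) - \<psi> (a z)) \<le> 2 * C"
        using norm_triangle_ineq4[of "\<phi> n (a z)" "\<psi> (a z)"] C[OF a_nonneg, of n z] C\<psi>[OF a_nonneg, of z] by linarith
      then have "cmod (\<phi> n (a z) * V w z - \<psi> (a z) * V w z) \<le> 2 * C * cmod (V w z)"
        unfolding left_diff_distrib[symmetric] norm_mult by (intro mult_right_mono) auto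
      then have "(cmod (\<phi> n (a z) * V w z - \<psi> (a z) * V w z))\<^sup>2 \<le> (2 * C * cmod (V w z))\<^sup>2"
        by (rule power_mono) simp
      then show "norm ((cmod (\<phi> n (a z) * V w z - \<psi> (a z) * V w z))\<^sup>2) \<le> (2 * C)\<^sup>2 * (cmod (V w z))\<^sup>2"
        by (simp add: power_mult_distrib)
    qed
  qed auto
  moreover have "(LINT z|M. (cmod (\<phi> n (a z) * V w z - \<psi> (a z) * V w z))\<^sup>2) = (norm (\<Phi> (\<phi> n) w - \<Phi> \<psi> w))\<^sup>2" for n
    unfolding V_norm
  proof (rule integral_cong_AE)
    show "AE z in M. (cmod (\<phi> n (a z) * V w z - \<psi> (a z) * V w z))\<^sup>2 = (cmod (V (\<Phi> (\<phi> n) w - \<Phi> \<psi> w) z))\<^sup>2"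
      using V_\<Phi>[OF bn, of n w] V_\<Phi>[OF b, of w] V_diff[of "\<Phi> (\<phi> n) w" "\<Phi> \<psi> w"] by eventually_elim simp
  qed measurable
  ultimately have "(\<lambda>n. (norm (\<Phi> (\<phi> n) w - \<Phi> \<psi> w))\<^sup>2) \<longlonglongrightarrow> 0" by simp
  then have "(\<lambda>n. sqrt ((norm (\<Phi> (\<phi> n) w - \<Phi> \<psi> w))\<^sup>2)) \<longlonglongrightarrow> sqrt 0" by (rule tendsto_real_sqrt)
  then have "(\<lambda>n. norm (\<Phi> (\<phi> n) w - \<Phi> \<psi> w)) \<longlonglongrightarrow> 0" by simp
  then show ?thesis using tendsto_norm_zero_iff LIM_zero_cancel by blast
qed

lemma \<Phi>_continuous_on:
  assumes m: "\<And>s. s \<in> S \<Longrightarrow> \<phi> s \<in> borel_measurable borel" and C: "\<And>s x. s \<in> S \<Longrightarrow> 0 \<le> x \<Longrightarrow> cmod (\<phi> s x) \<le> C"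
    and cont: "\<And>x. 0 \<le> x \<Longrightarrow> continuous_on S (\<lambda>s. \<phi> s x)"
  shows "continuous_on S (\<lambda>s::real. \<Phi> (\<phi> s) w)"
  unfolding continuous_on_sequentially comp_def
proof (intro allI ballI impI, elim conjE)
  fix s :: "nat \<Rightarrow> real" and t assume t: "t \<in> S" and s: "\<forall>n. s n \<in> S" "s \<longlonglongrightarrow> t"
  show "(\<lambda>n. \<Phi> (\<phi> (s n)) w) \<longlonglongrightarrow> \<Phi> (\<phi> t) w"
  proof (rule \<Phi>_tendsto)
    show "\<And>n x. 0 \<le> x \<Longrightarrow> cmod (\<phi> (s n) x) \<le> C" using C s by blast
    fix x :: real assume "0 \<le> x"
    from cont[OF this] show "(\<lambda>n. \<phi> (s n) x) \<longlonglongrightarrow> \<phi> t x"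
      using s t unfolding continuous_on_sequentially comp_def by blast
  qed (use m s t in auto)
qed

lemma \<Phi>_sum_fun:
  fixes n :: nat
  assumes "\<And>i. i < n \<Longrightarrow> bdd_fun (f i)"
  shows "\<Phi> (\<lambda>x. \<Sum>i<n. f i x) w = (\<Sum>i<n. \<Phi> (f i) w) \<and> bdd_fun (\<lambda>x. \<Sum>i<n. f i x)"
  using assms
proof (induction n)
  case 0
  have "\<Phi> (\<lambda>x. 0) w = 0" using \<Phi>_cmult_fun[OF bdd_fun_const, of 0 1 w] by simp
  then show ?case by simp
next
  case (Suc n)
  then have "bdd_fun (\<lambda>x. \<Sum>i<n. f i x)" "bdd_fun (f n)" "\<Phi> (\<lambda>x. \<Sum>i<n. f i x) w = (\<Sum>i<n. \<Phi> (f i) w)" by auto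
  then show ?case using \<Phi>_add_fun[of "\<lambda>x. \<Sum>i<n. f i x" "f n" w] bdd_fun_add[of "\<lambda>x. \<Sum>i<n. f i x" "f n"] by simp
qed

text \<open>Riemann sums on both sides avoid any joint measurability in s and x. They also show that
  the integrated multiplier is Borel, being a pointwise limit of Borel functions; for this,
  continuity in s is assumed for every real x and not only for x \<ge> 0.\<close>

lemma \<Phi>_integral:
  fixes \<phi> :: "real \<Rightarrow> real \<Rightarrow> complex"
  assumes m: "\<And>s. s \<in> {0..1} \<Longrightarrow> \<phi> s \<in> borel_measurable borel"
    and C: "\<And>s x. s \<in> {0..1} \<Longrightarrow> 0 \<le> x \<Longrightarrow> cmod (\<phi> s x) \<le> C"
    and cont: "\<And>x. continuous_on {0..1} (\<lambda>s. \<phi> s x)"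
  shows "integral {0..1} (\<lambda>s. \<Phi> (\<phi> s) w) = \<Phi> (\<lambda>x. integral {0..1} (\<lambda>s. \<phi> s x)) w"
    and "bdd_fun (\<lambda>x. integral {0..1} (\<lambda>s. \<phi> s x))"
proof -
  define R where "R n x = (\<Sum>k<Suc n. (1 / real (Suc n)) *\<^sub>R \<phi> (real k / real (Suc n)) x)" for n x
  have pt: "real k / real (Suc n) \<in> {0..1}" if "k < Suc n" for k n using that by auto
  have limR: "(\<lambda>n. R n x) \<longlonglongrightarrow> integral {0..1} (\<lambda>s. \<phi> s x)" for x
    unfolding R_def by (rule riemann_sums_tendsto[OF cont])
  have mR: "R n \<in> borel_measurable borel" for n
    unfolding R_def[abs_def] by (intro borel_measurable_sum borel_measurable_scaleR borel_measurable_const m pt) simp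
  have CR: "cmod (R n x) \<le> C" if x: "0 \<le> x" for n x
  proof -
    have "cmod (R n x) \<le> (\<Sum>k<Suc n. (1 / real (Suc n)) * C)"
      unfolding R_def
    proof (rule sum_norm_le)
      fix k assume "k \<in> {..<Suc n}"
      then have "cmod (\<phi> (real k / real (Suc n)) x) \<le> C" using pt x by (intro C) auto
      then have "(1 / real (Suc n)) * cmod (\<phi> (real k / real (Suc n)) x) \<le> (1 / real (Suc n)) * C"
        by (rule mult_left_mono) simp
      then show "norm ((1 / real (Suc n)) *\<^sub>R \<phi> (real k / real (Suc n)) x) \<le> (1 / real (Suc n)) * C" by simp
    qed
    then show ?thesis by (simp del: sum.lessThan_Suc)
  qed
  have mI: "(\<lambda>x. integral {0..1} (\<lambda>s. \<phi> s x)) \<in> borel_measurable borel"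
    by (rule borel_measurable_LIMSEQ_metric[OF mR limR])
  have CI: "cmod (integral {0..1} (\<lambda>s. \<phi> s x)) \<le> C" if "0 \<le> x" for x
    using tendsto_norm[OF limR[of x]] CR[OF that] by (intro LIMSEQ_le_const2) auto
  show "bdd_fun (\<lambda>x. integral {0..1} (\<lambda>s. \<phi> s x))" using mI CI by (rule bdd_funI)
  have L1: "(\<lambda>n. \<Phi> (R n) w) \<longlonglongrightarrow> \<Phi> (\<lambda>x. integral {0..1} (\<lambda>s. \<phi> s x)) w"
    by (rule \<Phi>_tendsto[OF mR mI CR limR])
  have eq: "\<Phi> (R n) w = (\<Sum>k<Suc n. (1 / real (Suc n)) *\<^sub>R \<Phi> (\<phi> (real k / real (Suc n))) w)" for n
  proof -
    have b: "bdd_fun (\<phi> (real k / real (Suc n)))" if "k < Suc n" for k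
      using m[OF pt[OF that]] C[OF pt[OF that]] by (rule bdd_funI)
    have b': "bdd_fun (\<lambda>x. (1 / real (Suc n)) *\<^sub>R \<phi> (real k / real (Suc n)) x)" if "k < Suc n" for k
      using bdd_fun_mult[OF bdd_fun_const b[OF that], of "of_real (1 / real (Suc n))"] by (simp add: scaleR_conv_of_real)
    have "\<Phi> (R n) w = (\<Sum>k<Suc n. \<Phi> (\<lambda>x. (1 / real (Suc n)) *\<^sub>R \<phi> (real k / real (Suc n)) x) w)"
      unfolding R_def[abs_def] by (rule \<Phi>_sum_fun[THEN conjunct1, OF b'])
    also have "\<dots> = (\<Sum>k<Suc n. (1 / real (Suc n)) *\<^sub>R \<Phi> (\<phi> (real k / real (Suc n))) w)"
    proof (rule sum.cong[OF refl])
      fix k assume "k \<in> {..<Suc n}"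
      then have "bdd_fun (\<phi> (real k / real (Suc n)))" using b by simp
      from \<Phi>_cmult_fun[OF this, of "of_real (1 / real (Suc n))" w]
      show "\<Phi> (\<lambda>x. (1 / real (Suc n)) *\<^sub>R \<phi> (real k / real (Suc n)) x) w = (1 / real (Suc n)) *\<^sub>R \<Phi> (\<phi> (real k / real (Suc n))) w"
        unfolding scaleC_of_real scaleR_conv_of_real[symmetric] .
    qed
    finally show ?thesis .
  qed
  have L2: "(\<lambda>n. \<Sum>k<Suc n. (1 / real (Suc n)) *\<^sub>R \<Phi> (\<phi> (real k / real (Suc n))) w) \<longlonglongrightarrow> integral {0..1} (\<lambda>s. \<Phi> (\<phi> s) w)"
    by (rule riemann_sums_tendsto[OF \<Phi>_continuous_on[OF m C cont]])
  show "integral {0..1} (\<lambda>s. \<Phi> (\<phi> s) w) = \<Phi> (\<lambda>x. integral {0..1} (\<lambda>s. \<phi> s x)) w"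
    by (rule LIMSEQ_unique[OF L2 L1[unfolded eq]])
qed

text \<open>The substitution of \<open>frac_conv_eq\<close> turns the singular integral into one
  over [0, 1] with a continuous integrand, to which \<open>\<Phi>_integral\<close> applies.\<close>

lemma \<Phi>_frac_conv:
  assumes \<beta>: "0 < \<beta>" and t: "0 \<le> t" and m: "\<And>s. 0 \<le> s \<Longrightarrow> \<phi> s \<in> borel_measurable borel"
    and C: "\<And>s x. 0 \<le> s \<Longrightarrow> 0 \<le> x \<Longrightarrow> cmod (\<phi> s x) \<le> C"
    and cont: "\<And>x. continuous_on {0..} (\<lambda>s. \<phi> s x)"
  shows "frac_conv \<beta> (\<lambda>s. \<Phi> (\<phi> s) w) t = \<Phi> (\<lambda>x. frac_conv \<beta> (\<lambda>s. \<phi> s x) t) w"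
    and "bdd_fun (\<lambda>x. frac_conv \<beta> (\<lambda>s. \<phi> s x) t)"
proof -
  define K where "K = t powr \<beta> / Gamma (\<beta> + 1)"
  define \<sigma> where "\<sigma> \<rho> = t * (1 - \<rho> powr (1 / \<beta>))" for \<rho>
  have c': "continuous_on {0..t} (\<lambda>s. \<phi> s x)" for x by (rule continuous_on_subset[OF cont]) auto
  have cV: "continuous_on {0..t} (\<lambda>s. \<Phi> (\<phi> s) w)"
    by (rule \<Phi>_continuous_on[of _ _ C]) (use m C c' in auto)
  have \<sigma>0: "0 \<le> \<sigma> \<rho>" if "\<rho> \<in> {0..1}" for \<rho> using frac_arg_range(1)[OF t _ _ \<beta>] that by (simp add: \<sigma>_def)
  have c\<sigma>: "continuous_on {0..1} (\<lambda>\<rho>. \<phi> (\<sigma> \<rho>) x)" for x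
    unfolding \<sigma>_def by (rule continuous_on_frac_integrand[OF \<beta> t c'])
  have I: "integral {0..1} (\<lambda>\<rho>. \<Phi> (\<phi> (\<sigma> \<rho>)) w) = \<Phi> (\<lambda>x. integral {0..1} (\<lambda>\<rho>. \<phi> (\<sigma> \<rho>) x)) w"
    and b: "bdd_fun (\<lambda>x. integral {0..1} (\<lambda>\<rho>. \<phi> (\<sigma> \<rho>) x))"
    by (rule \<Phi>_integral[of "\<lambda>\<rho>. \<phi> (\<sigma> \<rho>)" C]; use m C c\<sigma> \<sigma>0 in auto)+
  have fc: "frac_conv \<beta> (\<lambda>s. \<phi> s x) t = of_real K * integral {0..1} (\<lambda>\<rho>. \<phi> (\<sigma> \<rho>) x)" for x
    using frac_conv_eq[OF \<beta> t c'] by (simp add: K_def \<sigma>_def scaleR_conv_of_real)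
  show "bdd_fun (\<lambda>x. frac_conv \<beta> (\<lambda>s. \<phi> s x) t)" unfolding fc by (intro bdd_fun_mult bdd_fun_const b)
  have "frac_conv \<beta> (\<lambda>s. \<Phi> (\<phi> s) w) t = K *\<^sub>R integral {0..1} (\<lambda>\<rho>. \<Phi> (\<phi> (\<sigma> \<rho>)) w)"
    using frac_conv_eq[OF \<beta> t cV] by (simp add: K_def \<sigma>_def)
  also have "\<dots> = \<Phi> (\<lambda>x. frac_conv \<beta> (\<lambda>s. \<phi> s x) t) w"
    unfolding fc \<Phi>_cmult_fun[OF b] I scaleC_of_real ..
  finally show "frac_conv \<beta> (\<lambda>s. \<Phi> (\<phi> s) w) t = \<Phi> (\<lambda>x. frac_conv \<beta> (\<lambda>s. \<phi> s x) t) w" .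
qed

end

subsection \<open>The evolution problem\<close>

locale fractional_evolution = multiplication_model M a V
  for M :: "'b measure" and a :: "'b \<Rightarrow> real" and V :: "'h::complex_hilbert_space \<Rightarrow> 'b \<Rightarrow> complex" +
  fixes \<alpha> :: real and D :: "'h set" and A :: "'h \<Rightarrow> 'h" and B :: "'h \<Rightarrow> 'h"
  assumes \<alpha>: "0 < \<alpha>" "\<alpha> < 1"
    and lin: "linear_operator_on D A"
    and B_D: "B w \<in> D" and B_A: "B w + A (B w) = w" and B_inv: "x \<in> D \<Longrightarrow> B (x + A x) = x"
    and V_B: "AE z in M. V (B w) z = of_real (1 / (1 + a z)) * V w z"
begin

section \<open>The functional calculus and the operator A\<close>

lemma D_diff: "x \<in> D \<Longrightarrow> y \<in> D \<Longrightarrow> x - y \<in> D \<and> A (x - y) = A x - A y"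
proof -
  assume xy: "x \<in> D" "y \<in> D"
  then have "(-1) *\<^sub>C y \<in> D" "A ((-1) *\<^sub>C y) = (-1) *\<^sub>C A y"
    using lin unfolding linear_operator_on_def by blast+
  moreover from this xy have "x + (-1) *\<^sub>C y \<in> D" "A (x + (-1) *\<^sub>C y) = A x + A ((-1) *\<^sub>C y)"
    using lin unfolding linear_operator_on_def by blast+
  ultimately show ?thesis by (simp add: scaleC_minus_one)
qed

definition res :: "real \<Rightarrow> complex" where "res x = of_real (1 / (1 + x))"

lemma res_bdd: "bdd_fun res"
proof (rule bdd_funI)
  show "cmod (res x) \<le> 1" if "0 \<le> x" for x using that unfolding res_def norm_of_real by simp
qed (unfold res_def[abs_def], measurable)

lemma \<Phi>_res: "\<Phi> res w = B w"
  by (rule \<Phi>_eqI[OF res_bdd V_B[folded res_def]])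

lemma B_\<Phi>: "bdd_fun \<phi> \<Longrightarrow> B (\<Phi> \<phi> w) = \<Phi> \<phi> (B w)"
  using \<Phi>_comp[OF res_bdd, of \<phi> w] \<Phi>_comp[OF _ res_bdd, of \<phi> w] by (simp add: \<Phi>_res mult.commute)

lemma A_B: "A (B w) = w - B w"
  using B_A[of w] by (simp add: eq_diff_eq add.commute)

text \<open>The domain is the range of B, since x = B (x + A x), and \<Phi> \<phi> commutes with
  B.\<close>

lemma \<Phi>_D: "bdd_fun \<phi> \<Longrightarrow> x \<in> D \<Longrightarrow> \<Phi> \<phi> x \<in> D"
  using B_D[of "\<Phi> \<phi> (x + A x)"] B_\<Phi>[of \<phi> "x + A x"] B_inv[of x] by simp

lemma A_\<Phi>:
  assumes "bdd_fun \<phi>" "x \<in> D" shows "A (\<Phi> \<phi> x) = \<Phi> \<phi> (A x)"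
proof -
  have "\<Phi> \<phi> x = B (\<Phi> \<phi> (x + A x))" using B_\<Phi>[OF assms(1), of "x + A x"] B_inv[OF assms(2)] by simp
  then have "A (\<Phi> \<phi> x) = \<Phi> \<phi> (x + A x) - \<Phi> \<phi> x" using A_B by metis
  then show ?thesis by (simp add: \<Phi>_add[OF assms(1)])
qed

section \<open>Existence of a strong solution\<close>

definition e :: "real \<Rightarrow> real \<Rightarrow> complex" where
  "e t x = mittag_leffler \<alpha> (minus_it_powr \<alpha> t * of_real x)"

lemma e_measurable: "e t \<in> borel_measurable borel"
proof (rule borel_measurable_continuous_onI)
  show "continuous_on UNIV (e t)"
    unfolding e_def[abs_def]
    by (rule continuous_on_compose2[of UNIV "mittag_leffler \<alpha>"])
      (auto intro!: continuous_at_imp_continuous_on isCont_mittag_leffler \<alpha> continuous_intros)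
qed

lemma e_bounded: "\<exists>C. \<forall>t\<ge>0. \<forall>x\<ge>0. cmod (e t x) \<le> C"
  using mittag_leffler_bounded[OF \<alpha>] unfolding e_def by metis

lemma e_bdd: "0 \<le> t \<Longrightarrow> bdd_fun (e t)"
  using e_bounded e_measurable unfolding bdd_fun_def by blast

lemma e_continuous: "continuous_on {0..} (\<lambda>t. e t x)"
  unfolding e_def by (rule continuous_on_ml[OF \<alpha>(1)])

lemma e_zero: "e 0 x = 1"
proof -
  have "(\<Sum>k. 0 ^ k / complex_of_real (Gamma (\<alpha> * real k + 1))) = (\<Sum>k. (if k = 0 then 1 else 0))"
    by (rule suminf_cong) auto
  also have "\<dots> = 1" by (subst suminf_finite[of "{0}"]) auto
  finally show ?thesis by (simp add: e_def mittag_leffler_def minus_it_powr_def)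
qed

lemma \<Phi>_e_continuous: "continuous_on {0..} (\<lambda>t. \<Phi> (e t) w)"
proof -
  obtain C where "\<forall>t\<ge>0. \<forall>x\<ge>0. cmod (e t x) \<le> C" using e_bounded by blast
  then show ?thesis by (intro \<Phi>_continuous_on[of _ _ C] e_measurable e_continuous) auto
qed

text \<open>The scalar Volterra equation contains the unbounded factor x, to which the calculus does
  not apply. Writing u0 = B w multiplies it by 1 / (1 + x), and x / (1 + x) = 1 - 1 / (1 + x) is
  bounded; acting on w, this factor is A u0 = w - B w.\<close>

lemma volterra_identity:
  assumes u0: "u0 \<in> D" and t: "0 \<le> t"
  shows "frac_conv (1 - \<alpha>) (\<lambda>s. \<Phi> (e s) u0) t
    = minus_i_powr \<alpha> *\<^sub>C integral {0..t} (\<lambda>s. \<Phi> (e s) (A u0)) + (t powr (1 - \<alpha>) / Gamma (2 - \<alpha>)) *\<^sub>R u0"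
proof -
  define I1 where "I1 x = frac_conv (1 - \<alpha>) (\<lambda>s. e s x) t" for x
  define I2 where "I2 x = frac_conv 1 (\<lambda>s. e s x) t" for x
  define K where "K = complex_of_real (t powr (1 - \<alpha>) / Gamma (2 - \<alpha>))"
  define w where "w = u0 + A u0"
  have u0w: "u0 = B w" and Au0: "A u0 = w - B w" using B_inv[OF u0] by (auto simp: w_def)
  obtain C where C: "\<forall>t\<ge>0. \<forall>x\<ge>0. cmod (e t x) \<le> C" using e_bounded by blast
  have F1: "frac_conv (1 - \<alpha>) (\<lambda>s. \<Phi> (e s) v) t = \<Phi> I1 v" and b1: "bdd_fun I1" for v
    unfolding I1_def using \<alpha> C by (intro \<Phi>_frac_conv[of _ _ _ C] t e_measurable e_continuous; simp)+
  have F2: "frac_conv 1 (\<lambda>s. \<Phi> (e s) v) t = \<Phi> I2 v" and b2: "bdd_fun I2" for v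
    unfolding I2_def using C by (intro \<Phi>_frac_conv[of _ _ _ C] t e_measurable e_continuous; simp)+
  have rel: "I1 x * res x = (minus_i_powr \<alpha> * I2 x + - minus_i_powr \<alpha> * (I2 x * res x)) + K * res x" if x: "0 \<le> x" for x
  proof -
    have "I1 x = minus_i_powr \<alpha> * of_real x * I2 x + K"
      unfolding I1_def I2_def K_def frac_conv_one e_def
      using mittag_leffler_volterra[OF \<alpha> t x] by simp
    then have "I1 x * res x = minus_i_powr \<alpha> * I2 x * (of_real x * res x) + K * res x"
      by (simp add: algebra_simps)
    also have "x * (1 / (1 + x)) = 1 - 1 / (1 + x)" using x by (simp add: field_simps)
    then have "complex_of_real (x * (1 / (1 + x))) = complex_of_real (1 - 1 / (1 + x))" by (rule arg_cong)
    then have "of_real x * res x = 1 - res x"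
      unfolding res_def by (simp only: of_real_mult of_real_diff of_real_1)
    finally show ?thesis by (simp add: algebra_simps)
  qed
  have "frac_conv (1 - \<alpha>) (\<lambda>s. \<Phi> (e s) u0) t = \<Phi> I1 (\<Phi> res w)" by (simp only: F1 \<Phi>_res u0w)
  also have "\<dots> = \<Phi> (\<lambda>x. I1 x * res x) w" by (rule \<Phi>_comp[OF b1 res_bdd])
  also have "\<dots> = \<Phi> (\<lambda>x. (minus_i_powr \<alpha> * I2 x + - minus_i_powr \<alpha> * (I2 x * res x)) + K * res x) w"
    by (rule \<Phi>_cong) (rule rel)
  also have "\<dots> = (minus_i_powr \<alpha> *\<^sub>C \<Phi> I2 w + (- minus_i_powr \<alpha>) *\<^sub>C \<Phi> (\<lambda>x. I2 x * res x) w) + K *\<^sub>C \<Phi> res w"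
  proof -
    note b3 = bdd_fun_mult[OF b2 res_bdd]
    note c1 = bdd_fun_mult[OF bdd_fun_const b2, of "minus_i_powr \<alpha>"]
    note c2 = bdd_fun_mult[OF bdd_fun_const b3, of "- minus_i_powr \<alpha>"]
    note c3 = bdd_fun_mult[OF bdd_fun_const res_bdd, of K]
    show ?thesis
      by (simp only: \<Phi>_add_fun[OF bdd_fun_add[OF c1 c2] c3] \<Phi>_add_fun[OF c1 c2]
          \<Phi>_cmult_fun[OF b2] \<Phi>_cmult_fun[OF b3] \<Phi>_cmult_fun[OF res_bdd])
  qed
  also have "\<Phi> (\<lambda>x. I2 x * res x) w = \<Phi> I2 (B w)" by (simp only: \<Phi>_comp[OF b2 res_bdd, symmetric] \<Phi>_res)
  also have "(minus_i_powr \<alpha> *\<^sub>C \<Phi> I2 w + (- minus_i_powr \<alpha>) *\<^sub>C \<Phi> I2 (B w)) = minus_i_powr \<alpha> *\<^sub>C \<Phi> I2 (A u0)"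
    by (simp add: Au0 \<Phi>_diff[OF b2] scaleC_diff_right scaleC_minus_left)
  also have "\<Phi> I2 (A u0) = integral {0..t} (\<lambda>s. \<Phi> (e s) (A u0))" by (simp only: F2[symmetric] frac_conv_one)
  also have "K *\<^sub>C \<Phi> res w = (t powr (1 - \<alpha>) / Gamma (2 - \<alpha>)) *\<^sub>R u0" by (simp only: K_def scaleC_of_real \<Phi>_res u0w)
  finally show ?thesis .
qed

lemma frac_kernel_derivative:
  assumes t: "0 < t"
  shows "((\<lambda>t. t powr (1 - \<alpha>) / Gamma (2 - \<alpha>)) has_real_derivative frac_kernel (1 - \<alpha>) t) (at t)"
proof -
  have "1 - \<alpha> \<notin> \<int>\<^sub>\<le>\<^sub>0" using \<alpha> by (auto elim!: nonpos_Ints_cases)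
  then have "Gamma (2 - \<alpha>) = (1 - \<alpha>) * Gamma (1 - \<alpha>)"
    using Gamma_plus1[of "1 - \<alpha>"] by simp
  moreover have "0 < Gamma (1 - \<alpha>)" using \<alpha> by (intro Gamma_real_pos) simp
  moreover have "((\<lambda>t. t powr (1 - \<alpha>) / Gamma (2 - \<alpha>)) has_real_derivative (1 - \<alpha>) * t powr (1 - \<alpha> - 1) / Gamma (2 - \<alpha>)) (at t)"
    by (intro DERIV_cdivide has_real_derivative_powr t)
  ultimately show ?thesis using \<alpha> by (simp add: frac_kernel_def)
qed

lemma integral_derivative:
  fixes f :: "real \<Rightarrow> 'h"
  assumes f: "continuous_on {0..} f" and t: "0 < t"
  shows "((\<lambda>t. integral {0..t} f) has_vector_derivative f t) (at t)"
proof -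
  have "continuous_on {0..t + 1} f" by (rule continuous_on_subset[OF f]) auto
  then have "((\<lambda>t. integral {0..t} f) has_vector_derivative f t) (at t within {0..t + 1})"
    by (rule integral_has_vector_derivative) (use t in auto)
  then show ?thesis using t by (simp add: at_within_Icc_at)
qed

text \<open>Differentiating \<open>volterra_identity\<close> yields the C^1 property and the
  equation together: the u0-term differentiates to the kernel term that \<open>caputo\<close>
  subtracts. Both u and A u have the form \<Phi> (e t) applied to a fixed vector, which gives
  continuity in the graph norm.\<close>

theorem strong_solution_exists:
  assumes u0: "u0 \<in> D" shows "strong_solution \<alpha> D A u0 (\<lambda>t. \<Phi> (e t) u0)"
proof -
  define u where "u t = \<Phi> (e t) u0" for t
  have uD: "u t \<in> D" and Au: "A (u t) = \<Phi> (e t) (A u0)" if "0 \<le> t" for t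
    unfolding u_def using e_bdd[OF that] u0 by (auto intro: \<Phi>_D A_\<Phi>)
  have Auc: "continuous_on {0..} (\<lambda>t. \<Phi> (e t) (A u0))" by (rule \<Phi>_e_continuous)
  define F where "F t = minus_i_powr \<alpha> *\<^sub>C \<Phi> (e t) (A u0) + frac_kernel (1 - \<alpha>) t *\<^sub>R u0" for t
  have dF: "(frac_conv (1 - \<alpha>) u has_vector_derivative F t) (at t)" if t: "0 < t" for t
  proof -
    have "((\<lambda>t. minus_i_powr \<alpha> *\<^sub>C integral {0..t} (\<lambda>s. \<Phi> (e s) (A u0)) + (t powr (1 - \<alpha>) / Gamma (2 - \<alpha>)) *\<^sub>R u0)
        has_vector_derivative F t) (at t)"
      unfolding F_def
      by (intro has_vector_derivative_add
          bounded_linear.has_vector_derivative[OF bounded_linear_scaleC]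
          bounded_linear.has_vector_derivative[OF bounded_linear_scaleR_left]
          integral_derivative Auc t)
        (use frac_kernel_derivative[OF t] in \<open>simp add: has_real_derivative_iff_has_vector_derivative\<close>)
    then show ?thesis
    proof (rule has_vector_derivative_transform_within_open[of _ _ _ "{0<..}"])
      show "minus_i_powr \<alpha> *\<^sub>C integral {0..s} (\<lambda>s. \<Phi> (e s) (A u0)) + (s powr (1 - \<alpha>) / Gamma (2 - \<alpha>)) *\<^sub>R u0
          = frac_conv (1 - \<alpha>) u s" if "s \<in> {0<..}" for s
        unfolding u_def using volterra_identity[OF u0, of s] that by simp
    qed (use t in auto)
  qed
  have cF: "continuous_on {0<..} F"
    unfolding F_def frac_kernel_def
  proof (intro continuous_intros)
    show "continuous_on {0<..} (\<lambda>t. minus_i_powr \<alpha> *\<^sub>C \<Phi> (e t) (A u0))"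
      by (rule bounded_linear.continuous_on[OF bounded_linear_scaleC continuous_on_subset[OF Auc]]) auto
    have "0 < Gamma (1 - \<alpha>)" using \<alpha> by (intro Gamma_real_pos) simp
    then show "\<forall>x\<in>{0<..}. Gamma (1 - \<alpha>) \<noteq> 0" by simp
  qed auto
  have "strong_solution \<alpha> D A u0 u"
    unfolding strong_solution_def
  proof (intro conjI allI impI)
    show "u t \<in> D" if "0 \<le> t" for t using uD[OF that] .
    show "u 0 = u0" using \<Phi>_one[of u0] by (simp add: u_def e_zero[abs_def])
    show "frac_conv (1 - \<alpha>) u C1_differentiable_on {0<..}"
      unfolding C1_differentiable_on_def using dF cF by (intro exI[of _ F]) auto
    show "caputo \<alpha> u t = minus_i_powr \<alpha> *\<^sub>C A (u t)" if t: "0 < t" for t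
      using vector_derivative_at[OF dF[OF t]] Au[of t] t \<Phi>_one[of u0]
      by (simp add: caputo_def F_def u_def e_zero[abs_def])
    show "((\<lambda>s. graph_norm A (u s - u t)) \<longlongrightarrow> 0) (at t within {0..})" if t: "0 \<le> t" for t
    proof -
      have c1: "(u \<longlongrightarrow> u t) (at t within {0..})"
        using \<Phi>_e_continuous[of u0] t by (simp add: continuous_on_def u_def[abs_def])
      have c2: "((\<lambda>s. \<Phi> (e s) (A u0)) \<longlongrightarrow> \<Phi> (e t) (A u0)) (at t within {0..})"
        using Auc t by (simp add: continuous_on_def)
      have "((\<lambda>s. sqrt ((norm (u s - u t))\<^sup>2 + (norm (\<Phi> (e s) (A u0) - \<Phi> (e t) (A u0)))\<^sup>2))
          \<longlongrightarrow> sqrt ((norm (u t - u t))\<^sup>2 + (norm (\<Phi> (e t) (A u0) - \<Phi> (e t) (A u0)))\<^sup>2)) (at t within {0..})"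
        by (intro tendsto_intros c1 c2)
      then have "((\<lambda>s. sqrt ((norm (u s - u t))\<^sup>2 + (norm (\<Phi> (e s) (A u0) - \<Phi> (e t) (A u0)))\<^sup>2)) \<longlongrightarrow> 0) (at t within {0..})"
        by simp
      then show ?thesis
      proof (rule Lim_transform_eventually)
        have "sqrt ((norm (u s - u t))\<^sup>2 + (norm (\<Phi> (e s) (A u0) - \<Phi> (e t) (A u0)))\<^sup>2) = graph_norm A (u s - u t)"
          if "s \<in> {0..}" for s
          using D_diff[OF uD uD, of s t] Au[of s] Au[OF t] that t by (simp add: graph_norm_def)
        then show "\<forall>\<^sub>F s in at t within {0..}. sqrt ((norm (u s - u t))\<^sup>2 + (norm (\<Phi> (e s) (A u0) - \<Phi> (e t) (A u0)))\<^sup>2) = graph_norm A (u s - u t)"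
          by (auto simp: eventually_at_filter)
      qed
    qed
  qed
  then show ?thesis by (simp add: u_def[abs_def])
qed

section \<open>Uniqueness\<close>

lemma strong_solution_continuous:
  assumes "strong_solution \<alpha> D A u0 v"
  shows "continuous_on {0..} v" "continuous_on {0..} (\<lambda>t. A (v t))"
proof -
  have D: "v t \<in> D" if "0 \<le> t" for t using assms that by (simp add: strong_solution_def)
  have lim: "((\<lambda>s. graph_norm A (v s - v t)) \<longlongrightarrow> 0) (at t within {0..})" if "0 \<le> t" for t
    using assms that by (simp add: strong_solution_def)
  have ev: "\<forall>\<^sub>F s in at t within {0..}. norm (v s - v t) \<le> graph_norm A (v s - v t)"
    "\<forall>\<^sub>F s in at t within {0..}. norm (A (v s) - A (v t)) \<le> graph_norm A (v s - v t)" if t: "0 \<le> t" for t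
  proof -
    have "norm (v s - v t) \<le> graph_norm A (v s - v t) \<and> norm (A (v s) - A (v t)) \<le> graph_norm A (v s - v t)"
      if "s \<in> {0..}" for s
      using D_diff[OF D D, of s t] that t
      by (auto simp: graph_norm_def intro: real_le_rsqrt)
    then show "\<forall>\<^sub>F s in at t within {0..}. norm (v s - v t) \<le> graph_norm A (v s - v t)"
      "\<forall>\<^sub>F s in at t within {0..}. norm (A (v s) - A (v t)) \<le> graph_norm A (v s - v t)"
      by (auto simp: eventually_at_filter)
  qed
  show "continuous_on {0..} v"
    unfolding continuous_on_def
    by (intro ballI LIM_zero_cancel[OF Lim_null_comparison[OF ev(1) lim]]) auto
  show "continuous_on {0..} (\<lambda>t. A (v t))"
    unfolding continuous_on_def
    by (intro ballI LIM_zero_cancel[OF Lim_null_comparison[OF ev(2) lim]]) auto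
qed

text \<open>The multiplier of A^k on the spectral subspace where A \<le> n. For k = 0 it is the
  spectral projection itself, with 0^0 = 1, and these projections tend strongly to the
  identity.\<close>

definition cut :: "nat \<Rightarrow> nat \<Rightarrow> real \<Rightarrow> complex" where
  "cut n k x = of_real (x ^ k * indicator {0..real n} x)"

lemma cut_bound: "cmod (cut n k x) \<le> real n ^ k"
  unfolding cut_def norm_of_real by (auto simp: indicator_def abs_mult power_abs intro: power_mono)

lemma cut_bdd: "bdd_fun (cut n k)"
proof (rule bdd_funI[OF _ cut_bound])
  show "cut n k \<in> borel_measurable borel" unfolding cut_def[abs_def] by measurable
qed

text \<open>Moving A to a truncated vector raises the exponent by one. With x = B w this becomes an
  identity for the bounded symmetric operator B, namely q = q / (1 + x) + x q / (1 + x) for the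
  multiplier q.\<close>

lemma A_cut:
  assumes "x \<in> D" shows "cinner (A x) (\<Phi> (cut n k) y) = cinner x (\<Phi> (cut n (Suc k)) y)"
proof -
  define w where "w = x + A x"
  have x: "x = B w" and Ax: "A x = w - B w" using B_inv[OF assms] by (auto simp: w_def)
  have cr: "(\<lambda>x. cnj (res x)) = res" by (simp add: res_def fun_eq_iff)
  have Badj: "cinner (B w) v = cinner w (B v)" for v
    using \<Phi>_adjoint[OF res_bdd, of w v] unfolding cr \<Phi>_res .
  have "cinner (A x) (\<Phi> (cut n k) y) = cinner w (\<Phi> (cut n k) y - B (\<Phi> (cut n k) y))"
    by (simp add: Ax cinner_diff_left cinner_diff_right Badj)
  also have "\<Phi> (cut n k) y - B (\<Phi> (cut n k) y) = B (\<Phi> (cut n (Suc k)) y)"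
  proof -
    have "\<Phi> (cut n k) y = \<Phi> (\<lambda>x. res x * cut n k x + res x * cut n (Suc k) x) y"
    proof (rule \<Phi>_cong)
      fix x :: real assume x: "0 \<le> x"
      have "q = 1 / (1 + x) * q + 1 / (1 + x) * (x * q)" for q :: real
        using x by (simp add: divide_simps) (simp add: algebra_simps)
      from this[of "x ^ k * indicator {0..real n} x"]
      have "x ^ k * indicator {0..real n} x = 1 / (1 + x) * (x ^ k * indicator {0..real n} x) + 1 / (1 + x) * (x ^ Suc k * indicator {0..real n} x)"
        by (simp only: power_Suc mult.assoc)
      then show "cut n k x = res x * cut n k x + res x * cut n (Suc k) x"
        unfolding cut_def res_def by (simp only: of_real_add[symmetric] of_real_mult[symmetric])
    qed
    also have "\<dots> = \<Phi> (\<lambda>x. res x * cut n k x) y + \<Phi> (\<lambda>x. res x * cut n (Suc k) x) y"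
      by (intro \<Phi>_add_fun bdd_fun_mult res_bdd cut_bdd)
    also have "\<dots> = B (\<Phi> (cut n k) y) + B (\<Phi> (cut n (Suc k)) y)"
      by (simp only: \<Phi>_comp[OF res_bdd cut_bdd, symmetric] \<Phi>_res)
    finally show ?thesis unfolding diff_eq_eq by (rule trans[OF _ add.commute])
  qed
  also have "cinner w (B (\<Phi> (cut n (Suc k)) y)) = cinner x (\<Phi> (cut n (Suc k)) y)"
    by (simp add: x Badj)
  finally show ?thesis .
qed

lemma cut_tendsto: "(\<lambda>n. \<Phi> (cut n 0) y) \<longlonglongrightarrow> y"
proof -
  have "(\<lambda>n. \<Phi> (cut n 0) y) \<longlonglongrightarrow> \<Phi> (\<lambda>x. 1) y"
  proof (rule \<Phi>_tendsto)
    show "cut n 0 \<in> borel_measurable borel" for n using cut_bdd by (simp add: bdd_fun_def)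
    show "cmod (cut n 0 x) \<le> 1" for n x using cut_bound[of n 0 x] by simp
    fix x :: real assume x: "0 \<le> x"
    obtain N :: nat where "x \<le> real N" using real_arch_simple by blast
    then have "\<forall>\<^sub>F n in sequentially. cut n 0 x = 1"
      unfolding eventually_sequentially using x by (intro exI[of _ N]) (auto simp: cut_def)
    then show "(\<lambda>n. cut n 0 x) \<longlonglongrightarrow> 1" by (rule tendsto_eventually)
  qed simp
  then show ?thesis by (simp add: \<Phi>_one)
qed

text \<open>The difference \<open>d\<close> of two solutions is tested against spectrally truncated vectors;
  iterating the resulting scalar Volterra equations gains the factor
  \<open>n ^ k t powr (1 + \<alpha> k) / Gamma (2 + \<alpha> k)\<close>, which tends to \<open>0\<close>.\<close>

lemma homogeneous_solution_zero:
  assumes dD: "\<And>t. 0 \<le> t \<Longrightarrow> d t \<in> D" and d: "continuous_on {0..} d" and Ad: "continuous_on {0..} (\<lambda>t. A (d t))"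
    and eq: "\<And>t. 0 \<le> t \<Longrightarrow> frac_conv (1 - \<alpha>) d t = integral {0..t} (\<lambda>s. minus_i_powr \<alpha> *\<^sub>C A (d s))"
    and t: "0 \<le> t"
  shows "d t = 0"
proof -
  have sub: "continuous_on {0..s} f" if "continuous_on {0..} f" for f :: "real \<Rightarrow> 'z::topological_space" and s :: real
    by (rule continuous_on_subset[OF that]) auto
  have zero: "cinner (d t) (\<Phi> (cut n 0) y) = 0" for n y
  proof -
    define \<phi> where "\<phi> k s = cinner (d s) (\<Phi> (cut n k) y)" for k s
    define c where "c = minus_i_powr \<alpha>"
    have \<phi>c: "continuous_on {0..} (\<phi> k)" for k
      unfolding \<phi>_def by (rule bounded_linear.continuous_on[OF bounded_linear_cinner_left d])
    \<comment> \<open>Testing the vector equation with a truncated vector couples the scalar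
      function of index k to that of index k + 1.\<close>
    have step0: "frac_conv (1 - \<alpha>) (\<phi> k) s = c * frac_conv 1 (\<phi> (Suc k)) s" if s: "0 \<le> s" for k s
    proof -
      have "frac_conv (1 - \<alpha>) (\<phi> k) s = cinner (frac_conv (1 - \<alpha>) d s) (\<Phi> (cut n k) y)"
        unfolding \<phi>_def using \<alpha> s by (intro frac_conv_linear[OF bounded_linear_cinner_left] sub d) auto
      also have "\<dots> = integral {0..s} (\<lambda>r. cinner (c *\<^sub>C A (d r)) (\<Phi> (cut n k) y))"
      proof -
        have "(\<lambda>r. c *\<^sub>C A (d r)) integrable_on {0..s}"
          by (intro integrable_continuous_interval bounded_linear.continuous_on[OF bounded_linear_scaleC] sub Ad)
        from integral_linear[OF this bounded_linear_cinner_left, of "\<Phi> (cut n k) y"]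
        show ?thesis unfolding eq[OF s] c_def by (simp add: comp_def)
      qed
      also have "\<dots> = integral {0..s} (\<lambda>r. c * \<phi> (Suc k) r)"
      proof (rule integral_cong)
        fix r assume "r \<in> {0..s}"
        then have "d r \<in> D" using dD by simp
        from A_cut[OF this, of n k y] show "cinner (c *\<^sub>C A (d r)) (\<Phi> (cut n k) y) = c * \<phi> (Suc k) r"
          by (simp add: \<phi>_def cinner_scaleC_left)
      qed
      also have "\<dots> = c * frac_conv 1 (\<phi> (Suc k)) s" by (simp add: frac_conv_one)
      finally show ?thesis .
    qed
    \<comment> \<open>Integrating to order \<alpha> on both sides raises 1 - \<alpha> to 1 on the
      left and 1 to 1 + \<alpha> on the right, so each step gains an order \<alpha>.\<close>
    have step1: "frac_conv 1 (\<phi> k) s = c * frac_conv (1 + \<alpha>) (\<phi> (Suc k)) s" if s: "0 \<le> s" for k s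
    proof -
      have "frac_conv 1 (\<phi> k) s = frac_conv \<alpha> (frac_conv (1 - \<alpha>) (\<phi> k)) s"
        using frac_conv_semigroup[OF \<alpha>(1) _ s \<phi>c, of "1 - \<alpha>" k] \<alpha> by simp
      also have "\<dots> = frac_conv \<alpha> (\<lambda>r. c * frac_conv 1 (\<phi> (Suc k)) r) s"
        by (rule frac_conv_cong) (simp add: step0)
      also have "\<dots> = c * frac_conv \<alpha> (frac_conv 1 (\<phi> (Suc k))) s"
        by (intro frac_conv_cmult \<alpha> s sub continuous_on_frac_conv \<phi>c) simp
      also have "\<dots> = c * frac_conv (1 + \<alpha>) (\<phi> (Suc k)) s"
        using frac_conv_semigroup[OF \<alpha>(1) _ s \<phi>c, of 1 "Suc k"] by (simp add: add.commute)
      finally show ?thesis .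
    qed
    \<comment> \<open>The case k = 0 is separate because the semigroup law is available only for
      positive orders.\<close>
    have step: "frac_conv (1 + \<alpha> * real k) (\<phi> k) s = c * frac_conv (1 + \<alpha> * real (Suc k)) (\<phi> (Suc k)) s"
      if s: "0 \<le> s" for k s
    proof (cases "k = 0")
      case True
      then show ?thesis using step1[OF s, of 0] by simp
    next
      case False
      then have ak: "0 < \<alpha> * real k" using \<alpha> by simp
      have "frac_conv (1 + \<alpha> * real k) (\<phi> k) s = frac_conv (\<alpha> * real k) (frac_conv 1 (\<phi> k)) s"
        using frac_conv_semigroup[OF ak _ s \<phi>c, of 1 k] by (simp add: add.commute)
      also have "\<dots> = frac_conv (\<alpha> * real k) (\<lambda>r. c * frac_conv (1 + \<alpha>) (\<phi> (Suc k)) r) s"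
        by (rule frac_conv_cong) (simp add: step1)
      also have "\<dots> = c * frac_conv (\<alpha> * real k) (frac_conv (1 + \<alpha>) (\<phi> (Suc k))) s"
        using \<alpha> by (intro frac_conv_cmult ak s sub continuous_on_frac_conv \<phi>c) simp
      also have "\<dots> = c * frac_conv (1 + \<alpha> * real (Suc k)) (\<phi> (Suc k)) s"
        using frac_conv_semigroup[OF ak _ s \<phi>c, of "1 + \<alpha>" "Suc k"] \<alpha> by (simp add: algebra_simps)
      finally show ?thesis .
    qed
    have iter: "frac_conv 1 (\<phi> 0) s = c ^ k * frac_conv (1 + \<alpha> * real k) (\<phi> k) s" if s: "0 \<le> s" for k s
    proof (induction k)
      case (Suc k)
      then show ?case using step[OF s, of k] by (simp add: mult_ac)
    qed simp
    have int0: "integral {0..s} (\<phi> 0) = 0" if s: "0 \<le> s" for s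
    proof -
      have "bounded (d ` {0..s})"
        by (intro compact_imp_bounded compact_continuous_image sub d) simp
      then obtain M0 where M0: "\<forall>r\<in>{0..s}. norm (d r) \<le> M0" unfolding bounded_iff by auto
      define L where "L = norm y"
      have M00: "0 \<le> M0" using M0 s norm_ge_zero order_trans by (metis atLeastAtMost_iff order_refl)
      have \<phi>b: "norm (\<phi> k r) \<le> M0 * (real n ^ k * L)" if "0 \<le> r" "r \<le> s" for k r
      proof -
        have "norm (\<phi> k r) \<le> norm (d r) * norm (\<Phi> (cut n k) y)" unfolding \<phi>_def by (rule cinner_Cauchy_Schwarz)
        also have "\<dots> \<le> M0 * (real n ^ k * L)"
          unfolding L_def using M0 M00 that by (intro mult_mono \<Phi>_norm[OF cut_bdd cut_bound]) auto
        finally show ?thesis .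
      qed
      \<comment> \<open>Here T^\<alpha> = 2 (s^\<alpha> n + 1), so the Gamma bound beats the growth
        (s^\<alpha> n)^k by a factor 2^(-k). The summand 1 keeps the base positive when s = 0 or n =
        0.\<close>
      define T where "T = (2 * (s powr \<alpha> * real n + 1)) powr (1 / \<alpha>)"
      have base: "0 < 2 * (s powr \<alpha> * real n + 1)" by (simp add: add_nonneg_pos)
      have T0: "0 < T" using base by (simp add: T_def)
      have bound: "norm (frac_conv 1 (\<phi> 0) s) \<le> (s / T * exp T * M0 * L) * (1/2) ^ k" for k
      proof -
        have ak: "0 < 1 + \<alpha> * real k" using \<alpha> by (simp add: add_pos_nonneg)
        have "norm (frac_conv 1 (\<phi> 0) s) = norm (frac_conv (1 + \<alpha> * real k) (\<phi> k) s)"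
          unfolding iter[OF s, of k] by (simp add: norm_mult norm_power c_def)
        also have "\<dots> \<le> s powr (1 + \<alpha> * real k) / Gamma (1 + \<alpha> * real k + 1) * (M0 * (real n ^ k * L))"
          by (rule norm_frac_conv_le[OF ak s sub[OF \<phi>c] \<phi>b])
        also have "\<dots> \<le> s powr (1 + \<alpha> * real k) / (T powr (1 + \<alpha> * real k) * exp (- T)) * (M0 * (real n ^ k * L))"
          using Gamma_lower_bound[of "1 + \<alpha> * real k" T] ak T0 M00
          by (intro mult_right_mono divide_left_mono) (auto simp: L_def intro!: mult_pos_pos Gamma_real_pos add_pos_nonneg)
        also have "s powr (1 + \<alpha> * real k) = s * (s powr \<alpha>) ^ k"
        proof (cases "s = 0")
          case False
          then show ?thesis using s by (simp add: powr_add powr_powr[symmetric] powr_realpow)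
        qed simp
        also have "T powr (1 + \<alpha> * real k) = T * (2 * (s powr \<alpha> * real n + 1)) ^ k"
        proof -
          have "T powr (\<alpha> * real k) = (2 * (s powr \<alpha> * real n + 1)) ^ k"
            using base \<alpha> by (simp add: T_def powr_powr powr_realpow)
          then show ?thesis using T0 by (simp add: powr_add)
        qed
        also have "s * (s powr \<alpha>) ^ k / (T * (2 * (s powr \<alpha> * real n + 1)) ^ k * exp (- T)) * (M0 * (real n ^ k * L))
            = (s / T * exp T * M0 * L) * (s powr \<alpha> * real n / (2 * (s powr \<alpha> * real n + 1))) ^ k"
          by (simp add: exp_minus power_mult_distrib power_divide field_simps)
        also have "\<dots> \<le> (s / T * exp T * M0 * L) * (1/2) ^ k"
        proof (intro mult_left_mono power_mono)
          have q: "0 \<le> s powr \<alpha> * real n" by simp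
          have "q / (2 * (q + 1)) \<le> 1 / 2" if "0 \<le> q" for q :: real using that by (simp add: divide_simps)
          from this[OF q] show "s powr \<alpha> * real n / (2 * (s powr \<alpha> * real n + 1)) \<le> 1 / 2" .
          show "0 \<le> s powr \<alpha> * real n / (2 * (s powr \<alpha> * real n + 1))" using q by simp
          show "0 \<le> s / T * exp T * M0 * L" using s T0 M00 by (simp add: L_def)
        qed
        finally show ?thesis .
      qed
      have "(\<lambda>k. (s / T * exp T * M0 * L) * (1/2) ^ k) \<longlonglongrightarrow> 0"
        by (intro tendsto_mult_right_zero LIMSEQ_power_zero) simp
      then have "norm (frac_conv 1 (\<phi> 0) s) \<le> 0"
        by (rule LIMSEQ_le_const) (use bound in auto)
      then show ?thesis by (simp add: frac_conv_one)
    qed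
    have "\<phi> 0 t = 0" by (rule continuous_zero_if_integrals_zero[OF \<phi>c int0 t])
    then show ?thesis by (simp add: \<phi>_def)
  qed
  have "cinner (d t) y = 0" for y
    using tendsto_cinner_right[OF cut_tendsto[of y], of "d t"] zero by (simp add: LIMSEQ_const_iff)
  from this[of "d t"] show ?thesis by (simp add: cinner_self)
qed

text \<open>In the difference of two solutions the singular kernel terms cancel, so the equation can
  be integrated from 0. This produces exactly the integral equation of
  \<open>homogeneous_solution_zero\<close>.\<close>

theorem strong_solution_unique:
  assumes v: "strong_solution \<alpha> D A u0 v" and w: "strong_solution \<alpha> D A u0 w" and t: "0 \<le> t"
  shows "v t = w t"
proof -
  define d where "d t = v t - w t" for t
  have vD: "v t \<in> D" "w t \<in> D" if "0 \<le> t" for t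
    using v w that by (auto simp: strong_solution_def)
  have dD: "d t \<in> D" and Ad: "A (d t) = A (v t) - A (w t)" if "0 \<le> t" for t
    using D_diff[OF vD(1) vD(2)] that by (auto simp: d_def)
  note cv = strong_solution_continuous[OF v] and cw = strong_solution_continuous[OF w]
  have dc: "continuous_on {0..} d" unfolding d_def by (intro continuous_intros cv cw)
  have Adc: "continuous_on {0..} (\<lambda>t. A (d t))"
    by (rule continuous_on_eq[OF continuous_on_diff[OF cv(2) cw(2)]]) (simp add: Ad)
  \<comment> \<open>The C^1 condition turns the \<open>vector_derivative\<close> inside
    \<open>caputo\<close> into a genuine derivative.\<close>
  have der: "(frac_conv (1 - \<alpha>) f has_vector_derivative minus_i_powr \<alpha> *\<^sub>C A (f s) + frac_kernel (1 - \<alpha>) s *\<^sub>R u0) (at s)"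
    if f: "strong_solution \<alpha> D A u0 f" and s: "0 < s" for f s
  proof -
    have "caputo \<alpha> f s = minus_i_powr \<alpha> *\<^sub>C A (f s)" "f 0 = u0"
      and "frac_conv (1 - \<alpha>) f C1_differentiable_on {0<..}"
      using f s by (auto simp: strong_solution_def)
    moreover from this(3) have "frac_conv (1 - \<alpha>) f differentiable at s"
      using s unfolding C1_differentiable_on_def by (auto intro: differentiableI_vector)
    ultimately show ?thesis
      unfolding vector_derivative_works by (simp add: caputo_def diff_eq_eq)
  qed
  have eq: "frac_conv (1 - \<alpha>) d s = integral {0..s} (\<lambda>r. minus_i_powr \<alpha> *\<^sub>C A (d r))" if s: "0 \<le> s" for s
  proof -
    have a1: "0 < 1 - \<alpha>" using \<alpha> by simp
    have fd: "frac_conv (1 - \<alpha>) d r = frac_conv (1 - \<alpha>) v r - frac_conv (1 - \<alpha>) w r" if "0 \<le> r" for r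
      unfolding d_def[abs_def]
      using that by (intro frac_conv_diff[OF a1] continuous_on_subset[OF cv(1)] continuous_on_subset[OF cw(1)]) auto
    \<comment> \<open>The derivative is known only for r > 0; continuity of the fractional integral
      at 0, where it vanishes, supplies the lower endpoint.\<close>
    have "((\<lambda>r. minus_i_powr \<alpha> *\<^sub>C A (d r)) has_integral frac_conv (1 - \<alpha>) d s - frac_conv (1 - \<alpha>) d 0) {0..s}"
    proof (rule fundamental_theorem_of_calculus_interior[OF s])
      show "continuous_on {0..s} (frac_conv (1 - \<alpha>) d)"
        by (rule continuous_on_subset[OF continuous_on_frac_conv[OF a1 dc]]) auto
      fix r assume r: "r \<in> {0<..<s}"
      have "((\<lambda>r. frac_conv (1 - \<alpha>) v r - frac_conv (1 - \<alpha>) w r) has_vector_derivative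
          (minus_i_powr \<alpha> *\<^sub>C A (v r) + frac_kernel (1 - \<alpha>) r *\<^sub>R u0) - (minus_i_powr \<alpha> *\<^sub>C A (w r) + frac_kernel (1 - \<alpha>) r *\<^sub>R u0)) (at r)"
        using r by (intro has_vector_derivative_diff der v w) auto
      then have "((\<lambda>r. frac_conv (1 - \<alpha>) v r - frac_conv (1 - \<alpha>) w r) has_vector_derivative minus_i_powr \<alpha> *\<^sub>C A (d r)) (at r)"
        using r by (simp add: Ad scaleC_diff_right)
      then show "(frac_conv (1 - \<alpha>) d has_vector_derivative minus_i_powr \<alpha> *\<^sub>C A (d r)) (at r)"
        by (rule has_vector_derivative_transform_within_open[of _ _ _ "{0<..}"]) (use r fd in auto)
    qed
    moreover have "frac_conv (1 - \<alpha>) d 0 = 0" by (simp add: frac_conv_def)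
    ultimately show ?thesis by (simp add: integral_unique)
  qed
  have "d t = 0" by (rule homogeneous_solution_zero[OF dD dc Adc eq t])
  then show ?thesis by (simp add: d_def)
qed

section \<open>The unitary map and the representation formula\<close>

definition W :: "('b \<Rightarrow> complex) set \<Rightarrow> 'h" where
  "W F = (THE w. V w \<in> F)"

lemma L2_class_mem: "g \<in> L2_class M f \<longleftrightarrow> g \<in> square_integrable M \<and> (AE z in M. g z = f z)"
  by (simp add: L2_class_def)

lemma L2_class_cong:
  assumes "AE z in M. f z = g z" shows "L2_class M f = L2_class M g"
proof -
  have "(AE z in M. h z = f z) \<longleftrightarrow> (AE z in M. h z = g z)" for h
  proof
    assume "AE z in M. h z = f z"
    then show "AE z in M. h z = g z" using assms by eventually_elim simp
  next
    assume "AE z in M. h z = g z"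
    then show "AE z in M. h z = f z" using assms by eventually_elim simp
  qed
  then show ?thesis by (auto simp: L2_class_def)
qed

lemma W_class:
  assumes "AE z in M. V w z = f z" shows "W (L2_class M f) = w"
  unfolding W_def
proof (rule the_equality)
  show "V w \<in> L2_class M f" using assms V_sq by (simp add: L2_class_mem)
  fix v assume "V v \<in> L2_class M f"
  then have "AE z in M. V v z = f z" by (simp add: L2_class_mem)
  then have "AE z in M. V v z = V w z" using assms by eventually_elim simp
  then show "v = w" by (rule V_eqI)
qed

lemma W_V: "W (L2_class M (V w)) = w"
  by (rule W_class) simp

lemma L2_cases:
  assumes "F \<in> L2 M" obtains w where "F = L2_class M (V w)" "W F = w"
proof -
  obtain f where f: "f \<in> square_integrable M" "F = L2_class M f" using assms by (auto simp: L2_def)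
  obtain w where w: "AE z in M. V w z = f z" using V_surj[OF f(1)] by blast
  show ?thesis using that[of w] L2_class_cong[OF w] W_class[OF w] f(2) by simp
qed

lemma unitary_W: "unitary_L2 M W"
  unfolding unitary_L2_def
proof (intro conjI ballI allI)
  show "bij_betw W (L2 M) UNIV"
  proof (rule bij_betwI')
    show "W F = W F' \<longleftrightarrow> F = F'" if "F \<in> L2 M" "F' \<in> L2 M" for F F'
      using L2_cases[OF that(1)] L2_cases[OF that(2)] by metis
    show "\<exists>F\<in>L2 M. w = W F" for w
      by (intro bexI[of _ "L2_class M (V w)"]) (auto simp: W_V L2_def V_sq)
  qed simp
next
  fix f g assume fg: "f \<in> square_integrable M" "g \<in> square_integrable M"
  obtain w where w: "AE z in M. V w z = f z" using V_surj[OF fg(1)] by blast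
  obtain v where v: "AE z in M. V v z = g z" using V_surj[OF fg(2)] by blast
  have wv: "AE z in M. V (w + v) z = f z + g z"
    using w v V_add[of w v] by eventually_elim simp
  then show "W (L2_class M (\<lambda>x. f x + g x)) = W (L2_class M f) + W (L2_class M g)"
    by (simp only: W_class[OF w] W_class[OF v] W_class[OF wv])
  have "cinner w v = (LINT z|M. V w z * cnj (V v z))" by (simp add: V_inner)
  also have "\<dots> = (LINT x|M. f x * cnj (g x))"
  proof (rule integral_cong_AE)
    note [measurable] = square_integrableD(1)[OF fg(1)] square_integrableD(1)[OF fg(2)]
    show "(\<lambda>z. V w z * cnj (V v z)) \<in> borel_measurable M" by measurable
    show "(\<lambda>x. f x * cnj (g x)) \<in> borel_measurable M" by measurable
    show "AE z in M. V w z * cnj (V v z) = f z * cnj (g z)" using w v by eventually_elim simp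
  qed
  finally show "cinner (W (L2_class M f)) (W (L2_class M g)) = (LINT x|M. f x * cnj (g x))"
    using W_class[OF w] W_class[OF v] by simp
next
  fix c f assume f: "f \<in> square_integrable M"
  obtain w where w: "AE z in M. V w z = f z" using V_surj[OF f] by blast
  have cw: "AE z in M. V (c *\<^sub>C w) z = c * f z" using w V_scale[of c w] by eventually_elim simp
  then show "W (L2_class M (\<lambda>x. c * f x)) = c *\<^sub>C W (L2_class M f)"
    by (simp only: W_class[OF w] W_class[OF cw])
qed

text \<open>A class contains the chosen representative \<open>V w\<close> of exactly one vector
  \<open>w\<close>, which is how \<open>W\<close> reads it; going back attaches the class to that
  representative.\<close>

lemma inv_into_W: "inv_into (L2 M) W u = L2_class M (V u)"
proof (rule inv_into_f_eq)
  show "inj_on W (L2 M)" using unitary_W by (simp add: unitary_L2_def bij_betw_def)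
  show "L2_class M (V u) \<in> L2 M" by (auto simp: L2_def V_sq)
  show "W (L2_class M (V u)) = u" by (rule W_V)
qed

text \<open>Boundedness of the multiplier guarantees a square-integrable product, so the result is a
  genuine element of \<open>L2 M\<close> and not the empty default.\<close>

lemma L2_mult_class:
  assumes "bdd_fun \<phi>"
  shows "L2_mult M (\<lambda>z. \<phi> (a z)) (L2_class M (V u)) = L2_class M (V (\<Phi> \<phi> u))"
proof -
  note * = V_\<Phi>[OF assms, of u]
  have "(\<exists>f\<in>L2_class M (V u). AE z in M. h z = \<phi> (a z) * f z) \<longleftrightarrow> (AE z in M. h z = V (\<Phi> \<phi> u) z)" for h
  proof
    assume "\<exists>f\<in>L2_class M (V u). AE z in M. h z = \<phi> (a z) * f z"
    then obtain f where "AE z in M. f z = V u z" "AE z in M. h z = \<phi> (a z) * f z" by (auto simp: L2_class_mem)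
    then show "AE z in M. h z = V (\<Phi> \<phi> u) z" using * by eventually_elim simp
  next
    assume "AE z in M. h z = V (\<Phi> \<phi> u) z"
    then have "AE z in M. h z = \<phi> (a z) * V u z" using * by eventually_elim simp
    then show "\<exists>f\<in>L2_class M (V u). AE z in M. h z = \<phi> (a z) * f z"
      by (intro bexI[of _ "V u"]) (auto simp: L2_class_mem V_sq)
  qed
  then show ?thesis by (simp add: L2_mult_def L2_class_def)
qed

lemma representation:
  assumes u0: "u0 \<in> D" and u: "strong_solution \<alpha> D A u0 u" and t: "0 \<le> t"
  shows "let F = L2_mult M (\<lambda>x. mittag_leffler \<alpha> (minus_it_powr \<alpha> t * of_real (a x))) (inv_into (L2 M) W u0)
    in F \<in> L2 M \<and> u t = W F"
proof -
  have "u t = \<Phi> (e t) u0"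
    by (rule strong_solution_unique[OF u strong_solution_exists[OF u0] t])
  moreover have "L2_mult M (\<lambda>x. mittag_leffler \<alpha> (minus_it_powr \<alpha> t * of_real (a x))) (inv_into (L2 M) W u0)
      = L2_class M (V (\<Phi> (e t) u0))"
    unfolding inv_into_W using L2_mult_class[OF e_bdd[OF t], of u0] by (simp add: e_def)
  moreover have "W (L2_class M (V (\<Phi> (e t) u0))) = \<Phi> (e t) u0" by (rule W_V)
  moreover have "L2_class M (V (\<Phi> (e t) u0)) \<in> L2 M" by (auto simp: L2_def V_sq)
  ultimately show ?thesis by (simp add: Let_def)
qed

end

theorem theorem1:
  fixes \<alpha> :: real
    and D :: "'h::complex_hilbert_space set"
    and A :: "'h \<Rightarrow> 'h"
  assumes "0 < \<alpha>" and "\<alpha> < 1"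
    and "positive_self_adjoint D A"
  shows "(\<forall>u0\<in>D. \<exists>u. strong_solution \<alpha> D A u0 u \<and>
            (\<forall>v. strong_solution \<alpha> D A u0 v \<longrightarrow> (\<forall>t\<ge>0. v t = u t))) \<and>
         (\<exists>(M :: ('h \<times> real) measure) (a :: 'h \<times> real \<Rightarrow> real)
            (W :: ('h \<times> real \<Rightarrow> complex) set \<Rightarrow> 'h).
            a \<in> borel_measurable M \<and> unitary_L2 M W \<and>
            (\<forall>u0\<in>D. \<forall>u. strong_solution \<alpha> D A u0 u \<longrightarrow>
               (\<forall>t\<ge>0.
                  let F = L2_mult M
                            (\<lambda>x. mittag_leffler \<alpha> (minus_it_powr \<alpha> t * of_real (a x)))
                            (inv_into (L2 M) W u0)
                  in F \<in> L2 M \<and> u t = W F)))"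
proof -
  obtain B where B: "\<And>w. B w \<in> D" "\<And>w. B w + A (B w) = w" "\<And>x. x \<in> D \<Longrightarrow> B (x + A x) = x"
    "\<And>x y. B (x + y) = B x + B y" "\<And>c x. B (c *\<^sub>C x) = c *\<^sub>C B x"
    "\<And>x y. cinner (B x) y = cinner x (B y)"
    "\<And>x. norm (B x) \<le> norm x" "\<And>x. (norm (B x))\<^sup>2 \<le> Re (cinner (B x) x)"
    using resolvent_exists[OF assms(3)] by blast
  have lin: "linear_operator_on D A"
    using assms(3) unfolding positive_self_adjoint_def self_adjoint_def by blast
  then have "A (0 *\<^sub>C 0) = 0 *\<^sub>C A 0" unfolding linear_operator_on_def by blast
  then have A0: "A 0 = 0" by simp
  interpret contraction: positive_contraction B
  proof
    \<comment> \<open>From B x + A (B x) = x and A 0 = 0.\<close>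
    show "x = 0" if "B x = 0" for x using B(2)[of x] unfolding that by (simp add: A0)
  qed (rule B)+
  obtain M :: "('h \<times> real) measure" and a :: "'h \<times> real \<Rightarrow> real" and V :: "'h \<Rightarrow> 'h \<times> real \<Rightarrow> complex" where
    V: "\<And>w. V w \<in> square_integrable M" "\<And>w v. AE z in M. V (w + v) z = V w z + V v z"
    "\<And>c w. AE z in M. V (c *\<^sub>C w) z = c * V w z"
    "\<And>w v. (LINT z|M. V w z * cnj (V v z)) = cinner w v"
    "\<And>f. f \<in> square_integrable M \<Longrightarrow> \<exists>w. AE z in M. V w z = f z"
    "a \<in> borel_measurable M" "\<And>z. 0 \<le> a z"
    "\<And>w. AE z in M. V (B w) z = of_real (1 / (1 + a z)) * V w z"
    by (rule contraction.multiplication_form) (rule that)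
  interpret fractional_evolution M a V \<alpha> D A B
    by unfold_locales (fact V assms(1,2) lin B)+
  have "\<forall>u0\<in>D. \<exists>u. strong_solution \<alpha> D A u0 u \<and>
      (\<forall>v. strong_solution \<alpha> D A u0 v \<longrightarrow> (\<forall>t\<ge>0. v t = u t))"
    by (intro ballI exI conjI allI impI) (rule strong_solution_exists, assumption,
        rule strong_solution_unique, assumption, rule strong_solution_exists)
  moreover have "a \<in> borel_measurable M \<and> unitary_L2 M W \<and>
      (\<forall>u0\<in>D. \<forall>u. strong_solution \<alpha> D A u0 u \<longrightarrow>
         (\<forall>t\<ge>0. let F = L2_mult M (\<lambda>x. mittag_leffler \<alpha> (minus_it_powr \<alpha> t * of_real (a x)))
                      (inv_into (L2 M) W u0)
            in F \<in> L2 M \<and> u t = W F))"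
    by (intro conjI ballI allI impI V(6) unitary_W representation)
  ultimately show ?thesis
    by (elim conjE, intro conjI exI[of _ M] exI[of _ a] exI[of _ W])
qed

end
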